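(* Let $n\ge1$. For any $w\in D^{-1}(\mathbb{R}^n)$ there exists a sequence $w_k\in C^\infty_{c,av}(\mathbb{R}^n)$ such that $$w_k\to w\ \text{ in } D^{-1}(\mathbb{R}^n)\qquad\text{and}\qquad TV(w_k)\to TV(w).$$
   Context: $D^1_0(\mathbb{R}^n)$ is the completion of $C_c^\infty(\mathbb{R}^n)$ in the norm $\|\nabla u\|_{L^2}$; for $n\ge3$ it is identified with $\{u\in L^{2n/(n-2)}(\mathbb{R}^n):\nabla u\in L^2\}$, for $n\le2$ with $\{u\in L^1_{loc}(\mathbb{R}^n):\nabla u\in L^2\}$ modulo constants. $D^{-1}(\mathbb{R}^n)$ is its dual space (with the dual norm) and $\langle\cdot,\cdot\rangle$ the duality pairing. $C^\infty_{c,av}(\mathbb{R}^n)=\{u\in C_c^\infty(\mathbb{R}^n):\int u=0\}$, whose elements $u$ are regarded as elements of $D^{-1}(\mathbb{R}^n)$ through $\varphi\mapsto\int u\varphi$. The total variation $TV:D^{-1}(\mathbb{R}^n)\to[0,\infty]$ is $TV(u)=\sup\{\langle u,\operatorname{div}\varphi\rangle:\varphi\in C_c^\infty(\mathbb{R}^n;\mathbb{R}^n),\ \|\varphi\|_{L^\infty}\le1\}$ (for $n\le 2$, $\operatorname{div}\varphi$ stands for its class modulo constants). *)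

theory Defs
  imports "HOL-Analysis.Analysis"
begin

section \<open>Completion of a real normed vector space\<close>

text \<open>Cauchy sequences modulo sequences tending to zero in norm.\<close>

definition cauchy_equiv :: "(nat \<Rightarrow> 'v::real_normed_vector) \<Rightarrow> (nat \<Rightarrow> 'v) \<Rightarrow> bool"
  where "cauchy_equiv X Y \<longleftrightarrow> Cauchy X \<and> Cauchy Y \<and> (\<lambda>n. X n - Y n) \<longlonglongrightarrow> 0"

lemma Cauchy_const: "Cauchy (\<lambda>n. c :: 'v::real_normed_vector)"
  by (rule LIMSEQ_imp_Cauchy[OF tendsto_const])

lemma Cauchy_add:
  fixes X Y :: "nat \<Rightarrow> 'v::real_normed_vector"
  assumes "Cauchy X" "Cauchy Y"
  shows "Cauchy (\<lambda>n. X n + Y n)"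
proof (rule CauchyI)
  fix e :: real assume "0 < e"
  then have e2: "0 < e / 2" by simp
  obtain M where M: "\<And>m n. m \<ge> M \<Longrightarrow> n \<ge> M \<Longrightarrow> norm (X m - X n) < e / 2"
    using CauchyD[OF assms(1) e2] by blast
  obtain N where N: "\<And>m n. m \<ge> N \<Longrightarrow> n \<ge> N \<Longrightarrow> norm (Y m - Y n) < e / 2"
    using CauchyD[OF assms(2) e2] by blast
  have "norm ((X m + Y m) - (X n + Y n)) < e" if "m \<ge> max M N" "n \<ge> max M N" for m n
  proof -
    have "(X m + Y m) - (X n + Y n) = (X m - X n) + (Y m - Y n)" by simp
    then have "norm ((X m + Y m) - (X n + Y n)) \<le> norm (X m - X n) + norm (Y m - Y n)"
      by (metis norm_triangle_ineq)
    also have "\<dots> < e" using M[of m n] N[of m n] that by simp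
    finally show ?thesis .
  qed
  then show "\<exists>K. \<forall>m\<ge>K. \<forall>n\<ge>K. norm ((X m + Y m) - (X n + Y n)) < e" by blast
qed

lemma Cauchy_scaleR: "Cauchy X \<Longrightarrow> Cauchy (\<lambda>n. r *\<^sub>R (X n :: 'v::real_normed_vector))"
  by (rule bounded_linear.Cauchy[OF bounded_linear_scaleR_right])

lemma Cauchy_minus: "Cauchy X \<Longrightarrow> Cauchy (\<lambda>n. - (X n :: 'v::real_normed_vector))"
  using Cauchy_scaleR[of X "-1"] by simp

lemma Cauchy_diff:
  "Cauchy X \<Longrightarrow> Cauchy Y \<Longrightarrow> Cauchy (\<lambda>n. X n - (Y n :: 'v::real_normed_vector))"
  using Cauchy_add[of X "\<lambda>n. - Y n"] Cauchy_minus[of Y] by simp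

lemma Cauchy_norm_convergent:
  fixes X :: "nat \<Rightarrow> 'v::real_normed_vector"
  assumes "Cauchy X"
  shows "convergent (\<lambda>n. norm (X n))"
proof -
  have "Cauchy (\<lambda>n. norm (X n))"
  proof (rule CauchyI)
    fix e :: real assume "0 < e"
    then obtain M where "\<forall>m\<ge>M. \<forall>n\<ge>M. norm (X m - X n) < e"
      using CauchyD[OF assms] by blast
    then show "\<exists>M. \<forall>m\<ge>M. \<forall>n\<ge>M. norm (norm (X m) - norm (X n)) < e"
      using norm_triangle_ineq3 by (metis order_le_less_trans real_norm_def)
  qed
  then show ?thesis by (simp add: Cauchy_convergent)
qed

lemma Cauchy_norm_LIMSEQ:
  "Cauchy X \<Longrightarrow> (\<lambda>n. norm (X n)) \<longlonglongrightarrow> lim (\<lambda>n. norm (X n :: 'v::real_normed_vector))"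
  using Cauchy_norm_convergent convergent_LIMSEQ_iff by blast

lemma part_equivp_cauchy_equiv:
  "part_equivp (cauchy_equiv :: (nat \<Rightarrow> 'a::real_normed_vector) \<Rightarrow> _)" (is "part_equivp ?R")
proof (rule part_equivpI)
  show "\<exists>x. ?R x x"
    by (rule exI[of _ "\<lambda>n. 0"]) (simp add: cauchy_equiv_def Cauchy_const)
  show "symp ?R"
  proof (rule sympI)
    fix x y :: "nat \<Rightarrow> 'a"
    assume xy: "cauchy_equiv x y"
    then have "(\<lambda>n. x n - y n) \<longlonglongrightarrow> 0" by (simp add: cauchy_equiv_def)
    from tendsto_minus[OF this] show "cauchy_equiv y x"
      using xy by (simp add: cauchy_equiv_def)
  qed
  show "transp ?R"
  proof (rule transpI)
    fix x y z :: "nat \<Rightarrow> 'a"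
    assume xyz: "cauchy_equiv x y" "cauchy_equiv y z"
    then have "(\<lambda>n. x n - y n) \<longlonglongrightarrow> 0" "(\<lambda>n. y n - z n) \<longlonglongrightarrow> 0"
      by (simp_all add: cauchy_equiv_def)
    from tendsto_add[OF this] show "cauchy_equiv x z"
      using xyz by (simp add: cauchy_equiv_def)
  qed
qed

quotient_type (overloaded) 'v normed_completion = "nat \<Rightarrow> 'v::real_normed_vector" / partial: cauchy_equiv
  morphisms rep_completion abs_completion
  by (rule part_equivp_cauchy_equiv)

lemma normed_completion_cases:
  obtains X where "Cauchy X" "x = abs_completion X"
proof -
  have "cauchy_equiv (rep_completion x) (rep_completion x)" "abs_completion (rep_completion x) = x"
    using Quotient3_rep_reflp[OF Quotient3_normed_completion]
      Quotient3_abs_rep[OF Quotient3_normed_completion] by blast+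
  then show thesis using that unfolding cauchy_equiv_def by metis
qed

instantiation normed_completion :: (real_normed_vector) real_normed_vector
begin

lift_definition zero_normed_completion :: "'a normed_completion" is "\<lambda>n. 0"
  by (simp add: cauchy_equiv_def Cauchy_const)

lift_definition plus_normed_completion ::
  "'a normed_completion \<Rightarrow> 'a normed_completion \<Rightarrow> 'a normed_completion"
  is "\<lambda>X Y n. X n + Y n"
  unfolding cauchy_equiv_def
  by (auto intro!: Cauchy_add simp: add_diff_add intro: tendsto_add_zero)

lift_definition uminus_normed_completion :: "'a normed_completion \<Rightarrow> 'a normed_completion"
  is "\<lambda>X n. - X n"
proof -
  fix X Y :: "nat \<Rightarrow> 'a" assume "cauchy_equiv X Y"
  then show "cauchy_equiv (\<lambda>n. - X n) (\<lambda>n. - Y n)"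
    unfolding cauchy_equiv_def
    using tendsto_minus[of "\<lambda>n. X n - Y n" 0 sequentially]
    by (simp add: Cauchy_minus)
qed

definition minus_normed_completion ::
  "'a normed_completion \<Rightarrow> 'a normed_completion \<Rightarrow> 'a normed_completion"
  where "minus_normed_completion x y = x + (- y)"

lift_definition scaleR_normed_completion :: "real \<Rightarrow> 'a normed_completion \<Rightarrow> 'a normed_completion"
  is "\<lambda>r X n. r *\<^sub>R X n"
proof -
  fix r :: real and X Y :: "nat \<Rightarrow> 'a" assume "cauchy_equiv X Y"
  then show "cauchy_equiv (\<lambda>n. r *\<^sub>R X n) (\<lambda>n. r *\<^sub>R Y n)"
    unfolding cauchy_equiv_def
    using tendsto_scaleR[OF tendsto_const, of "\<lambda>n. X n - Y n" 0 sequentially r]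
    by (simp add: Cauchy_scaleR scaleR_diff_right)
qed

lift_definition norm_normed_completion :: "'a normed_completion \<Rightarrow> real"
  is "\<lambda>X. lim (\<lambda>n. norm (X n))"
proof -
  fix X Y :: "nat \<Rightarrow> 'a" assume "cauchy_equiv X Y"
  then have c: "Cauchy X" "Cauchy Y" and 0: "(\<lambda>n. X n - Y n) \<longlonglongrightarrow> 0"
    unfolding cauchy_equiv_def by auto
  have "(\<lambda>n. norm (X n) - norm (Y n)) \<longlonglongrightarrow> 0"
    by (rule Lim_null_comparison[OF _ tendsto_norm_zero[OF 0]])
       (simp add: norm_triangle_ineq3)
  moreover have "(\<lambda>n. norm (X n) - norm (Y n)) \<longlonglongrightarrow>
      lim (\<lambda>n. norm (X n)) - lim (\<lambda>n. norm (Y n))"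
    by (intro tendsto_diff Cauchy_norm_LIMSEQ c)
  ultimately show "lim (\<lambda>n. norm (X n)) = lim (\<lambda>n. norm (Y n))"
    using LIMSEQ_unique by fastforce
qed

definition dist_normed_completion :: "'a normed_completion \<Rightarrow> 'a normed_completion \<Rightarrow> real"
  where "dist_normed_completion x y = norm (x - y)"

definition sgn_normed_completion :: "'a normed_completion \<Rightarrow> 'a normed_completion"
  where "sgn_normed_completion x = inverse (norm x) *\<^sub>R x"

definition uniformity_normed_completion ::
  "('a normed_completion \<times> 'a normed_completion) filter"
  where "uniformity_normed_completion = (INF e\<in>{0 <..}. principal {(x, y). dist x y < e})"

definition open_normed_completion :: "'a normed_completion set \<Rightarrow> bool"
  where "open_normed_completion S = (\<forall>x\<in>S. \<forall>\<^sub>F (x', y) in uniformity. x' = x \<longrightarrow> y \<in> S)"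

instance
proof
  fix x y z :: "'a normed_completion" and r s :: real
  show "x + y + z = x + (y + z)"
    by transfer (simp add: cauchy_equiv_def Cauchy_add add.assoc)
  show "x + y = y + x"
    by transfer (simp add: cauchy_equiv_def Cauchy_add add.commute)
  show "0 + x = x"
    by transfer (simp add: cauchy_equiv_def)
  show "- x + x = 0"
    by transfer (simp add: cauchy_equiv_def Cauchy_const)
  show "x - y = x + - y"
    by (simp add: minus_normed_completion_def)
  show "r *\<^sub>R (x + y) = r *\<^sub>R x + r *\<^sub>R y"
    by transfer (simp add: cauchy_equiv_def Cauchy_add Cauchy_scaleR scaleR_add_right)
  show "(r + s) *\<^sub>R x = r *\<^sub>R x + s *\<^sub>R x"
    by transfer (simp add: cauchy_equiv_def Cauchy_add Cauchy_scaleR scaleR_add_left)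
  show "r *\<^sub>R s *\<^sub>R x = (r * s) *\<^sub>R x"
    by transfer (simp add: cauchy_equiv_def Cauchy_scaleR)
  show "1 *\<^sub>R x = x"
    by transfer (simp add: cauchy_equiv_def)
  show "dist x y = norm (x - y)"
    by (rule dist_normed_completion_def)
  show "sgn x = inverse (norm x) *\<^sub>R x"
    by (rule sgn_normed_completion_def)
  show "(uniformity :: ('a normed_completion \<times> 'a normed_completion) filter) =
      (INF e\<in>{0 <..}. principal {(x, y). dist x y < e})"
    by (rule uniformity_normed_completion_def)
  show "open U = (\<forall>x\<in>U. \<forall>\<^sub>F (x', y) in uniformity. x' = x \<longrightarrow> y \<in> U)"
    for U :: "'a normed_completion set"
    by (rule open_normed_completion_def)
  show "(norm x = 0) = (x = 0)"
  proof (transfer, unfold cauchy_equiv_def, safe)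
    fix X :: "nat \<Rightarrow> 'a"
    assume c: "Cauchy X" and "lim (\<lambda>n. norm (X n)) = 0"
    with Cauchy_norm_LIMSEQ[OF c] show "(\<lambda>n. X n - 0) \<longlonglongrightarrow> 0"
      by (simp add: tendsto_norm_zero_iff)
  next
    fix X :: "nat \<Rightarrow> 'a"
    assume "(\<lambda>n. X n - 0) \<longlonglongrightarrow> 0"
    then show "lim (\<lambda>n. norm (X n)) = 0"
      using tendsto_norm_zero limI by fastforce
  qed (simp_all add: Cauchy_const)
  show "norm (x + y) \<le> norm x + norm y"
  proof (transfer, unfold cauchy_equiv_def, elim conjE)
    fix X Y :: "nat \<Rightarrow> 'a"
    assume c: "Cauchy X" "Cauchy Y"
    show "lim (\<lambda>n. norm (X n + Y n)) \<le> lim (\<lambda>n. norm (X n)) + lim (\<lambda>n. norm (Y n))"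
      by (rule LIMSEQ_le[OF Cauchy_norm_LIMSEQ[OF Cauchy_add[OF c]]
            tendsto_add[OF Cauchy_norm_LIMSEQ[OF c(1)] Cauchy_norm_LIMSEQ[OF c(2)]]])
         (auto intro: norm_triangle_ineq)
  qed
  show "norm (r *\<^sub>R x) = \<bar>r\<bar> * norm x"
  proof (transfer, unfold cauchy_equiv_def, elim conjE)
    fix r :: real and X :: "nat \<Rightarrow> 'a"
    assume c: "Cauchy X"
    show "lim (\<lambda>n. norm (r *\<^sub>R X n)) = \<bar>r\<bar> * lim (\<lambda>n. norm (X n))"
      using tendsto_mult[OF tendsto_const Cauchy_norm_LIMSEQ[OF c], of "\<bar>r\<bar>"]
      by (intro limI) simp
  qed
qed

end

lift_definition to_completion :: "'v::real_normed_vector \<Rightarrow> 'v normed_completion" is "\<lambda>v n. v"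
  by (simp add: cauchy_equiv_def Cauchy_const)

lemma norm_to_completion [simp]: "norm (to_completion v) = norm v"
  by transfer simp

lemma to_completion_add: "to_completion (v + w) = to_completion v + to_completion w"
  by transfer (simp add: cauchy_equiv_def Cauchy_const)

lemma to_completion_scaleR: "to_completion (r *\<^sub>R v) = r *\<^sub>R to_completion v"
  by transfer (simp add: cauchy_equiv_def Cauchy_const)

lemma linear_to_completion: "linear to_completion"
  by (rule linearI) (simp_all add: to_completion_add to_completion_scaleR)

lemma to_completion_diff: "to_completion (v - w) = to_completion v - to_completion w"
  by (rule linear_diff[OF linear_to_completion])

lemma dist_to_completion [simp]: "dist (to_completion v) (to_completion w) = dist v w"
  by (simp add: dist_norm flip: to_completion_diff)

lemma to_completion_LIMSEQ_abs_completion: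
  assumes X: "Cauchy X"
  shows "(\<lambda>n. to_completion (X n)) \<longlonglongrightarrow> abs_completion X"
proof (rule LIMSEQ_I)
  fix e :: real assume "0 < e"
  then obtain M where M: "\<And>m n. m \<ge> M \<Longrightarrow> n \<ge> M \<Longrightarrow> norm (X m - X n) < e / 2"
    using CauchyD[OF X, of "e / 2"] by auto
  have "norm (to_completion (X n) - abs_completion X) < e" if n: "n \<ge> M" for n
  proof -
    have eq: "cauchy_equiv X X" "cauchy_equiv (\<lambda>m. X n) (\<lambda>m. X n)"
        "cauchy_equiv (\<lambda>m. - X m) (\<lambda>m. - X m)"
        "cauchy_equiv (\<lambda>m. X n + - X m) (\<lambda>m. X n + - X m)"
      using X by (simp_all add: cauchy_equiv_def Cauchy_const Cauchy_minus Cauchy_diff)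
    have "to_completion (X n) - abs_completion X = abs_completion (\<lambda>m. X n + - X m)"
      by (simp add: minus_normed_completion_def to_completion.abs_eq
          uminus_normed_completion.abs_eq[OF eq(1)] plus_normed_completion.abs_eq[OF eq(2,3)])
    then have "norm (to_completion (X n) - abs_completion X) = lim (\<lambda>m. norm (X n - X m))"
      using norm_normed_completion.abs_eq[OF eq(4)] by simp
    also have "\<dots> \<le> e / 2"
    proof (rule LIMSEQ_le_const2[OF Cauchy_norm_LIMSEQ])
      show "Cauchy (\<lambda>m. X n - X m)"
        by (intro Cauchy_diff Cauchy_const X)
      show "\<exists>N. \<forall>m\<ge>N. norm (X n - X m) \<le> e / 2"
        using M[OF n] less_imp_le by blast
    qed
    finally show ?thesis using \<open>0 < e\<close> by simp
  qed
  then show "\<exists>no. \<forall>n\<ge>no. norm (to_completion (X n) - abs_completion X) < e" by blast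
qed

lemma dense_range_to_completion:
  "closure (range (to_completion :: 'v::real_normed_vector \<Rightarrow> _)) = UNIV" (is "?C = _")
proof -
  have "x \<in> ?C" for x
  proof (cases x rule: normed_completion_cases)
    case (1 X)
    then show ?thesis
      by (auto simp: closure_sequential
          intro!: exI[of _ "\<lambda>n. to_completion (X n)"] to_completion_LIMSEQ_abs_completion)
  qed
  then show ?thesis by blast
qed

instance normed_completion :: (real_normed_vector) banach
proof
  fix F :: "nat \<Rightarrow> 'a normed_completion"
  assume F: "Cauchy F"
  have "\<exists>v. dist (to_completion v) (F n) < inverse (real (Suc n))" for n
  proof -
    have "F n \<in> closure (range to_completion)" by (simp add: dense_range_to_completion)
    then show ?thesis
      by (auto simp: closure_approachable)
  qed
  then obtain X where X: "\<And>n. dist (to_completion (X n)) (F n) < inverse (real (Suc n))" by metis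
  have lim0: "(\<lambda>n. to_completion (X n) - F n) \<longlonglongrightarrow> 0"
    by (rule Lim_null_comparison[OF _ LIMSEQ_inverse_real_of_nat])
       (use X in \<open>auto simp: dist_norm intro!: always_eventually less_imp_le\<close>)
  have "Cauchy (\<lambda>n. (to_completion (X n) - F n) + F n)"
    by (intro Cauchy_add F LIMSEQ_imp_Cauchy[OF lim0])
  then have "Cauchy X" by (simp add: Cauchy_def)
  from tendsto_diff[OF to_completion_LIMSEQ_abs_completion[OF this] lim0]
  show "convergent F" by (auto simp: convergent_def)
qed


section \<open>Smooth functions with compact support\<close>

text \<open>\<open>C_k k f\<close>: all iterated directional derivatives of \<open>f\<close> up to order \<open>k\<close> exist and are
  continuous.\<close>

primrec C_k :: "nat \<Rightarrow> ('a::real_normed_vector \<Rightarrow> 'b::real_normed_vector) \<Rightarrow> bool" where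
  "C_k 0 f \<longleftrightarrow> continuous_on UNIV f"
| "C_k (Suc k) f \<longleftrightarrow>
     (\<forall>x. f differentiable at x) \<and> (\<forall>v. C_k k (\<lambda>x. frechet_derivative f (at x) v))"

definition smooth :: "('a::real_normed_vector \<Rightarrow> 'b::real_normed_vector) \<Rightarrow> bool"
  where "smooth f \<longleftrightarrow> (\<forall>k. C_k k f)"

definition Cc_infty :: "('a::euclidean_space \<Rightarrow> 'b::real_normed_vector) set"
  where "Cc_infty = {f. smooth f \<and> compact (closure {x. f x \<noteq> 0})}"

definition grad :: "('a::euclidean_space \<Rightarrow> real) \<Rightarrow> 'a \<Rightarrow> 'a"
  where "grad u x = (\<Sum>b\<in>Basis. frechet_derivative u (at x) b *\<^sub>R b)"

definition divergence :: "('a::euclidean_space \<Rightarrow> 'a) \<Rightarrow> 'a \<Rightarrow> real"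
  where "divergence \<phi> x = (\<Sum>b\<in>Basis. frechet_derivative \<phi> (at x) b \<bullet> b)"

lemma C_k_zero: "C_k k (\<lambda>x. 0)"
  by (induction k) simp_all

lemma C_k_add: "C_k k f \<Longrightarrow> C_k k g \<Longrightarrow> C_k k (\<lambda>x. f x + g x)"
proof (induction k arbitrary: f g)
  case 0
  then show ?case by (simp add: continuous_on_add)
next
  case (Suc k)
  have "((\<lambda>x. f x + g x) has_derivative
      (\<lambda>v. frechet_derivative f (at x) v + frechet_derivative g (at x) v)) (at x)" for x
    using Suc.prems by (intro has_derivative_add) (simp_all flip: frechet_derivative_works)
  then have "frechet_derivative (\<lambda>x. f x + g x) (at x) =
      (\<lambda>v. frechet_derivative f (at x) v + frechet_derivative g (at x) v)" for x
    by (metis frechet_derivative_at)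
  then show ?case using Suc by simp
qed

lemma C_k_bounded_linear:
  assumes T: "bounded_linear T"
  shows "C_k k f \<Longrightarrow> C_k k (\<lambda>x. T (f x))"
proof (induction k arbitrary: f)
  case 0
  then show ?case using bounded_linear.continuous_on[OF T] by simp
next
  case (Suc k)
  have d: "((\<lambda>x. T (f x)) has_derivative (\<lambda>v. T (frechet_derivative f (at x) v))) (at x)" for x
    using Suc.prems
    by (intro bounded_linear.has_derivative[OF T]) (simp flip: frechet_derivative_works)
  then have "frechet_derivative (\<lambda>x. T (f x)) (at x) =
      (\<lambda>v. T (frechet_derivative f (at x) v))" for x
    by (metis frechet_derivative_at)
  then show ?case using Suc d by (auto simp: differentiable_def)
qed

lemma C_k_sum: "(\<And>i. i \<in> I \<Longrightarrow> C_k k (f i)) \<Longrightarrow> C_k k (\<lambda>x. \<Sum>i\<in>I. f i x)"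
  by (induction I rule: infinite_finite_induct) (auto intro: C_k_zero C_k_add)

lemma smooth_derivative: "smooth f \<Longrightarrow> smooth (\<lambda>x. frechet_derivative f (at x) v)"
  unfolding smooth_def by (metis C_k.simps(2))

lemma smooth_differentiable: "smooth f \<Longrightarrow> f differentiable at x"
  unfolding smooth_def by (metis C_k.simps(2))

lemma smooth_has_derivative:
  "smooth f \<Longrightarrow> (f has_derivative frechet_derivative f (at x)) (at x)"
  using smooth_differentiable frechet_derivative_works by blast

lemma smooth_continuous: "smooth f \<Longrightarrow> continuous_on UNIV f"
  unfolding smooth_def by (metis C_k.simps(1))

lemma smooth_divergence:
  assumes "smooth \<phi>"
  shows "smooth (divergence \<phi>)"
  unfolding smooth_def
proof
  fix k
  have "C_k k (\<lambda>x. frechet_derivative \<phi> (at x) b)" for b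
    using smooth_derivative[OF assms] by (simp add: smooth_def)
  then show "C_k k (divergence \<phi>)"
    unfolding divergence_def
    by (intro C_k_sum C_k_bounded_linear[where T = "\<lambda>y. y \<bullet> _"]) (auto intro: bounded_linear_inner_left)
qed

lemma continuous_grad:
  assumes "smooth u"
  shows "continuous_on S (grad u)"
proof -
  have "continuous_on S (\<lambda>x. frechet_derivative u (at x) b)" for b
    using smooth_continuous[OF smooth_derivative[OF assms]] continuous_on_subset by blast
  then show ?thesis
    unfolding grad_def by (intro continuous_intros)
qed

lemma frechet_derivative_outside_support:
  assumes "x \<notin> closure {x. f x \<noteq> 0}"
  shows "frechet_derivative f (at x) = (\<lambda>v. 0)"
proof -
  have "((\<lambda>y. 0) has_derivative (\<lambda>v. 0)) (at x)" by simp
  then have "(f has_derivative (\<lambda>v. 0)) (at x)"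
    by (rule has_derivative_transform_within_open[of _ _ _ _ "- closure {x. f x \<noteq> 0}"])
       (use assms closure_subset[of "{x. f x \<noteq> 0}"] in auto)
  then show ?thesis by (metis frechet_derivative_at)
qed

lemma compact_closure_mono:
  "compact (closure A) \<Longrightarrow> B \<subseteq> closure A \<Longrightarrow> compact (closure (B :: 'a::euclidean_space set))"
  by (meson bounded_subset bounded_closure compact_imp_bounded compact_closure)

lemma Cc_infty_divergence:
  assumes "\<phi> \<in> Cc_infty"
  shows "divergence \<phi> \<in> Cc_infty"
proof -
  have "{x. divergence \<phi> x \<noteq> 0} \<subseteq> closure {x. \<phi> x \<noteq> 0}"
    by (auto simp: divergence_def intro: ccontr dest!: frechet_derivative_outside_support)
  then show ?thesis
    using assms compact_closure_mono[of "{x. \<phi> x \<noteq> 0}" "{x. divergence \<phi> x \<noteq> 0}"]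
    by (simp add: Cc_infty_def smooth_divergence)
qed

lemma Cc_infty_add:
  assumes "f \<in> Cc_infty" "g \<in> Cc_infty"
  shows "(\<lambda>x. f x + g x) \<in> Cc_infty"
proof -
  have "bounded ({x. f x \<noteq> 0} \<union> {x. g x \<noteq> 0})"
    using assms by (simp add: Cc_infty_def)
  then have "bounded {x. f x + g x \<noteq> 0}"
    by (rule bounded_subset) auto
  then show ?thesis
    using assms by (simp add: Cc_infty_def smooth_def C_k_add)
qed

lemma Cc_infty_bounded_linear:
  assumes T: "bounded_linear T" and f: "f \<in> Cc_infty"
  shows "(\<lambda>x. T (f x)) \<in> Cc_infty"
proof -
  have "bounded {x. f x \<noteq> 0}"
    using f by (simp add: Cc_infty_def)
  then have "bounded {x. T (f x) \<noteq> 0}"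
    by (rule bounded_subset) (use linear_0[OF bounded_linear.linear[OF T]] in auto)
  then show ?thesis
    using f by (simp add: Cc_infty_def smooth_def C_k_bounded_linear[OF T])
qed

lemma Cc_infty_zero: "(\<lambda>x. 0) \<in> Cc_infty"
  by (simp add: Cc_infty_def smooth_def C_k_zero)


section \<open>The Dirichlet norm on test functions\<close>

typedef (overloaded) 'a test_fun = "Cc_infty :: ('a::euclidean_space \<Rightarrow> real) set"
  morphisms fun_of Test_fun
  using Cc_infty_zero by blast

setup_lifting type_definition_test_fun

lemma smooth_fun_of: "smooth (fun_of u)"
  using fun_of[of u] by (simp add: Cc_infty_def)

lemma compact_support_fun_of: "compact (closure {x. fun_of u x \<noteq> 0})"
  using fun_of[of u] by (simp add: Cc_infty_def)

lemma grad_fun_of_outside_support: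
  "x \<notin> closure {x. fun_of u x \<noteq> 0} \<Longrightarrow> grad (fun_of u) x = 0"
  by (simp add: grad_def frechet_derivative_outside_support)

lemma integrable_grad_inner_grad:
  "integrable lborel (\<lambda>x. grad (fun_of u) x \<bullet> grad (fun_of v) x)"
proof -
  let ?K = "closure {x. fun_of u x \<noteq> 0}"
  have "integrable lborel (\<lambda>x. indicator ?K x *\<^sub>R (grad (fun_of u) x \<bullet> grad (fun_of v) x))"
    by (intro borel_integrable_compact compact_support_fun_of continuous_on_inner
        continuous_grad smooth_fun_of)
  moreover have "(\<lambda>x. indicator ?K x *\<^sub>R (grad (fun_of u) x \<bullet> grad (fun_of v) x)) =
      (\<lambda>x. grad (fun_of u) x \<bullet> grad (fun_of v) x)"
  proof
    show "indicator ?K x *\<^sub>R (grad (fun_of u) x \<bullet> grad (fun_of v) x) =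
        grad (fun_of u) x \<bullet> grad (fun_of v) x" for x
      by (cases "x \<in> ?K") (simp_all add: grad_fun_of_outside_support)
  qed
  ultimately show ?thesis by (simp only:)
qed

instantiation test_fun :: (euclidean_space) real_inner
begin

lift_definition zero_test_fun :: "'a test_fun" is "\<lambda>x. 0"
  by (rule Cc_infty_zero)

lift_definition plus_test_fun :: "'a test_fun \<Rightarrow> 'a test_fun \<Rightarrow> 'a test_fun"
  is "\<lambda>u v x. u x + v x"
  by (rule Cc_infty_add)

lift_definition scaleR_test_fun :: "real \<Rightarrow> 'a test_fun \<Rightarrow> 'a test_fun"
  is "\<lambda>r u x. r *\<^sub>R u x"
  by (rule Cc_infty_bounded_linear[OF bounded_linear_scaleR_right])

lift_definition uminus_test_fun :: "'a test_fun \<Rightarrow> 'a test_fun"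
  is "\<lambda>u x. - u x"
  by (rule Cc_infty_bounded_linear[OF bounded_linear_minus[OF bounded_linear_ident]])

definition minus_test_fun :: "'a test_fun \<Rightarrow> 'a test_fun \<Rightarrow> 'a test_fun"
  where "minus_test_fun u v = u + (- v)"

definition inner_test_fun :: "'a test_fun \<Rightarrow> 'a test_fun \<Rightarrow> real"
  where "inner_test_fun u v = (\<integral>x. grad (fun_of u) x \<bullet> grad (fun_of v) x \<partial>lborel)"

definition norm_test_fun :: "'a test_fun \<Rightarrow> real"
  where "norm_test_fun u = sqrt (\<integral>x. (norm (grad (fun_of u) x))\<^sup>2 \<partial>lborel)"

definition dist_test_fun :: "'a test_fun \<Rightarrow> 'a test_fun \<Rightarrow> real"
  where "dist_test_fun u v = norm (u - v)"

definition sgn_test_fun :: "'a test_fun \<Rightarrow> 'a test_fun"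
  where "sgn_test_fun u = inverse (norm u) *\<^sub>R u"

definition uniformity_test_fun :: "('a test_fun \<times> 'a test_fun) filter"
  where "uniformity_test_fun = (INF e\<in>{0 <..}. principal {(u, v). dist u v < e})"

definition open_test_fun :: "'a test_fun set \<Rightarrow> bool"
  where "open_test_fun S = (\<forall>u\<in>S. \<forall>\<^sub>F (u', v) in uniformity. u' = u \<longrightarrow> v \<in> S)"

lemma grad_plus: "grad (fun_of (u + v)) x = grad (fun_of u) x + grad (fun_of v) x"
proof -
  have "(fun_of (u + v) has_derivative
      (\<lambda>h. frechet_derivative (fun_of u) (at x) h + frechet_derivative (fun_of v) (at x) h)) (at x)"
    unfolding plus_test_fun.rep_eq
    by (intro has_derivative_add smooth_has_derivative smooth_fun_of)
  then have "frechet_derivative (fun_of (u + v)) (at x) =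
      (\<lambda>h. frechet_derivative (fun_of u) (at x) h + frechet_derivative (fun_of v) (at x) h)"
    by (metis frechet_derivative_at)
  then show ?thesis by (simp add: grad_def scaleR_add_left sum.distrib)
qed

lemma grad_scaleR: "grad (fun_of (r *\<^sub>R u)) x = r *\<^sub>R grad (fun_of u) x"
proof -
  have "(fun_of (r *\<^sub>R u) has_derivative (\<lambda>h. r *\<^sub>R frechet_derivative (fun_of u) (at x) h)) (at x)"
    unfolding scaleR_test_fun.rep_eq
    by (intro has_derivative_scaleR_right smooth_has_derivative smooth_fun_of)
  then have "frechet_derivative (fun_of (r *\<^sub>R u)) (at x) =
      (\<lambda>h. r *\<^sub>R frechet_derivative (fun_of u) (at x) h)"
    by (metis frechet_derivative_at)
  then show ?thesis by (simp add: grad_def scaleR_sum_right)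
qed

lemma inner_self_eq_0_imp:
  fixes u :: "'a test_fun"
  assumes "(\<integral>x. grad (fun_of u) x \<bullet> grad (fun_of u) x \<partial>lborel) = 0"
  shows "u = 0"
proof -
  let ?f = "fun_of u"
  have "AE x in lborel. grad ?f x \<bullet> grad ?f x = 0"
    using assms integral_nonneg_eq_0_iff_AE[OF integrable_grad_inner_grad[of u u]] by simp
  then have ae: "AE x in lborel. x \<notin> {x. grad ?f x \<noteq> 0}" by simp
  have op: "open {x. grad ?f x \<noteq> 0}"
    by (intro open_Collect_neq continuous_grad smooth_fun_of continuous_on_const)
  have "{x. grad ?f x \<noteq> 0} \<in> null_sets lborel"
    using ae op by (subst AE_iff_null_sets) auto
  then have "negligible {x. grad ?f x \<noteq> 0}"
    using null_sets_completionI negligible_iff_null_sets by blast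
  then have "{x. grad ?f x \<noteq> 0} = {}" using op open_not_negligible by blast
  then have g0: "grad ?f x = 0" for x by auto
  have D0: "frechet_derivative ?f (at x) = (\<lambda>h. 0)" for x
  proof
    fix h
    have lin: "linear (frechet_derivative ?f (at x))"
      using smooth_has_derivative[OF smooth_fun_of] has_derivative_linear by blast
    have "frechet_derivative ?f (at x) b = 0" if "b \<in> Basis" for b
    proof -
      have "grad ?f x \<bullet> b = frechet_derivative ?f (at x) b"
        using that by (simp add: grad_def)
      then show ?thesis by (simp add: g0)
    qed
    moreover have "frechet_derivative ?f (at x) h =
        (\<Sum>b\<in>Basis. (h \<bullet> b) *\<^sub>R frechet_derivative ?f (at x) b)"
      by (subst euclidean_representation[of h, symmetric])
         (simp add: linear_sum[OF lin] linear_cmul[OF lin])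
    ultimately show "frechet_derivative ?f (at x) h = 0" by simp
  qed
  have "(?f has_derivative (\<lambda>h. 0)) (at x)" for x
    using smooth_has_derivative[OF smooth_fun_of, of u x] by (simp add: D0)
  then obtain c where c: "\<And>x. ?f x = c"
    using has_derivative_zero_constant[of UNIV ?f] by auto
  have "bounded {x. ?f x \<noteq> 0}"
    using compact_support_fun_of[of u] by simp
  then have "c = 0" using c not_bounded_UNIV[where 'a = 'a] by (cases "c = 0") auto
  then show ?thesis
    using c by (auto simp: zero_test_fun.rep_eq simp flip: fun_of_inject)
qed

instance
proof
  fix u v w :: "'a test_fun" and r s :: real
  show "u + v + w = u + (v + w)" by transfer (simp add: add.assoc)
  show "u + v = v + u" by transfer (simp add: add.commute)
  show "0 + u = u" by transfer simp
  show "- u + u = 0" by transfer simp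
  show "u - v = u + - v" by (rule minus_test_fun_def)
  show "r *\<^sub>R (u + v) = r *\<^sub>R u + r *\<^sub>R v" by transfer (simp add: distrib_left)
  show "(r + s) *\<^sub>R u = r *\<^sub>R u + s *\<^sub>R u" by transfer (simp add: distrib_right)
  show "r *\<^sub>R s *\<^sub>R u = (r * s) *\<^sub>R u" by transfer (simp add: mult.assoc)
  show "1 *\<^sub>R u = u" by transfer simp
  show "dist u v = norm (u - v)" by (rule dist_test_fun_def)
  show "sgn u = inverse (norm u) *\<^sub>R u" by (rule sgn_test_fun_def)
  show "(uniformity :: ('a test_fun \<times> 'a test_fun) filter) =
      (INF e\<in>{0 <..}. principal {(u, v). dist u v < e})"
    by (rule uniformity_test_fun_def)
  show "open U = (\<forall>u\<in>U. \<forall>\<^sub>F (u', v) in uniformity. u' = u \<longrightarrow> v \<in> U)" for U :: "'a test_fun set"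
    by (rule open_test_fun_def)
  show "inner u v = inner v u"
    by (simp add: inner_test_fun_def inner_commute)
  show "inner (u + v) w = inner u w + inner v w"
    by (simp add: inner_test_fun_def grad_plus inner_add_left integrable_grad_inner_grad)
  show "inner (r *\<^sub>R u) v = r * inner u v"
    by (simp add: inner_test_fun_def grad_scaleR)
  show "0 \<le> inner u u"
    by (simp add: inner_test_fun_def)
  show "(inner u u = 0) = (u = 0)"
  proof
    show "u = 0" if "inner u u = 0"
      using that inner_self_eq_0_imp by (simp add: inner_test_fun_def)
    have "grad (fun_of (0 :: 'a test_fun)) x = 0" for x
      by (simp add: zero_test_fun.rep_eq grad_def)
    then show "inner u u = 0" if "u = 0"
      using that by (simp add: inner_test_fun_def)
  qed
  show "norm u = sqrt (inner u u)"
    by (simp add: norm_test_fun_def inner_test_fun_def power2_norm_eq_inner)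
qed

end


section \<open>The space \<open>D1_0\<close>, its dual, and total variation\<close>

text \<open>For \<open>DIM('a) \<le> 2\<close>, \<open>to_completion \<psi>\<close> plays the role of the class of \<open>\<psi>\<close> modulo constants.
  The dual carries the operator norm of the type of bounded linear functions.\<close>

type_synonym 'a D1_0 = "'a test_fun normed_completion"
type_synonym 'a Dm1 = "'a D1_0 \<Rightarrow>\<^sub>L real"

definition Cc_infty_av :: "('a::euclidean_space \<Rightarrow> real) set"
  where "Cc_infty_av = {u \<in> Cc_infty. (\<integral>x. u x \<partial>lborel) = 0}"

text \<open>\<open>W\<close> is the functional \<open>\<phi> \<mapsto> \<integral>u\<phi>\<close>, prescribed on the dense image of the test functions; hence at
  most one \<open>W\<close> represents a given \<open>u\<close> (\<open>represents_unique\<close>). That \<open>\<phi> \<mapsto> \<integral>u\<phi>\<close> is bounded in the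
  Dirichlet norm is part of what asserting \<open>represents u W\<close> claims.\<close>

definition represents :: "('a::euclidean_space \<Rightarrow> real) \<Rightarrow> 'a Dm1 \<Rightarrow> bool"
  where "represents u W \<longleftrightarrow>
    (\<forall>\<phi>. blinfun_apply W (to_completion \<phi>) = (\<integral>x. u x * fun_of \<phi> x \<partial>lborel))"

lemma represents_unique:
  assumes "represents u W" "represents u W'"
  shows "W = W'"
proof (rule blinfun_eqI)
  fix x
  have "continuous_on UNIV (\<lambda>x. blinfun_apply W x - blinfun_apply W' x)"
    by (intro continuous_intros)
  then have cl: "closed {x. blinfun_apply W x - blinfun_apply W' x = 0}"
    using closed_Collect_eq[of "\<lambda>x. blinfun_apply W x - blinfun_apply W' x" "\<lambda>x. 0"] by simp
  have "range to_completion \<subseteq> {x. blinfun_apply W x - blinfun_apply W' x = 0}"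
    using assms by (auto simp: represents_def)
  then have "closure (range to_completion) \<subseteq> {x. blinfun_apply W x - blinfun_apply W' x = 0}"
    using cl closure_minimal by blast
  then show "blinfun_apply W x = blinfun_apply W' x"
    using dense_range_to_completion by auto
qed

text \<open>\<open>div_class \<phi>\<close> is the divergence of \<open>\<phi> \<in> Cc_infty\<close> as an element of \<open>D1_0\<close>;
  see \<open>Cc_infty_divergence\<close>.\<close>

definition div_class :: "('a::euclidean_space \<Rightarrow> 'a) \<Rightarrow> 'a D1_0"
  where "div_class \<phi> = to_completion (Test_fun (divergence \<phi>))"

definition TV :: "'a::euclidean_space Dm1 \<Rightarrow> ereal"
  where "TV W = Sup {ereal (blinfun_apply W (div_class \<phi>)) |\<phi>.
    \<phi> \<in> Cc_infty \<and> (AE x in lborel. norm (\<phi> x) \<le> 1)}"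

lemma TV_nonneg: "0 \<le> TV W"
proof -
  have "divergence (\<lambda>x::'a. 0) = (\<lambda>x. 0)"
    by (simp add: divergence_def fun_eq_iff)
  then have "div_class (\<lambda>x::'a. 0) = to_completion 0"
    by (simp add: div_class_def zero_test_fun_def)
  then have "blinfun_apply W (div_class (\<lambda>x. 0)) = 0"
    by (simp add: linear_0[OF linear_to_completion])
  then show ?thesis
    unfolding TV_def
    by (intro Sup_upper2[of "ereal (blinfun_apply W (div_class (\<lambda>x. 0)))"])
       (auto intro!: exI[of _ "\<lambda>x. 0"] Cc_infty_zero)
qed

end

theory Submission
  imports Defs
begin

text \<open>Total variation is a supremum of continuous functionals, so only the upper bound on \<open>TV (W k)\<close> needs
  work. If \<open>TV w = \<infinity>\<close>, density suffices: \<open>w\<close> is a limit of functionals \<open>\<phi> \<mapsto> \<integral>\<nabla>v \<bullet> \<nabla>\<phi>\<close> with \<open>v\<close> a test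
  function, represented by \<open>- \<Delta>v\<close>. If \<open>TV w < \<infinity>\<close>, mollify first: this does not increase \<open>TV\<close> and yields a
  smooth function \<open>g\<close> vanishing at infinity. Then replace \<open>g\<close> by \<open>\<eta> g - (\<integral>\<eta> g) \<zeta>\<close>, with \<open>\<eta>\<close> a cutoff at
  scale \<open>R\<close> and \<open>\<zeta> = \<eta> / \<integral>\<eta>\<close>. On functionals this is the adjoint of \<open>\<phi> \<mapsto> \<eta> (\<phi> - \<integral>\<zeta> \<phi>)\<close>, which is bounded
  in the Dirichlet norm uniformly in \<open>R\<close> by a Poincare inequality, and \<open>TV\<close> grows by at most a constant times
  \<open>1 / R\<close> times the integral of \<open>\<bar>g\<bar>\<close> over the ball of radius \<open>2 * R\<close>. For \<open>n \<ge> 2\<close> the latter tends to \<open>0\<close> by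
  the Hardy inequality \<open>(n - 1) * \<integral>\<bar>g\<bar> / sqrt (1 + \<bar>x\<bar>\<^sup>2) \<le> TV\<close>; for \<open>n = 1\<close> because \<open>g\<close> vanishes at infinity.\<close>

section \<open>Calculus of smooth functions\<close>

text \<open>Mollification precedes the cutoff because the product rule produces the term
  \<open>g x * (grad \<eta> x \<bullet> \<phi> x)\<close>, which can be estimated by absolute values
  only once the functional is given by a function \<open>g\<close>. Multiplication by \<eta> alone
  would not do: for n \<le> 2 there are test functions equal to 1 on the ball of radius 2 R with
  arbitrarily small Dirichlet norm, so \<phi> \<mapsto> \<eta> \<phi> is unbounded. Removing a
  weighted mean first cures this in every dimension, and on the dual side the same subtraction makes
  the integral of the truncated function vanish. Convergence under the cutoff needs no compactness:
  the operators are bounded uniformly in R, and a functional represented by a mean-zero function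
  supported where \<eta> = 1 is left unchanged. The pre-Hilbert space of test functions is
  incomplete, so a bounded functional need not be \<open>inner v\<close> for a test function v; it
  is only a norm limit of such. Facts about a general functional are therefore proved for
  \<open>inner v\<close> and carried over by a uniform bound.\<close>

lemma C_k_SucI:
  assumes "\<And>x. (f has_derivative f' x) (at x)" "\<And>v. C_k k (\<lambda>x. f' x v)"
  shows "C_k (Suc k) f"
proof -
  have "frechet_derivative f (at x) = f' x" for x
    using assms(1)[of x] by (metis frechet_derivative_at)
  then show ?thesis
    using assms by (auto simp: differentiable_def)
qed

lemma C_k_Suc_has_derivative:
  "C_k (Suc k) f \<Longrightarrow> (f has_derivative frechet_derivative f (at x)) (at x)"
  by (simp flip: frechet_derivative_works)

lemma C_k_Suc_imp: "C_k (Suc k) f \<Longrightarrow> C_k k f"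
proof (induction k arbitrary: f)
  case 0
  then show ?case
    by (simp add: continuous_on_eq_continuous_within differentiable_imp_continuous_within)
next
  case (Suc k)
  show ?case
    by (rule C_k_SucI[of _ "\<lambda>x. frechet_derivative f (at x)"])
       (use C_k_Suc_has_derivative[OF Suc.prems] Suc.IH Suc.prems C_k.simps(2)[of "Suc k" f] in blast)+
qed

lemma C_k_const: "C_k k (\<lambda>x. c)"
proof (cases k)
  case (Suc j)
  show ?thesis
    unfolding Suc by (rule C_k_SucI[of _ "\<lambda>x v. 0"]) (auto intro: C_k_zero)
qed simp

lemma C_k_ident: "C_k k (\<lambda>x. x)"
proof (cases k)
  case (Suc j)
  show ?thesis
    unfolding Suc by (rule C_k_SucI[of _ "\<lambda>x v. v"]) (auto intro: C_k_const)
qed (simp add: continuous_on_id)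

lemma C_k_bilinear:
  assumes P: "bounded_bilinear P"
  shows "C_k k f \<Longrightarrow> C_k k g \<Longrightarrow> C_k k (\<lambda>x. P (f x) (g x))"
proof (induction k arbitrary: f g)
  case 0
  then show ?case using bounded_bilinear.continuous_on[OF P] by simp
next
  case (Suc k)
  show ?case
  proof (rule C_k_SucI)
    show "((\<lambda>x. P (f x) (g x)) has_derivative
        (\<lambda>v. P (f x) (frechet_derivative g (at x) v) + P (frechet_derivative f (at x) v) (g x))) (at x)" for x
      using Suc.prems by (intro bounded_bilinear.FDERIV[OF P] C_k_Suc_has_derivative)
    show "C_k k (\<lambda>x. P (f x) (frechet_derivative g (at x) v) + P (frechet_derivative f (at x) v) (g x))" for v
      using Suc.prems by (intro C_k_add Suc.IH C_k_Suc_imp[of k f] C_k_Suc_imp[of k g]) auto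
  qed
qed

lemma C_k_affine:
  assumes L: "bounded_linear L"
  shows "C_k k f \<Longrightarrow> C_k k (\<lambda>x. f (L x + c))"
proof (induction k arbitrary: f)
  case 0
  then show ?case
    by (simp add: continuous_on_compose2[of UNIV f] continuous_on_add bounded_linear.continuous_on[OF L])
next
  case (Suc k)
  show ?case
  proof (rule C_k_SucI)
    have a: "((\<lambda>x. L x + c) has_derivative L) (at x)" for x
      by (auto intro!: derivative_eq_intros bounded_linear_imp_has_derivative[OF L])
    show "((\<lambda>x. f (L x + c)) has_derivative (\<lambda>v. frechet_derivative f (at (L x + c)) (L v))) (at x)" for x
      using diff_chain_at[OF a, of f] C_k_Suc_has_derivative[OF Suc.prems] by (simp add: o_def)
    show "C_k k (\<lambda>x. frechet_derivative f (at (L x + c)) (L v))" for v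
      by (rule Suc.IH[of "\<lambda>x. frechet_derivative f (at x) (L v)"]) (use Suc.prems in simp)
  qed
qed

lemma frechet_derivative_real:
  fixes h :: "real \<Rightarrow> 'b::real_normed_vector"
  assumes "h differentiable at t"
  shows "frechet_derivative h (at t) s = s *\<^sub>R frechet_derivative h (at t) 1"
  using linear_cmul[OF linear_frechet_derivative[OF assms], of s 1] by (simp only: real_scaleR_def mult_1_right)

text \<open>On the real line the derivative of \<open>h\<close> splits into a scalar and the
  derivative in the fixed direction 1. In the general chain rule the direction fed to the outer
  derivative varies with \<open>x\<close>, and the induction hypothesis would not apply to
  it.\<close>

lemma C_k_compose_real:
  fixes h :: "real \<Rightarrow> 'b::real_normed_vector"
  shows "C_k k h \<Longrightarrow> C_k k f \<Longrightarrow> C_k k (\<lambda>x. h (f x))"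
proof (induction k arbitrary: f h)
  case 0
  then show ?case
    using continuous_on_compose2[of UNIV h UNIV f] by (simp only: C_k.simps subset_UNIV simp_thms)
next
  case (Suc k)
  show ?case
  proof (rule C_k_SucI)
    show "((\<lambda>x. h (f x)) has_derivative
        (\<lambda>v. frechet_derivative f (at x) v *\<^sub>R frechet_derivative h (at (f x)) 1)) (at x)" for x
    proof (rule has_derivative_eq_rhs)
      show "((\<lambda>x. h (f x)) has_derivative
          (\<lambda>v. frechet_derivative h (at (f x)) (frechet_derivative f (at x) v))) (at x)"
        using diff_chain_at[OF C_k_Suc_has_derivative[OF Suc.prems(2)] C_k_Suc_has_derivative[OF Suc.prems(1)]]
        by (simp only: o_def)
      show "(\<lambda>v. frechet_derivative h (at (f x)) (frechet_derivative f (at x) v)) =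
          (\<lambda>v. frechet_derivative f (at x) v *\<^sub>R frechet_derivative h (at (f x)) 1)"
        by (rule ext, rule frechet_derivative_real) (use Suc.prems(1) in \<open>simp only: C_k.simps\<close>)
    qed
    show "C_k k (\<lambda>x. frechet_derivative f (at x) v *\<^sub>R frechet_derivative h (at (f x)) 1)" for v
    proof (rule C_k_bilinear[OF bounded_bilinear_scaleR])
      show "C_k k (\<lambda>x. frechet_derivative h (at (f x)) 1)"
        by (rule Suc.IH[of "\<lambda>t. frechet_derivative h (at t) 1"])
           (use Suc.prems(1) C_k_Suc_imp[OF Suc.prems(2)] in \<open>simp_all only: C_k.simps\<close>)
      show "C_k k (\<lambda>x. frechet_derivative f (at x) v)"
        using Suc.prems(2) by (simp only: C_k.simps)
    qed
  qed
qed

lemma C_k_powr: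
  fixes f :: "'a::real_normed_vector \<Rightarrow> real"
  assumes "\<And>x. 0 < f x"
  shows "C_k k f \<Longrightarrow> C_k k (\<lambda>x. f x powr p)"
proof (induction k arbitrary: p)
  case 0
  have "f x \<noteq> 0" for x using assms[of x] by simp
  with 0 show ?case by (auto intro!: continuous_intros)
next
  case (Suc k)
  show ?case
  proof (rule C_k_SucI)
    have "((\<lambda>x. f x powr p) has_derivative
        (\<lambda>v. f x powr p * (0 * ln (f x) + frechet_derivative f (at x) v * p / f x))) (at x)" for x
      using assms by (intro has_derivative_powr[where X=UNIV, simplified] C_k_Suc_has_derivative[OF Suc.prems]) auto
    moreover have "f x powr p * (0 * ln (f x) + d * p / f x) = (p * d) * f x powr (p - 1)" for x d
      using assms[of x] by (simp add: powr_diff)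
    ultimately show "((\<lambda>x. f x powr p) has_derivative
        (\<lambda>v. (p * frechet_derivative f (at x) v) * f x powr (p - 1))) (at x)" for x
      by simp
    show "C_k k (\<lambda>x. (p * frechet_derivative f (at x) v) * f x powr (p - 1))" for v
      using Suc.prems
      by (intro C_k_bilinear[OF bounded_bilinear_mult] Suc.IH C_k_const C_k_Suc_imp[of k f]) auto
  qed
qed

section \<open>Closure properties of smooth functions\<close>

lemma smooth_const: "smooth (\<lambda>x. c)"
  and smooth_ident: "smooth (\<lambda>x. x)"
  and smooth_add: "smooth f \<Longrightarrow> smooth g \<Longrightarrow> smooth (\<lambda>x. f x + g x)"
  by (simp_all add: smooth_def C_k_const C_k_ident C_k_add)

lemma smooth_bilinear:
  "bounded_bilinear P \<Longrightarrow> smooth f \<Longrightarrow> smooth g \<Longrightarrow> smooth (\<lambda>x. P (f x) (g x))"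
  unfolding smooth_def using C_k_bilinear[of P _ f g] by blast

lemmas smooth_scaleR = smooth_bilinear[OF bounded_bilinear_scaleR]
  and smooth_mult = smooth_bilinear[OF bounded_bilinear_mult]
  and smooth_inner = smooth_bilinear[OF bounded_bilinear_inner]

lemma smooth_sum: "(\<And>i. i \<in> I \<Longrightarrow> smooth (f i)) \<Longrightarrow> smooth (\<lambda>x. \<Sum>i\<in>I. f i x)"
  by (simp add: smooth_def C_k_sum)

lemma smooth_diff: "smooth f \<Longrightarrow> smooth g \<Longrightarrow> smooth (\<lambda>x. f x - g x)"
  using smooth_add[of f "\<lambda>x. (-1) *\<^sub>R g x"] smooth_scaleR[OF smooth_const, of g "-1"] by simp

lemma smooth_affine: "bounded_linear L \<Longrightarrow> smooth f \<Longrightarrow> smooth (\<lambda>x. f (L x + c))"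
  unfolding smooth_def using C_k_affine[of L _ f c] by blast

lemma smooth_translate: "smooth f \<Longrightarrow> smooth (\<lambda>x. f (x + c))"
  by (rule smooth_affine[OF bounded_linear_ident])

lemma smooth_compose_real:
  fixes h :: "real \<Rightarrow> 'b::real_normed_vector"
  shows "smooth h \<Longrightarrow> smooth f \<Longrightarrow> smooth (\<lambda>x. h (f x))"
  unfolding smooth_def using C_k_compose_real[of _ h f] by blast

lemma smooth_powr:
  fixes f :: "'a::real_normed_vector \<Rightarrow> real"
  shows "(\<And>x. 0 < f x) \<Longrightarrow> smooth f \<Longrightarrow> smooth (\<lambda>x. f x powr p)"
  unfolding smooth_def using C_k_powr[of f _ p] by blast

lemma smooth_grad: "smooth u \<Longrightarrow> smooth (grad u)"
  unfolding grad_def by (intro smooth_sum smooth_scaleR smooth_derivative smooth_const)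

text \<open>The exponent \<open>m\<close> makes the family closed under differentiation: by
  \<open>flat_exp_DERIV\<close> the derivative of a member is a combination of two others. One
  induction over the order, generalised over \<open>m\<close>, then proves smoothness of all of
  them.\<close>

definition flat_exp :: "nat \<Rightarrow> real \<Rightarrow> real"
  where "flat_exp m t = (if 0 < t then exp (- 1 / t) / t ^ m else 0)"

text \<open>The exponential series at \<open>1 / t\<close> dominates its single term of degree
  \<open>m + 2\<close>. Two powers of \<open>t\<close> are kept so that the difference quotient at 0
  tends to 0.\<close>

lemma flat_exp_le: "\<bar>flat_exp m t\<bar> \<le> fact (m + 2) * t\<^sup>2"
proof (cases "0 < t")
  case True
  have "(1 / t) ^ (m + 2) / fact (m + 2) \<le> exp (1 / t)"
  proof -
    have "(\<Sum>k\<in>{m+2}. (1 / t) ^ k /\<^sub>R fact k) \<le> (\<Sum>k. (1 / t) ^ k /\<^sub>R fact k)"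
      using True by (intro sum_le_suminf summable_exp_generic) auto
    then show ?thesis by (simp add: exp_def inverse_eq_divide del: fact_Suc power_Suc)
  qed
  then have "(1 / t) ^ (m + 2) \<le> fact (m + 2) * exp (1 / t)"
    by (simp only: divide_le_eq fact_gt_zero if_True mult.commute)
  then have "1 / t ^ (m + 2) \<le> fact (m + 2) * exp (1 / t)"
    by (simp only: power_one_over)
  then have "exp (- 1 / t) * (1 / t ^ (m + 2)) \<le> exp (- 1 / t) * (fact (m + 2) * exp (1 / t))"
    by (intro mult_left_mono) auto
  also have "\<dots> = fact (m + 2)"
    by (simp add: exp_minus field_simps)
  finally have *: "exp (- 1 / t) / t ^ (m + 2) \<le> fact (m + 2)" by simp
  have "exp (- 1 / t) / t ^ m = exp (- 1 / t) / t ^ (m + 2) * t\<^sup>2"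
    using True by (simp add: power_add field_simps power2_eq_square)
  also have "\<dots> \<le> fact (m + 2) * t\<^sup>2"
    by (rule mult_right_mono[OF *]) simp
  finally show ?thesis
    using True by (simp add: flat_exp_def)
qed (simp add: flat_exp_def)

lemma flat_exp_DERIV:
  "(flat_exp m has_real_derivative (flat_exp (m + 2) t - m * flat_exp (m + 1) t)) (at t)"
proof -
  consider "t < 0" | "t = 0" | "0 < t" by linarith
  then show ?thesis
  proof cases
    case 1
    have "(flat_exp m has_real_derivative 0) (at t)"
      by (rule has_field_derivative_transform_within_open[of "\<lambda>t. 0" _ _ "{..<0}"])
         (use 1 in \<open>auto simp: flat_exp_def\<close>)
    then show ?thesis using 1 by (simp add: flat_exp_def)
  next
    case 2
    have "((\<lambda>h. (flat_exp m (0 + h) - flat_exp m 0) / h) \<longlongrightarrow> 0) (at 0)"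
    proof (rule Lim_null_comparison)
      show "\<forall>\<^sub>F h in at 0. norm ((flat_exp m (0 + h) - flat_exp m 0) / h) \<le> fact (m + 2) * \<bar>h\<bar>"
        unfolding eventually_at
      proof (intro exI[of _ 1] conjI ballI impI)
        fix h :: real assume "h \<noteq> 0 \<and> dist h 0 < 1"
        then show "norm ((flat_exp m (0 + h) - flat_exp m 0) / h) \<le> fact (m + 2) * \<bar>h\<bar>"
          using flat_exp_le[of m h]
          by (simp add: flat_exp_def[of m 0] divide_simps power2_eq_square mult.assoc del: fact_Suc)
      qed simp
      show "((\<lambda>h::real. fact (m + 2) * \<bar>h\<bar>) \<longlongrightarrow> 0) (at 0)"
        by (rule tendsto_eq_intros refl | simp)+
    qed
    then show ?thesis
      using 2 by (simp add: DERIV_def flat_exp_def[of _ 0])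
  next
    case 3
    \<comment> \<open>For \<open>m = 0\<close> the truncated exponent \<open>m - Suc 0\<close> is
      not \<open>m - 1\<close>, but then both sides vanish through the factor
      \<open>m\<close>.\<close>
    have p: "real m * t ^ (m - Suc 0) = real m * t ^ m / t"
      using 3 by (cases m) auto
    have e: "((\<lambda>t. exp (- 1 / t)) has_real_derivative exp (- 1 / t) / t\<^sup>2) (at t)"
      using 3 by (auto intro!: derivative_eq_intros simp: power2_eq_square)
    have "((\<lambda>t. exp (- 1 / t) / t ^ m) has_real_derivative
        (exp (- 1 / t) / t\<^sup>2 * t ^ m - exp (- 1 / t) * (real m * t ^ (m - Suc 0))) / (t ^ m * t ^ m)) (at t)"
      using 3 by (intro DERIV_divide e DERIV_pow) simp
    also have "(exp (- 1 / t) / t\<^sup>2 * t ^ m - exp (- 1 / t) * (real m * t ^ (m - Suc 0))) / (t ^ m * t ^ m) =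
        flat_exp (m + 2) t - m * flat_exp (m + 1) t"
      unfolding p using 3 by (simp add: flat_exp_def field_simps power2_eq_square)
    finally have "((\<lambda>t. exp (- 1 / t) / t ^ m) has_real_derivative
        (flat_exp (m + 2) t - m * flat_exp (m + 1) t)) (at t)" .
    then show ?thesis
      by (rule has_field_derivative_transform_within_open[of _ _ _ "{0<..}"])
         (use 3 in \<open>auto simp: flat_exp_def\<close>)
  qed
qed

lemma smooth_flat_exp: "smooth (flat_exp m)"
proof -
  have "C_k k (flat_exp m)" for k
  proof (induction k arbitrary: m)
    case 0
    show ?case
      using DERIV_isCont[OF flat_exp_DERIV] by (simp add: continuous_on_eq_continuous_at)
  next
    case (Suc k)
    show ?case
    proof (rule C_k_SucI)
      show "(flat_exp m has_derivative
          (\<lambda>v. (flat_exp (m + 2) t + (- real m) * flat_exp (m + 1) t) * v)) (at t)" for t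
        using flat_exp_DERIV[of m t] by (simp add: has_field_derivative_def)
      show "C_k k (\<lambda>t. (flat_exp (m + 2) t + (- real m) * flat_exp (m + 1) t) * v)" for v
        by (intro C_k_bilinear[OF bounded_bilinear_mult] C_k_add C_k_const Suc)
    qed
  qed
  then show ?thesis by (simp add: smooth_def)
qed

section \<open>Smooth functions with compact support\<close>

lemma Cc_infty_iff:
  fixes f :: "'a::euclidean_space \<Rightarrow> 'b::real_normed_vector"
  shows "f \<in> Cc_infty \<longleftrightarrow> smooth f \<and> (\<exists>r>0. \<forall>x. r < norm x \<longrightarrow> f x = 0)"
proof -
  have "compact (closure {x. f x \<noteq> 0}) \<longleftrightarrow> (\<exists>r>0. \<forall>x. r < norm x \<longrightarrow> f x = 0)"
    by (simp add: bounded_pos) (metis linorder_not_less)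
  then show ?thesis by (simp add: Cc_infty_def)
qed

lemma Cc_inftyI:
  fixes f :: "'a::euclidean_space \<Rightarrow> 'b::real_normed_vector"
  assumes "smooth f" "\<And>x. r < norm x \<Longrightarrow> f x = 0"
  shows "f \<in> Cc_infty"
  using assms unfolding Cc_infty_iff by (intro conjI exI[of _ "max 1 r"]) auto

lemma Cc_inftyE:
  fixes f :: "'a::euclidean_space \<Rightarrow> 'b::real_normed_vector"
  assumes "f \<in> Cc_infty"
  obtains r where "0 < r" "\<And>x. r < norm x \<Longrightarrow> f x = 0"
  using assms unfolding Cc_infty_iff by blast

lemma Cc_infty_smooth: "f \<in> Cc_infty \<Longrightarrow> smooth f"
  by (simp add: Cc_infty_def)

lemma frechet_derivative_eq_0:
  fixes f :: "'a::euclidean_space \<Rightarrow> 'b::real_normed_vector"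
  assumes "\<And>x. r < norm x \<Longrightarrow> f x = 0" "r < norm x"
  shows "frechet_derivative f (at x) = (\<lambda>v. 0)"
proof (rule frechet_derivative_outside_support)
  have "closure {x. f x \<noteq> 0} \<subseteq> cball 0 r"
    using assms(1) by (intro closure_minimal) (auto simp: linorder_not_less[symmetric])
  then show "x \<notin> closure {x. f x \<noteq> 0}" using assms(2) by auto
qed

lemma Cc_infty_bilinear:
  fixes f :: "'a::euclidean_space \<Rightarrow> 'b::real_normed_vector" and g :: "'a \<Rightarrow> 'c::real_normed_vector"
  assumes "bounded_bilinear P" "smooth f" "smooth g" "f \<in> Cc_infty \<or> g \<in> Cc_infty"
  shows "(\<lambda>x. P (f x) (g x)) \<in> Cc_infty"
proof -
  obtain r where "\<And>x. r < norm x \<Longrightarrow> f x = 0 \<or> g x = 0"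
    using assms(4) Cc_inftyE by metis
  then have "r < norm x \<Longrightarrow> P (f x) (g x) = 0" for x
    using bounded_bilinear.zero_left[OF assms(1)] bounded_bilinear.zero_right[OF assms(1)] by metis
  then show ?thesis
    by (rule Cc_inftyI[OF smooth_bilinear[OF assms(1-3)]])
qed

lemmas Cc_infty_scaleR = Cc_infty_bilinear[OF bounded_bilinear_scaleR]
  and Cc_infty_mult = Cc_infty_bilinear[OF bounded_bilinear_mult]

lemma Cc_infty_diff:
  assumes "f \<in> Cc_infty" "g \<in> Cc_infty"
  shows "(\<lambda>x. f x - g x) \<in> Cc_infty"
  using Cc_infty_add[OF assms(1) Cc_infty_bounded_linear[OF bounded_linear_minus[OF bounded_linear_ident] assms(2)]]
  by simp

lemma Cc_infty_derivative:
  fixes f :: "'a::euclidean_space \<Rightarrow> 'b::real_normed_vector"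
  assumes "f \<in> Cc_infty"
  shows "(\<lambda>x. frechet_derivative f (at x) v) \<in> Cc_infty"
proof -
  obtain r where "\<And>x. r < norm x \<Longrightarrow> f x = 0" using assms Cc_inftyE by metis
  then show ?thesis
    by (intro Cc_inftyI[of _ r] smooth_derivative Cc_infty_smooth[OF assms])
       (simp add: frechet_derivative_eq_0[where r = r])
qed

lemma Cc_infty_sum:
  "(\<And>i. i \<in> I \<Longrightarrow> f i \<in> Cc_infty) \<Longrightarrow> (\<lambda>x. \<Sum>i\<in>I. f i x) \<in> Cc_infty"
  by (induction I rule: infinite_finite_induct) (auto intro: Cc_infty_zero Cc_infty_add)

lemma Cc_infty_grad:
  assumes "u \<in> Cc_infty"
  shows "grad u \<in> Cc_infty"
  unfolding grad_def
  by (intro Cc_infty_sum Cc_infty_bounded_linear[OF bounded_linear_scaleR_left] Cc_infty_derivative assms)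

lemma Cc_infty_translate:
  fixes f :: "'a::euclidean_space \<Rightarrow> 'b::real_normed_vector"
  assumes "f \<in> Cc_infty"
  shows "(\<lambda>x. f (x + z)) \<in> Cc_infty"
proof -
  obtain r where "\<And>x. r < norm x \<Longrightarrow> f x = 0" using assms Cc_inftyE by metis
  moreover have "r < norm (x + z)" if "r + norm z < norm x" for x
    using that norm_triangle_ineq4[of "x + z" z] by simp
  ultimately show ?thesis
    by (intro Cc_inftyI[of _ "r + norm z"] smooth_translate Cc_infty_smooth[OF assms]) auto
qed

lemma Cc_infty_reflect:
  fixes f :: "'a::euclidean_space \<Rightarrow> 'b::real_normed_vector"
  assumes "f \<in> Cc_infty"
  shows "(\<lambda>x. f (- x)) \<in> Cc_infty"
proof -
  obtain r where "\<And>x. r < norm x \<Longrightarrow> f x = 0" using assms Cc_inftyE by metis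
  then show ?thesis
    using smooth_affine[OF bounded_linear_minus[OF bounded_linear_ident] Cc_infty_smooth[OF assms], of 0]
    by (intro Cc_inftyI[of _ r]) auto
qed

section \<open>Product and chain rules for gradient and divergence\<close>

lemma grad_inner:
  assumes "smooth u"
  shows "grad u x \<bullet> v = frechet_derivative u (at x) v"
proof -
  have lin: "linear (frechet_derivative u (at x))"
    using smooth_has_derivative[OF assms] has_derivative_linear by blast
  have "frechet_derivative u (at x) v = (\<Sum>b\<in>Basis. (v \<bullet> b) *\<^sub>R frechet_derivative u (at x) b)"
    by (subst euclidean_representation[of v, symmetric])
       (simp add: linear_sum[OF lin] linear_cmul[OF lin])
  then show ?thesis
    by (simp add: grad_def inner_sum_left inner_commute[of v] mult.commute)
qed

lemma grad_eqI:
  assumes "(u has_derivative (\<lambda>v. g \<bullet> v)) (at x)"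
  shows "grad u x = g"
proof -
  have "frechet_derivative u (at x) = (\<lambda>v. g \<bullet> v)"
    using assms by (metis frechet_derivative_at)
  then show ?thesis
    by (simp add: grad_def euclidean_representation)
qed

lemma smooth_has_derivative_grad:
  "smooth u \<Longrightarrow> (u has_derivative (\<lambda>v. grad u x \<bullet> v)) (at x)"
  using smooth_has_derivative[of u x] by (simp add: grad_inner)

lemma grad_mult:
  fixes f g :: "'a::euclidean_space \<Rightarrow> real"
  assumes "smooth f" "smooth g"
  shows "grad (\<lambda>x. f x * g x) x = f x *\<^sub>R grad g x + g x *\<^sub>R grad f x"
proof (rule grad_eqI)
  show "((\<lambda>x. f x * g x) has_derivative (\<lambda>v. (f x *\<^sub>R grad g x + g x *\<^sub>R grad f x) \<bullet> v)) (at x)"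
    using has_derivative_mult[OF smooth_has_derivative_grad[OF assms(1)] smooth_has_derivative_grad[OF assms(2)]]
    by (rule has_derivative_eq_rhs) (simp add: inner_add_left mult.commute)
qed

lemma grad_compose:
  fixes f :: "'a::euclidean_space \<Rightarrow> real"
  assumes "smooth f" "(h has_real_derivative d) (at (f x))"
  shows "grad (\<lambda>x. h (f x)) x = d *\<^sub>R grad f x"
proof (rule grad_eqI)
  show "((\<lambda>x. h (f x)) has_derivative (\<lambda>v. d *\<^sub>R grad f x \<bullet> v)) (at x)"
    using diff_chain_at[OF smooth_has_derivative_grad[OF assms(1)] assms(2)[unfolded has_field_derivative_def]]
    by (simp add: o_def)
qed

lemma divergence_scaleR:
  fixes f :: "'a::euclidean_space \<Rightarrow> real"
  assumes "smooth f" "smooth F"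
  shows "divergence (\<lambda>x. f x *\<^sub>R F x) x = f x * divergence F x + grad f x \<bullet> F x"
proof -
  have "((\<lambda>x. f x *\<^sub>R F x) has_derivative
      (\<lambda>v. f x *\<^sub>R frechet_derivative F (at x) v + (grad f x \<bullet> v) *\<^sub>R F x)) (at x)"
    by (intro has_derivative_scaleR smooth_has_derivative assms smooth_has_derivative_grad)
  then have "frechet_derivative (\<lambda>x. f x *\<^sub>R F x) (at x) =
      (\<lambda>v. f x *\<^sub>R frechet_derivative F (at x) v + (grad f x \<bullet> v) *\<^sub>R F x)"
    by (metis frechet_derivative_at)
  then have "divergence (\<lambda>x. f x *\<^sub>R F x) x =
      f x * divergence F x + (\<Sum>b\<in>Basis. (grad f x \<bullet> b) * (F x \<bullet> b))"
    by (simp add: divergence_def inner_add_left sum.distrib sum_distrib_left)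
  then show ?thesis
    by (simp flip: euclidean_inner)
qed

section \<open>Mean value theorem and symmetry of second derivatives\<close>

lemma smooth_mvt:
  fixes f :: "'a::euclidean_space \<Rightarrow> real"
  assumes "smooth f" "0 < t"
  obtains s where "0 < s" "s < t" "f (x + t *\<^sub>R v) - f x = t * frechet_derivative f (at (x + s *\<^sub>R v)) v"
proof -
  have D: "((\<lambda>s. f (x + s *\<^sub>R v)) has_real_derivative frechet_derivative f (at (x + s *\<^sub>R v)) v) (at s)" for s
  proof -
    have a: "((\<lambda>s. x + s *\<^sub>R v) has_derivative (\<lambda>h. h *\<^sub>R v)) (at s)"
      by (auto intro!: derivative_eq_intros)
    have "((\<lambda>s. f (x + s *\<^sub>R v)) has_derivative (\<lambda>h. grad f (x + s *\<^sub>R v) \<bullet> (h *\<^sub>R v))) (at s)"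
      using diff_chain_at[OF a smooth_has_derivative_grad[OF assms(1)]] by (simp only: o_def)
    then show ?thesis
      unfolding has_field_derivative_def by (rule has_derivative_eq_rhs) (simp add: fun_eq_iff grad_inner[OF assms(1), symmetric])
  qed
  obtain s where "0 < s" "s < t" "f (x + t *\<^sub>R v) - f (x + 0 *\<^sub>R v) = (t - 0) * frechet_derivative f (at (x + s *\<^sub>R v)) v"
    using MVT2[OF assms(2) D] by blast
  then show thesis by (intro that[of s]) simp_all
qed

lemma frechet_derivative_translate:
  assumes "f differentiable at (y + c)"
  shows "frechet_derivative (\<lambda>y. f (y + c)) (at y) = frechet_derivative f (at (y + c))"
proof -
  have "((\<lambda>y. y + c) has_derivative (\<lambda>h. h)) (at y)"
    by (auto intro!: derivative_eq_intros)
  from diff_chain_at[OF this assms[unfolded frechet_derivative_works]]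
  have "((\<lambda>y. f (y + c)) has_derivative frechet_derivative f (at (y + c))) (at y)"
    by (simp only: o_def)
  then show ?thesis by (rule frechet_derivative_at[symmetric])
qed

lemma grad_translate: "smooth f \<Longrightarrow> grad (\<lambda>y. f (y + c)) y = grad f (y + c)"
  unfolding grad_def by (subst frechet_derivative_translate[OF smooth_differentiable]) auto

text \<open>The right-hand side below singles out one order of differentiation while the left-hand side is
  symmetric in \<open>v\<close> and \<open>w\<close>.\<close>

lemma second_difference:
  fixes f :: "'a::euclidean_space \<Rightarrow> real"
  assumes f: "smooth f" and t: "0 < t"
  obtains s s' where "0 < s" "s < t" "0 < s'" "s' < t"
    "f (x + t *\<^sub>R v + t *\<^sub>R w) - f (x + t *\<^sub>R v) - f (x + t *\<^sub>R w) + f x =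
      t\<^sup>2 * frechet_derivative (\<lambda>y. frechet_derivative f (at y) w) (at (x + s *\<^sub>R w + s' *\<^sub>R v)) v"
proof -
  let ?g = "\<lambda>y. f (y + t *\<^sub>R v) - f y"
  have tr: "smooth (\<lambda>y. f (y + t *\<^sub>R v))"
    by (rule smooth_translate[OF f])
  have Dg: "frechet_derivative ?g (at y) = (\<lambda>h. grad f (y + t *\<^sub>R v) \<bullet> h - grad f y \<bullet> h)" for y
    using has_derivative_diff[OF smooth_has_derivative_grad[OF tr, of y] smooth_has_derivative_grad[OF f, of y]]
    unfolding grad_translate[OF f] by (rule frechet_derivative_at[symmetric])
  obtain s where s: "0 < s" "s < t"
    "?g (x + t *\<^sub>R w) - ?g x = t * frechet_derivative ?g (at (x + s *\<^sub>R w)) w"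
    by (rule smooth_mvt[OF smooth_diff[OF tr f] t, where x = x and v = w])
  obtain s' where s': "0 < s'" "s' < t"
    "frechet_derivative f (at (x + s *\<^sub>R w + t *\<^sub>R v)) w - frechet_derivative f (at (x + s *\<^sub>R w)) w =
      t * frechet_derivative (\<lambda>y. frechet_derivative f (at y) w) (at (x + s *\<^sub>R w + s' *\<^sub>R v)) v"
    by (rule smooth_mvt[OF smooth_derivative[OF f] t, where x = "x + s *\<^sub>R w" and v = v])
  have "?g (x + t *\<^sub>R w) - ?g x =
      t * (t * frechet_derivative (\<lambda>y. frechet_derivative f (at y) w) (at (x + s *\<^sub>R w + s' *\<^sub>R v)) v)"
    using s(3) s'(3) by (simp only: Dg grad_inner[OF f])
  moreover have "x + t *\<^sub>R w + t *\<^sub>R v = x + t *\<^sub>R v + t *\<^sub>R w"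
    by (simp only: add.assoc add.commute add.left_commute)
  ultimately show thesis
    by (intro that[OF s(1,2) s'(1,2)]) (simp only: power2_eq_square mult.assoc)
qed

text \<open>The second difference divided by the square of the step converges to both mixed
  derivatives, because \<open>second_difference\<close> may be applied with \<open>v\<close> and
  \<open>w\<close> in either role and the intermediate points shrink to \<open>x\<close>.\<close>

lemma second_derivative_symmetric:
  fixes f :: "'a::euclidean_space \<Rightarrow> real"
  assumes f: "smooth f"
  shows "frechet_derivative (\<lambda>y. frechet_derivative f (at y) v) (at x) w =
    frechet_derivative (\<lambda>y. frechet_derivative f (at y) w) (at x) v"
proof -
  let ?D = "\<lambda>v w x. frechet_derivative (\<lambda>y. frechet_derivative f (at y) v) (at x) w"
  define t where "t n = inverse (real (Suc n))" for n
  have t: "0 < t n" for n by (simp add: t_def)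
  have t0: "t \<longlonglongrightarrow> 0" unfolding t_def by (rule LIMSEQ_inverse_real_of_nat)
  define \<Delta> where "\<Delta> n = f (x + t n *\<^sub>R v + t n *\<^sub>R w) - f (x + t n *\<^sub>R v) - f (x + t n *\<^sub>R w) + f x" for n
  have \<Delta>': "\<Delta> n = f (x + t n *\<^sub>R w + t n *\<^sub>R v) - f (x + t n *\<^sub>R w) - f (x + t n *\<^sub>R v) + f x" for n
    unfolding \<Delta>_def by (simp add: add.commute add.left_commute add.assoc)
  \<comment> \<open>The inner \<open>v\<close> and \<open>w\<close> are fresh while \<Delta> keeps
    the outer ones; this makes both orders of differentiation instances of one limit.\<close>
  have lim: "(\<lambda>n. \<Delta> n / (t n)\<^sup>2) \<longlonglongrightarrow> ?D w v x"
    if ex: "\<And>n. \<exists>s s'. 0 < s \<and> s < t n \<and> 0 < s' \<and> s' < t n \<and> \<Delta> n = (t n)\<^sup>2 * ?D w v (x + s *\<^sub>R w + s' *\<^sub>R v)" for v w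
  proof -
    obtain s s' where s: "\<And>n. 0 < s n \<and> s n < t n \<and> 0 < s' n \<and> s' n < t n \<and>
        \<Delta> n = (t n)\<^sup>2 * ?D w v (x + s n *\<^sub>R w + s' n *\<^sub>R v)"
      using ex by metis
    have "s \<longlonglongrightarrow> 0" "s' \<longlonglongrightarrow> 0"
      by (rule tendsto_sandwich[OF _ _ tendsto_const t0]; use s in \<open>auto intro!: always_eventually less_imp_le\<close>)+
    then have "(\<lambda>n. x + s n *\<^sub>R w + s' n *\<^sub>R v) \<longlonglongrightarrow> x + 0 *\<^sub>R w + 0 *\<^sub>R v"
      by (intro tendsto_intros)
    then have "(\<lambda>n. ?D w v (x + s n *\<^sub>R w + s' n *\<^sub>R v)) \<longlonglongrightarrow> ?D w v (x + 0 *\<^sub>R w + 0 *\<^sub>R v)"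
    proof (rule isCont_tendsto_compose[rotated])
      have "continuous_on UNIV (?D w v)"
        by (intro smooth_continuous smooth_derivative f)
      then show "isCont (?D w v) z" for z
        by (simp only: continuous_on_eq_continuous_at open_UNIV UNIV_I ball_UNIV)
    qed
    moreover have "\<Delta> n / (t n)\<^sup>2 = ?D w v (x + s n *\<^sub>R w + s' n *\<^sub>R v)" for n
      using s[of n] t[of n] by simp
    ultimately show ?thesis by simp
  qed
  have "\<exists>s s'. 0 < s \<and> s < t n \<and> 0 < s' \<and> s' < t n \<and> \<Delta> n = (t n)\<^sup>2 * ?D w v (x + s *\<^sub>R w + s' *\<^sub>R v)" for n
    unfolding \<Delta>_def by (rule second_difference[OF f t[of n], where x = x and v = v and w = w]) (intro exI conjI)
  then have "(\<lambda>n. \<Delta> n / (t n)\<^sup>2) \<longlonglongrightarrow> ?D w v x" by (rule lim)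
  moreover have "\<exists>s s'. 0 < s \<and> s < t n \<and> 0 < s' \<and> s' < t n \<and> \<Delta> n = (t n)\<^sup>2 * ?D v w (x + s *\<^sub>R v + s' *\<^sub>R w)" for n
    unfolding \<Delta>' by (rule second_difference[OF f t[of n], where x = x and v = w and w = v]) (intro exI conjI)
  then have "(\<lambda>n. \<Delta> n / (t n)\<^sup>2) \<longlonglongrightarrow> ?D v w x" by (rule lim)
  ultimately show ?thesis using LIMSEQ_unique by blast
qed

text \<open>Symmetry of second derivatives allows the exchange. It is needed to recognise the
  derivative of a translated gradient as the gradient of a test function, namely of a directional
  derivative.\<close>

lemma derivative_grad:
  fixes u :: "'a::euclidean_space \<Rightarrow> real"
  assumes u: "smooth u"
  shows "frechet_derivative (grad u) (at x) v = grad (\<lambda>y. frechet_derivative u (at y) v) x"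
proof -
  have "(grad u has_derivative (\<lambda>v. \<Sum>b\<in>Basis. frechet_derivative (\<lambda>y. frechet_derivative u (at y) b) (at x) v *\<^sub>R b)) (at x)"
    unfolding grad_def[abs_def]
    by (intro has_derivative_sum has_derivative_scaleR_left smooth_has_derivative smooth_derivative u)
  then have "frechet_derivative (grad u) (at x) =
      (\<lambda>v. \<Sum>b\<in>Basis. frechet_derivative (\<lambda>y. frechet_derivative u (at y) b) (at x) v *\<^sub>R b)"
    by (rule frechet_derivative_at[symmetric])
  moreover have "(\<Sum>b\<in>Basis. frechet_derivative (\<lambda>y. frechet_derivative u (at y) b) (at x) v *\<^sub>R b) =
      (\<Sum>b\<in>Basis. frechet_derivative (\<lambda>y. frechet_derivative u (at y) v) (at x) b *\<^sub>R b)"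
    by (intro sum.cong refl arg_cong2[where f = scaleR] second_derivative_symmetric[OF u])
  ultimately show ?thesis
    by (simp only: grad_def)
qed

section \<open>Bounds and integrals of test functions\<close>

lemma integrable_compact_support:
  fixes f :: "'a::euclidean_space \<Rightarrow> 'b::{banach,second_countable_topology}"
  assumes "continuous_on UNIV f" "\<And>x. r < norm x \<Longrightarrow> f x = 0"
  shows "integrable lborel f"
proof -
  have "integrable lborel (\<lambda>x. indicator (cball 0 r) x *\<^sub>R f x)"
    using assms(1) continuous_on_subset by (intro borel_integrable_compact) auto
  also have "(\<lambda>x. indicator (cball 0 r) x *\<^sub>R f x) = f"
    using assms(2) by (auto simp: indicator_def fun_eq_iff)
  finally show ?thesis .
qed

lemma Cc_infty_integrable:
  fixes f :: "'a::euclidean_space \<Rightarrow> 'b::{banach,second_countable_topology}"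
  assumes "f \<in> Cc_infty"
  shows "integrable lborel f"
  using assms by (metis Cc_inftyE integrable_compact_support smooth_continuous Cc_infty_smooth)

lemma Cc_infty_bounded:
  fixes f :: "'a::euclidean_space \<Rightarrow> 'b::real_normed_vector"
  assumes "f \<in> Cc_infty"
  obtains B where "0 < B" "\<And>x. norm (f x) \<le> B"
proof -
  obtain r where r: "0 < r" "\<And>x. r < norm x \<Longrightarrow> f x = 0" using assms Cc_inftyE by metis
  have "bounded (f ` cball 0 r)"
    using smooth_continuous[OF Cc_infty_smooth[OF assms]] continuous_on_subset
    by (intro compact_imp_bounded compact_continuous_image) auto
  then obtain B where "0 < B" "\<And>x. x \<in> cball 0 r \<Longrightarrow> norm (f x) \<le> B"
    by (auto simp: bounded_pos)
  then have "norm (f x) \<le> B" for x using r by (cases "r < norm x") (auto simp: not_less)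
  then show thesis using that[of B] \<open>0 < B\<close> by blast
qed

lemma onorm_le_sum_Basis:
  fixes T :: "'a::euclidean_space \<Rightarrow> 'b::real_normed_vector"
  assumes "linear T"
  shows "onorm T \<le> (\<Sum>b\<in>Basis. norm (T b))"
proof (rule onorm_le)
  fix v :: 'a
  have "norm (T v) = norm (\<Sum>b\<in>Basis. (v \<bullet> b) *\<^sub>R T b)"
    by (subst euclidean_representation[of v, symmetric])
       (simp add: linear_sum[OF assms] linear_cmul[OF assms])
  also have "\<dots> \<le> (\<Sum>b\<in>Basis. \<bar>v \<bullet> b\<bar> * norm (T b))"
    by (rule sum_norm_le) simp
  also have "\<dots> \<le> (\<Sum>b\<in>Basis. norm v * norm (T b))"
    by (intro sum_mono mult_right_mono Basis_le_norm) auto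
  finally show "norm (T v) \<le> (\<Sum>b\<in>Basis. norm (T b)) * norm v"
    by (simp add: sum_distrib_left mult.commute)
qed

lemma Cc_infty_lipschitz:
  fixes f :: "'a::euclidean_space \<Rightarrow> 'b::real_normed_vector"
  assumes f: "f \<in> Cc_infty"
  obtains L where "0 \<le> L" "\<And>x y. norm (f x - f y) \<le> L * norm (x - y)"
proof -
  have "\<exists>B. \<forall>x. norm (frechet_derivative f (at x) b) \<le> B" for b
    using Cc_infty_bounded[OF Cc_infty_derivative[OF f]] by metis
  then obtain B where B: "\<And>x b. norm (frechet_derivative f (at x) b) \<le> B b" by metis
  have on: "onorm (frechet_derivative f (at x)) \<le> (\<Sum>b\<in>Basis. B b)" for x
  proof -
    have "onorm (frechet_derivative f (at x)) \<le> (\<Sum>b\<in>Basis. norm (frechet_derivative f (at x) b))"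
      by (intro onorm_le_sum_Basis linear_frechet_derivative smooth_differentiable Cc_infty_smooth f)
    also have "\<dots> \<le> (\<Sum>b\<in>Basis. B b)" by (intro sum_mono B)
    finally show ?thesis .
  qed
  show thesis
  proof (rule that)
    show "norm (f x - f y) \<le> (\<Sum>b\<in>Basis. B b) * norm (x - y)" for x y
      by (rule differentiable_bound[of UNIV f "\<lambda>x. frechet_derivative f (at x)"])
         (auto intro: smooth_has_derivative Cc_infty_smooth f on)
    show "0 \<le> (\<Sum>b\<in>Basis. B b)"
      using order_trans[OF norm_ge_zero B] by (rule sum_nonneg)
  qed
qed

text \<open>The first derivatives are Lipschitz, so the derivative varies by at most a multiple of
  \<open>norm h\<close> on the ball of that radius. Uniformity in \<open>x\<close> is the point: it
  allows the remainder to be integrated when differentiating translates and convolutions.\<close>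

lemma Cc_infty_taylor:
  fixes f :: "'a::euclidean_space \<Rightarrow> 'b::real_normed_vector"
  assumes f: "f \<in> Cc_infty"
  obtains C where "0 \<le> C" "\<And>x h. norm (f (x + h) - f x - frechet_derivative f (at x) h) \<le> C * (norm h)\<^sup>2"
proof -
  let ?D = "\<lambda>x. frechet_derivative f (at x)"
  have "\<exists>L\<ge>0. \<forall>x y. norm (?D x b - ?D y b) \<le> L * norm (x - y)" for b
    using Cc_infty_lipschitz[OF Cc_infty_derivative[OF f]] by metis
  then obtain L where L: "\<And>b. 0 \<le> L b" "\<And>x y b. norm (?D x b - ?D y b) \<le> L b * norm (x - y)" by metis
  have lin: "linear (?D x)" for x
    by (intro linear_frechet_derivative smooth_differentiable Cc_infty_smooth f)
  have "norm (f (x + h) - f x - ?D x h) \<le> (\<Sum>b\<in>Basis. L b) * (norm h)\<^sup>2" for x h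
  proof -
    have on: "onorm (?D y - ?D x) \<le> (\<Sum>b\<in>Basis. L b) * norm h" if "y \<in> cball x (norm h)" for y
    proof -
      have "onorm (?D y - ?D x) \<le> (\<Sum>b\<in>Basis. norm ((?D y - ?D x) b))"
        by (intro onorm_le_sum_Basis) (simp add: fun_diff_def linear_compose_sub lin)
      also have "\<dots> \<le> (\<Sum>b\<in>Basis. L b * norm h)"
      proof (intro sum_mono)
        fix b :: 'a
        have "norm ((?D y - ?D x) b) \<le> L b * norm (y - x)" using L(2) by simp
        also have "\<dots> \<le> L b * norm h"
          using that L(1) by (intro mult_left_mono) (auto simp: dist_norm norm_minus_commute)
        finally show "norm ((?D y - ?D x) b) \<le> L b * norm h" .
      qed
      finally show ?thesis by (simp add: sum_distrib_right)
    qed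
    have "norm (f (x + h) - f x - ?D x (x + h - x)) \<le> norm (x + h - x) * ((\<Sum>b\<in>Basis. L b) * norm h)"
    proof (rule differentiable_bound_linearization[of x "x + h" "cball x (norm h)" f ?D x])
      show "x + t *\<^sub>R (x + h - x) \<in> cball x (norm h)" if "t \<in> {0..1}" for t
        using that by (auto simp: dist_norm mult_left_le_one_le)
    qed (auto intro: on has_derivative_at_withinI smooth_has_derivative Cc_infty_smooth f)
    then show ?thesis by (simp add: power2_eq_square mult_ac)
  qed
  then show thesis
    using that[of "\<Sum>b\<in>Basis. L b"] L(1) by (simp add: sum_nonneg)
qed

section \<open>Invariance of Lebesgue measure and exchange of integrals\<close>

lemma nn_integral_lborel_translate:
  fixes f :: "'a::euclidean_space \<Rightarrow> ennreal"
  assumes [measurable]: "f \<in> borel_measurable borel"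
  shows "(\<integral>\<^sup>+x. f (x + z) \<partial>lborel) = (\<integral>\<^sup>+x. f x \<partial>lborel)"
  by (subst lborel_distr_plus[of z, symmetric], subst nn_integral_distr) (auto simp: add.commute)

lemma integral_lborel_translate:
  fixes f :: "'a::euclidean_space \<Rightarrow> 'b::{banach,second_countable_topology}"
  assumes [measurable]: "f \<in> borel_measurable borel"
  shows "(\<integral>x. f (x + z) \<partial>lborel) = (\<integral>x. f x \<partial>lborel)"
  by (subst (2) lborel_distr_plus[of z, symmetric], subst integral_distr) (auto simp: add.commute)

lemma integral_lborel_reflect:
  fixes f :: "'a::euclidean_space \<Rightarrow> 'b::{banach,second_countable_topology}"
  assumes [measurable]: "f \<in> borel_measurable borel"
  shows "(\<integral>x. f (- x) \<partial>lborel) = (\<integral>x. f x \<partial>lborel)"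
  by (subst (2) lborel_affine[of "-1" 0], simp, subst integral_density)
     (auto simp: integral_distr)

lemma borel_measurable_smooth: "smooth f \<Longrightarrow> f \<in> borel_measurable borel"
  by (rule borel_measurable_continuous_onI[OF smooth_continuous])

lemma lborel_integral_swap:
  fixes F :: "'a::euclidean_space \<Rightarrow> 'b::euclidean_space \<Rightarrow> 'c::{banach,second_countable_topology}"
  assumes c: "continuous_on UNIV (\<lambda>(x, y). F x y)"
    and "\<And>x y. r < norm x \<Longrightarrow> F x y = 0" "\<And>x y. r < norm y \<Longrightarrow> F x y = 0"
  shows "(\<integral>x. \<integral>y. F x y \<partial>lborel \<partial>lborel) = (\<integral>y. \<integral>x. F x y \<partial>lborel \<partial>lborel)"
proof -
  have "integrable lborel (\<lambda>(x, y). F x y)"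
  proof (rule integrable_compact_support[OF c])
    fix p :: "'a \<times> 'b" assume p: "2 * r < norm p"
    have "norm p \<le> norm (fst p) + norm (snd p)" using norm_Pair_le[of "fst p" "snd p"] by simp
    then have "r < norm (fst p) \<or> r < norm (snd p)" using p by linarith
    then show "(case p of (x, y) \<Rightarrow> F x y) = 0" using assms by (cases p) auto
  qed
  then have "integrable (lborel \<Otimes>\<^sub>M lborel) (\<lambda>(x, y). F x y)" by (simp add: lborel_prod)
  from lborel_pair.Fubini_integral[OF this] show ?thesis by simp
qed

text \<open>By translation invariance the difference quotient of \<open>f\<close> in direction
  \<open>v\<close> has integral 0. It differs from the derivative by O(t) uniformly, on a ball
  independent of t, so the integral of the derivative is O(t) for every small t.\<close>

lemma integral_derivative_eq_0:
  fixes f :: "'a::euclidean_space \<Rightarrow> 'b::euclidean_space"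
  assumes f: "f \<in> Cc_infty"
  shows "(\<integral>x. frechet_derivative f (at x) v \<partial>lborel) = 0"
proof -
  let ?D = "\<lambda>x. frechet_derivative f (at x) v"
  obtain C where C: "0 \<le> C" "\<And>x h. norm (f (x + h) - f x - frechet_derivative f (at x) h) \<le> C * (norm h)\<^sup>2"
    using Cc_infty_taylor[OF f] by metis
  obtain r where r: "0 < r" "\<And>x. r < norm x \<Longrightarrow> f x = 0" using f Cc_inftyE by metis
  \<comment> \<open>The support radius enlarged by the largest shift that occurs, as
    \<open>t \<le> 1\<close>.\<close>
  define R where "R = r + norm v"
  define K where "K = C * (norm v)\<^sup>2 * measure lborel (cball (0::'a) R)"
  have lin: "linear (frechet_derivative f (at x))" for x
    by (intro linear_frechet_derivative smooth_differentiable Cc_infty_smooth f)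
  have le: "norm (\<integral>x. ?D x \<partial>lborel) \<le> t * K" if t: "0 < t" "t \<le> 1" for t
  proof -
    let ?E = "\<lambda>x. f (x + t *\<^sub>R v) - f x - t *\<^sub>R ?D x"
    have ft: "(\<lambda>x. f (x + t *\<^sub>R v)) \<in> Cc_infty" by (rule Cc_infty_translate[OF f])
    have i: "integrable lborel f" "integrable lborel (\<lambda>x. f (x + t *\<^sub>R v))" "integrable lborel ?D"
      by (intro Cc_infty_integrable f ft Cc_infty_derivative)+
    have "(\<integral>x. ?E x \<partial>lborel) = - t *\<^sub>R (\<integral>x. ?D x \<partial>lborel)"
      using i integral_lborel_translate[of f "t *\<^sub>R v"] borel_measurable_smooth[OF Cc_infty_smooth[OF f]] by simp
    then have "t * norm (\<integral>x. ?D x \<partial>lborel) = norm (\<integral>x. ?E x \<partial>lborel)"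
      using t by simp
    also have "\<dots> \<le> (\<integral>x. C * (norm (t *\<^sub>R v))\<^sup>2 * indicator (cball (0::'a) R) x \<partial>lborel)"
    proof (rule Bochner_Integration.integral_norm_bound_integral)
      show "integrable lborel ?E" using i by simp
      show "integrable lborel (\<lambda>x::'a. C * (norm (t *\<^sub>R v))\<^sup>2 * indicator (cball 0 R) x)"
        by (intro integrable_mult_right integrable_real_indicator) (simp_all add: emeasure_lborel_cball_finite[unfolded infinity_ennreal_def])
      fix x :: 'a
      show "norm (?E x) \<le> C * (norm (t *\<^sub>R v))\<^sup>2 * indicator (cball 0 R) x"
      proof (cases "x \<in> cball 0 R")
        case True
        then show ?thesis using C(2)[of x "t *\<^sub>R v"] by (simp add: linear_cmul[OF lin])
      next
        case False
        have "t * norm v \<le> norm v" using t by (simp add: mult_left_le_one_le)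
        moreover have "r + norm v < norm x" "0 \<le> norm v"
          using False by (simp_all add: R_def)
        moreover have "norm x \<le> norm (x + t *\<^sub>R v) + t * norm v"
          using norm_triangle_ineq4[of "x + t *\<^sub>R v" "t *\<^sub>R v"] t by simp
        ultimately have "r < norm (x + t *\<^sub>R v)" "r < norm x" by linarith+
        then show ?thesis
          using r(2) frechet_derivative_eq_0[of r f x] False by simp
      qed
    qed
    also have "\<dots> = t * (t * K)"
      using t by (simp add: K_def power_mult_distrib power2_eq_square)
    finally show ?thesis using t by simp
  qed
  have "norm (\<integral>x. ?D x \<partial>lborel) \<le> 0"
  proof (rule tendsto_lowerbound)
    show "((\<lambda>t. t * K) \<longlongrightarrow> 0) (at_right 0)"
      by (rule tendsto_eq_intros refl | simp)+
    show "\<forall>\<^sub>F t in at_right 0. norm (\<integral>x. ?D x \<partial>lborel) \<le> t * K"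
      using le by (intro eventually_at_rightI[of 0 1]) auto
  qed simp
  then show ?thesis by simp
qed

lemma integral_divergence_eq_0:
  assumes "F \<in> Cc_infty"
  shows "(\<integral>x. divergence F x \<partial>lborel) = 0"
  unfolding divergence_def
  by (simp add: integral_derivative_eq_0[OF assms] Cc_infty_integrable Cc_infty_derivative[OF assms] Bochner_Integration.integral_sum)

lemma integral_by_parts:
  fixes f :: "'a::euclidean_space \<Rightarrow> real"
  assumes "smooth f" "smooth F" "f \<in> Cc_infty \<or> F \<in> Cc_infty"
  shows "(\<integral>x. f x * divergence F x \<partial>lborel) = - (\<integral>x. grad f x \<bullet> F x \<partial>lborel)"
proof -
  have "integrable lborel (\<lambda>x. f x * divergence F x)"
    using assms Cc_infty_divergence by (intro Cc_infty_integrable Cc_infty_mult smooth_divergence) auto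
  moreover have "integrable lborel (\<lambda>x. grad f x \<bullet> F x)"
    using assms Cc_infty_grad
    by (intro Cc_infty_integrable Cc_infty_bilinear[OF bounded_bilinear_inner] smooth_grad) auto
  moreover have "(\<integral>x. divergence (\<lambda>x. f x *\<^sub>R F x) x \<partial>lborel) = 0"
    by (intro integral_divergence_eq_0 Cc_infty_scaleR assms)
  ultimately show ?thesis
    by (simp add: divergence_scaleR assms)
qed

text \<open>The inner \<open>flat_exp\<close> vanishes for \<open>norm x \<le> r\<close>; the factor
  \<open>exp 1\<close> turns the resulting value \<open>flat_exp 0 1\<close> into 1. For
  \<open>norm x \<ge> 2 * r\<close> its argument is at least 3, its value exceeds 1 / 2, and the
  factor 2 makes the outer argument nonpositive, hence the bump 0.\<close>

definition bump :: "real \<Rightarrow> 'a::euclidean_space \<Rightarrow> real"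
  where "bump r x = exp 1 * flat_exp 0 (1 - 2 * flat_exp 0 ((x /\<^sub>R r) \<bullet> (x /\<^sub>R r) - 1))"

lemma flat_exp_0_le: "t \<le> 1 \<Longrightarrow> flat_exp 0 t \<le> exp (- 1)"
  by (simp add: flat_exp_def divide_simps)

lemma flat_exp_0_nonneg: "0 \<le> flat_exp 0 t"
  by (simp add: flat_exp_def)

lemma smooth_bump: "smooth (bump r :: 'a::euclidean_space \<Rightarrow> real)"
proof -
  have "smooth (\<lambda>x::'a. inverse r *\<^sub>R x)"
    by (intro smooth_scaleR smooth_const smooth_ident)
  then show ?thesis
    unfolding bump_def[abs_def]
    by (intro smooth_mult smooth_const smooth_compose_real[OF smooth_flat_exp] smooth_diff smooth_inner)
qed

lemma bump_nonneg: "0 \<le> bump r x"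
  by (simp add: bump_def flat_exp_0_nonneg)

lemma bump_le_1: "bump r x \<le> 1"
proof -
  have "flat_exp 0 (1 - 2 * flat_exp 0 ((x /\<^sub>R r) \<bullet> (x /\<^sub>R r) - 1)) \<le> exp (- 1)"
    using flat_exp_0_nonneg by (intro flat_exp_0_le) simp
  then have "bump r x \<le> exp 1 * exp (- 1)"
    unfolding bump_def by (intro mult_left_mono) auto
  then show ?thesis by (simp flip: exp_add)
qed

lemma bump_eq_1:
  assumes "0 < r" "norm x \<le> r"
  shows "bump r x = 1"
proof -
  have "norm (x /\<^sub>R r) \<le> 1" using assms by (simp add: divide_simps)
  then have "(norm (x /\<^sub>R r))\<^sup>2 \<le> 1" by (simp add: power_le_one)
  then have "(x /\<^sub>R r) \<bullet> (x /\<^sub>R r) \<le> 1" by (simp only: power2_norm_eq_inner)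
  then have "flat_exp 0 ((x /\<^sub>R r) \<bullet> (x /\<^sub>R r) - 1) = 0" by (simp add: flat_exp_def)
  then have "bump r x = exp 1 * flat_exp 0 1" unfolding bump_def by (simp only: mult_zero_right diff_zero)
  then show ?thesis by (simp add: flat_exp_def flip: exp_add)
qed

lemma bump_eq_0:
  assumes "0 < r" "2 * r \<le> norm x"
  shows "bump r x = 0"
proof -
  have "2 \<le> norm (x /\<^sub>R r)" using assms by (simp add: divide_simps)
  then have "2\<^sup>2 \<le> (norm (x /\<^sub>R r))\<^sup>2" by (intro power_mono) auto
  moreover define s where "s = (x /\<^sub>R r) \<bullet> (x /\<^sub>R r) - 1"
  ultimately have s: "3 \<le> s" by (simp only: power2_norm_eq_inner) simp
  have "1 / 2 \<le> 1 + - 1 / s"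
    using s by (simp add: divide_simps)
  also have "\<dots> \<le> exp (- 1 / s)"
    by (rule exp_ge_add_one_self)
  also have "\<dots> = flat_exp 0 s"
    using s by (simp add: flat_exp_def)
  finally have "1 - 2 * flat_exp 0 s \<le> 0" by simp
  then show ?thesis unfolding bump_def s_def[symmetric] by (simp add: flat_exp_def)
qed

lemma bump_Cc_infty: "0 < r \<Longrightarrow> bump r \<in> Cc_infty"
  by (rule Cc_inftyI[of _ "2 * r"]) (auto simp: smooth_bump bump_eq_0)

lemma bump_minus: "bump r (- x) = bump r x"
  by (simp add: bump_def)

lemma grad_bump_scale:
  assumes "0 < r"
  shows "grad (bump r) x = grad (bump 1) (x /\<^sub>R r) /\<^sub>R r"
proof (rule grad_eqI)
  have "((\<lambda>x. x /\<^sub>R r) has_derivative (\<lambda>v. v /\<^sub>R r)) (at x)"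
    by (auto intro!: derivative_eq_intros)
  from diff_chain_at[OF this smooth_has_derivative_grad[OF smooth_bump[of 1]]]
  have "((\<lambda>x. bump 1 (x /\<^sub>R r)) has_derivative (\<lambda>v. grad (bump 1) (x /\<^sub>R r) \<bullet> (v /\<^sub>R r))) (at x)"
    by (simp only: o_def)
  moreover have "(\<lambda>x::'a. bump 1 (x /\<^sub>R r)) = bump r"
    by (simp add: bump_def fun_eq_iff)
  ultimately show "(bump r has_derivative (\<bullet>) (grad (bump 1) (x /\<^sub>R r) /\<^sub>R r)) (at x)"
    by (simp add: inner_scaleR_left[abs_def])
qed

text \<open>All bumps are dilates of \<open>bump 1\<close>, so one constant serves every radius. The
  gain \<open>1 / r\<close> pays for the factor R in the Poincare inequality and for the growth of
  the mass on large balls.\<close>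

lemma grad_bump_bound:
  obtains K where "0 < K" "\<And>r x. 0 < r \<Longrightarrow> norm (grad (bump r) (x::'a::euclidean_space)) \<le> K / r"
proof -
  obtain K where K: "0 < K" "\<And>x::'a. norm (grad (bump 1) x) \<le> K"
    by (rule Cc_infty_bounded[OF Cc_infty_grad[OF bump_Cc_infty[of 1, OF zero_less_one]]]) blast
  show thesis
  proof (rule that[OF K(1)])
    fix r x assume r: "0 < (r::real)"
    then show "norm (grad (bump r) (x::'a)) \<le> K / r"
      using K(2)[of "x /\<^sub>R r"] by (simp add: grad_bump_scale[OF r, of x] divide_simps)
  qed
qed

lemma grad_bump_eq_0:
  assumes "0 < r" "2 * r < norm x"
  shows "grad (bump r) x = 0"
proof -
  have "frechet_derivative (bump r) (at x) = (\<lambda>v. 0)"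
    by (rule frechet_derivative_eq_0[of "2 * r"]) (use assms in \<open>auto intro: bump_eq_0\<close>)
  then show ?thesis by (simp add: grad_def)
qed

section \<open>Translations and convolutions of test functions\<close>

lemma fun_of_Cc_infty: "fun_of u \<in> Cc_infty"
  by (rule fun_of)

lemma test_fun_eqI: "(\<And>x. fun_of u x = fun_of v x) \<Longrightarrow> u = v"
  by (simp add: fun_of_inject[symmetric] fun_eq_iff)

lemma fun_of_minus: "fun_of (u - v) x = fun_of u x - fun_of v x"
  by (simp only: diff_conv_add_uminus plus_test_fun.rep_eq uminus_test_fun.rep_eq)

lemma grad_minus: "grad (fun_of (u - v)) x = grad (fun_of u) x - grad (fun_of v) x"
proof -
  have "u - v = u + (- 1) *\<^sub>R v" by simp
  then show ?thesis by (simp only: grad_plus grad_scaleR) simp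
qed

lemma norm_test_fun_sq: "(norm u)\<^sup>2 = (\<integral>x. (norm (grad (fun_of u) x))\<^sup>2 \<partial>lborel)"
  by (simp add: norm_test_fun_def)

lemma integrable_norm_grad_sq: "integrable lborel (\<lambda>x. (norm (grad (fun_of u) x))\<^sup>2)"
  using integrable_grad_inner_grad[of u u] by (simp add: power2_norm_eq_inner)

lemma norm_test_fun_le:
  fixes u :: "'a::euclidean_space test_fun"
  assumes "0 \<le> B" "\<And>x. norm (grad (fun_of u) x) \<le> B" "\<And>x. r < norm x \<Longrightarrow> fun_of u x = 0"
  shows "norm u \<le> B * sqrt (measure lborel (cball (0::'a) r))"
proof (rule power2_le_imp_le)
  have "(norm u)\<^sup>2 \<le> (\<integral>x. B\<^sup>2 * indicator (cball (0::'a) r) x \<partial>lborel)"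
    unfolding norm_test_fun_sq
  proof (rule integral_mono[OF integrable_norm_grad_sq])
    show "integrable lborel (\<lambda>x::'a. B\<^sup>2 * indicator (cball (0::'a) r) x)"
      by (intro integrable_mult_right integrable_real_indicator)
         (simp_all add: emeasure_lborel_cball_finite[unfolded infinity_ennreal_def])
    fix x :: 'a
    show "(norm (grad (fun_of u) x))\<^sup>2 \<le> B\<^sup>2 * indicator (cball (0::'a) r) x"
    proof (cases "x \<in> cball 0 r")
      case True
      then show ?thesis using assms(2) by (simp add: power_mono)
    next
      case False
      then have "frechet_derivative (fun_of u) (at x) = (\<lambda>v. 0)"
        by (intro frechet_derivative_eq_0[of r] assms(3)) auto
      then show ?thesis by (simp add: grad_def)
    qed
  qed
  then show "(norm u)\<^sup>2 \<le> (B * sqrt (measure lborel (cball (0::'a) r)))\<^sup>2"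
    by (simp add: power_mult_distrib)
  show "0 \<le> B * sqrt (measure lborel (cball (0::'a) r))"
    using assms(1) by simp
qed

section \<open>Translations in the Dirichlet norm\<close>

definition translate :: "'a::euclidean_space \<Rightarrow> 'a test_fun \<Rightarrow> 'a test_fun"
  where "translate z u = Test_fun (\<lambda>x. fun_of u (x + z))"

lemma fun_of_translate: "fun_of (translate z u) = (\<lambda>x. fun_of u (x + z))"
  unfolding translate_def by (rule Test_fun_inverse[OF Cc_infty_translate[OF fun_of_Cc_infty]])

lemma grad_fun_of_translate: "grad (fun_of (translate z u)) x = grad (fun_of u) (x + z)"
  unfolding fun_of_translate by (rule grad_translate[OF smooth_fun_of])

lemma translate_translate: "translate z (translate y u) = translate (z + y) u"
  by (rule test_fun_eqI) (simp add: fun_of_translate add.assoc)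

lemma translate_0 [simp]: "translate 0 u = u"
  by (rule test_fun_eqI) (simp add: fun_of_translate)

lemma inner_translate: "inner (translate z u) (translate z v) = inner u v"
proof -
  have "(\<lambda>x. grad (fun_of u) x \<bullet> grad (fun_of v) x) \<in> borel_measurable borel"
    by (intro borel_measurable_continuous_onI continuous_on_inner continuous_grad smooth_fun_of)
  from integral_lborel_translate[OF this, of z] show ?thesis
    by (simp add: inner_test_fun_def grad_fun_of_translate)
qed

lemma inner_translate_left: "inner (translate z u) v = inner u (translate (- z) v)"
  using inner_translate[of z u "translate (- z) v"] by (simp add: translate_translate)

lemma norm_translate [simp]: "norm (translate z u) = norm u"
  by (simp add: norm_eq_sqrt_inner inner_translate)

definition dir_deriv :: "'a::euclidean_space \<Rightarrow> 'a test_fun \<Rightarrow> 'a test_fun"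
  where "dir_deriv v u = Test_fun (\<lambda>x. frechet_derivative (fun_of u) (at x) v)"

lemma fun_of_dir_deriv: "fun_of (dir_deriv v u) = (\<lambda>x. frechet_derivative (fun_of u) (at x) v)"
  unfolding dir_deriv_def by (rule Test_fun_inverse[OF Cc_infty_derivative[OF fun_of_Cc_infty]])

text \<open>The norm only sees gradients, so the remainder is controlled by the uniform Taylor bound
  for \<open>grad (fun_of u)\<close>, on a ball that contains the supports of all the functions
  involved.\<close>

lemma translate_has_derivative:
  fixes u :: "'a::euclidean_space test_fun"
  shows "((\<lambda>z. translate z u) has_derivative (\<lambda>v. translate z (dir_deriv v u))) (at z)"
  unfolding has_derivative_at
proof
  have lin: "linear (frechet_derivative (fun_of u) (at x))" for x
    by (intro linear_frechet_derivative smooth_differentiable smooth_fun_of)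
  have "linear (\<lambda>v. translate z (dir_deriv v u))"
    by (intro linearI test_fun_eqI)
       (simp_all add: fun_of_translate fun_of_dir_deriv plus_test_fun.rep_eq scaleR_test_fun.rep_eq
         linear_add[OF lin] linear_cmul[OF lin])
  then show "bounded_linear (\<lambda>v. translate z (dir_deriv v u))"
    by (simp add: linear_conv_bounded_linear)
  obtain C where C: "0 \<le> C" "\<And>x h. norm (grad (fun_of u) (x + h) - grad (fun_of u) x -
      frechet_derivative (grad (fun_of u)) (at x) h) \<le> C * (norm h)\<^sup>2"
    by (rule Cc_infty_taylor[OF Cc_infty_grad[OF fun_of_Cc_infty[of u]]]) blast
  obtain r where r: "0 < r" "\<And>x. r < norm x \<Longrightarrow> fun_of u x = 0"
    by (rule Cc_inftyE[OF fun_of_Cc_infty[of u]]) blast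
  \<comment> \<open>The summand 1 accommodates all increments with
    \<open>norm h \<le> 1\<close>.\<close>
  define R where "R = r + norm z + 1"
  define m where "m = sqrt (measure lborel (cball (0::'a) R))"
  have est: "norm (translate (z + h) u - translate z u - translate z (dir_deriv h u)) \<le> C * (norm h)\<^sup>2 * m"
    if h: "norm h \<le> 1" for h
    unfolding m_def
  proof (rule norm_test_fun_le)
    show "0 \<le> C * (norm h)\<^sup>2" using C(1) by simp
    fix x :: 'a
    have "grad (fun_of (translate (z + h) u - translate z u - translate z (dir_deriv h u))) x =
        grad (fun_of u) ((x + z) + h) - grad (fun_of u) (x + z) - frechet_derivative (grad (fun_of u)) (at (x + z)) h"
      by (simp add: grad_minus grad_fun_of_translate fun_of_dir_deriv derivative_grad[OF smooth_fun_of] add.assoc)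
    then show "norm (grad (fun_of (translate (z + h) u - translate z u - translate z (dir_deriv h u))) x) \<le> C * (norm h)\<^sup>2"
      using C(2)[of "x + z" h] by (simp only:)
    assume x: "R < norm x"
    have "norm x \<le> norm (x + z) + norm z" using norm_triangle_ineq4[of "x + z" z] by simp
    moreover have "norm x \<le> norm (x + (z + h)) + norm z + norm h"
      using norm_triangle_ineq4[of "x + (z + h)" "z + h"] norm_triangle_ineq[of z h] by simp
    ultimately have "r < norm (x + z)" "r < norm (x + (z + h))" using x h unfolding R_def by linarith+
    then show "fun_of (translate (z + h) u - translate z u - translate z (dir_deriv h u)) x = 0"
      using r(2) frechet_derivative_eq_0[OF r(2), where x = "x + z"]
      by (simp add: fun_of_minus fun_of_translate fun_of_dir_deriv)
  qed
  show "(\<lambda>h. norm (translate (z + h) u - translate z u - translate z (dir_deriv h u)) / norm h) \<midarrow>0\<rightarrow> 0"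
  proof (rule Lim_null_comparison)
    show "((\<lambda>h. C * norm h * m) \<longlongrightarrow> 0) (at (0::'a))"
      by (rule tendsto_eq_intros refl | simp)+
    show "\<forall>\<^sub>F h in at 0. norm (norm (translate (z + h) u - translate z u - translate z (dir_deriv h u)) / norm h) \<le> C * norm h * m"
      unfolding eventually_at
    proof (intro exI[of _ 1] conjI ballI impI)
      fix h :: 'a assume "h \<noteq> 0 \<and> dist h 0 < 1"
      then show "norm (norm (translate (z + h) u - translate z u - translate z (dir_deriv h u)) / norm h) \<le> C * norm h * m"
        using est[of h] by (simp add: divide_simps power2_eq_square mult_ac)
    qed simp
  qed
qed

lemma translate_tendsto:
  assumes "(z \<longlongrightarrow> c) F"
  shows "((\<lambda>n. translate (z n) u) \<longlongrightarrow> translate c u) F"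
  using isCont_tendsto_compose[OF has_derivative_continuous[OF translate_has_derivative] assms] .

text \<open>Differentiating gives a function of the same form with \<open>u\<close> replaced by one
  of its directional derivatives, so the induction runs over all \<open>u\<close> at once. This is
  where the smoothness of the mollified functional comes from.\<close>

lemma smooth_functional_translate:
  assumes L: "bounded_linear L"
  shows "smooth (\<lambda>x. L (translate (- x) u) :: real)"
proof -
  have D: "((\<lambda>x. L (translate (- x) u)) has_derivative (\<lambda>v. L (translate (- x) (dir_deriv (- v) u)))) (at x)" for x u
  proof -
    have "(uminus has_derivative uminus) (at x)"
      by (auto intro!: derivative_eq_intros)
    from diff_chain_at[OF this translate_has_derivative]
    have "((\<lambda>x. translate (- x) u) has_derivative (\<lambda>v. translate (- x) (dir_deriv (- v) u))) (at x)"
      by (simp only: o_def)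
    from bounded_linear.has_derivative[OF L this] show ?thesis .
  qed
  have "C_k k (\<lambda>x. L (translate (- x) u))" for k
  proof (induction k arbitrary: u)
    case 0
    show ?case
      unfolding C_k.simps using has_derivative_continuous[OF D]
      by (simp add: continuous_on_eq_continuous_at)
  next
    case (Suc k)
    show ?case by (rule C_k_SucI[OF D Suc])
  qed
  then show ?thesis by (simp add: smooth_def)
qed

text \<open>Far translates have disjoint supports. For functionals of the form
  \<open>inner v\<close> the mollified function thus even has compact support.\<close>

lemma inner_translate_far:
  fixes u v :: "'a::euclidean_space test_fun"
  obtains R where "\<And>z. R < norm z \<Longrightarrow> inner v (translate z u) = 0"
proof -
  obtain r where r: "\<And>x. r < norm x \<Longrightarrow> grad (fun_of u) x = 0"
    by (rule Cc_inftyE[OF Cc_infty_grad[OF fun_of_Cc_infty[of u]]]) blast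
  obtain s where s: "\<And>x. s < norm x \<Longrightarrow> grad (fun_of v) x = 0"
    by (rule Cc_inftyE[OF Cc_infty_grad[OF fun_of_Cc_infty[of v]]]) blast
  show thesis
  proof (rule that)
    fix z :: 'a assume z: "r + s < norm z"
    have "grad (fun_of v) x \<bullet> grad (fun_of u) (x + z) = 0" for x
    proof (cases "s < norm x")
      case False
      have "norm z \<le> norm (x + z) + norm x" using norm_triangle_ineq4[of "x + z" x] by simp
      then have "r < norm (x + z)" using False z by linarith
      then show ?thesis using r by simp
    qed (use s in simp)
    then show "inner v (translate z u) = 0"
      by (simp add: inner_test_fun_def grad_fun_of_translate)
  qed
qed

text \<open>With \<open>x + z\<close> in place of \<open>x - z\<close> this is the average of the
  translates \<open>\<phi> (x + z)\<close> weighted by \<open>f\<close>, so it fits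
  \<open>translate\<close> without a sign. It is the usual convolution when \<open>f\<close> is
  even, as all mollifiers here are.\<close>

definition conv :: "('a::euclidean_space \<Rightarrow> real) \<Rightarrow> ('a \<Rightarrow> 'b::euclidean_space) \<Rightarrow> 'a \<Rightarrow> 'b"
  where "conv f \<phi> x = (\<integral>z. f z *\<^sub>R \<phi> (x + z) \<partial>lborel)"

lemma conv_integrable:
  fixes \<phi> :: "'a::euclidean_space \<Rightarrow> 'b::euclidean_space"
  assumes "f \<in> Cc_infty" "\<phi> \<in> Cc_infty"
  shows "integrable lborel (\<lambda>z. f z *\<^sub>R \<phi> (x + z))"
proof -
  have "(\<lambda>z. \<phi> (z + x)) \<in> Cc_infty" by (rule Cc_infty_translate[OF assms(2)])
  then have "(\<lambda>z. f z *\<^sub>R \<phi> (z + x)) \<in> Cc_infty"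
    using assms(1) by (intro Cc_infty_scaleR Cc_infty_smooth) auto
  then show ?thesis by (simp add: Cc_infty_integrable add.commute)
qed

text \<open>The Taylor remainder of \<phi> is uniform in the base point, so it can be integrated
  against the absolute value of \<open>f\<close>; this replaces dominated convergence.\<close>

lemma conv_has_derivative:
  fixes \<phi> :: "'a::euclidean_space \<Rightarrow> 'b::euclidean_space"
  assumes f: "f \<in> Cc_infty" and \<phi>: "\<phi> \<in> Cc_infty"
  shows "(conv f \<phi> has_derivative (\<lambda>v. conv f (\<lambda>x. frechet_derivative \<phi> (at x) v) x)) (at x)"
  unfolding has_derivative_at
proof
  let ?D = "\<lambda>v x. frechet_derivative \<phi> (at x) v"
  have lin: "linear (frechet_derivative \<phi> (at x))" for x
    by (intro linear_frechet_derivative smooth_differentiable Cc_infty_smooth \<phi>)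
  have i: "integrable lborel (\<lambda>z. f z *\<^sub>R ?D v (x + z))" for v x
    by (rule conv_integrable[OF f Cc_infty_derivative[OF \<phi>]])
  have "linear (\<lambda>v. conv f (?D v) x)"
    unfolding conv_def
  proof (rule linearI)
    show "(\<integral>z. f z *\<^sub>R ?D (v + w) (x + z) \<partial>lborel) =
        (\<integral>z. f z *\<^sub>R ?D v (x + z) \<partial>lborel) + (\<integral>z. f z *\<^sub>R ?D w (x + z) \<partial>lborel)" for v w
      by (simp add: linear_add[OF lin] scaleR_add_right i)
    show "(\<integral>z. f z *\<^sub>R ?D (c *\<^sub>R v) (x + z) \<partial>lborel) = c *\<^sub>R (\<integral>z. f z *\<^sub>R ?D v (x + z) \<partial>lborel)" for c v
      by (simp only: linear_cmul[OF lin] scaleR_left_commute[of _ c] integral_scaleR_right)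
  qed
  then show "bounded_linear (\<lambda>v. conv f (?D v) x)" by (simp add: linear_conv_bounded_linear)
  obtain C where C: "0 \<le> C" "\<And>x h. norm (\<phi> (x + h) - \<phi> x - frechet_derivative \<phi> (at x) h) \<le> C * (norm h)\<^sup>2"
    by (rule Cc_infty_taylor[OF \<phi>]) blast
  have fi: "integrable lborel (\<lambda>z. norm (f z))" by (rule integrable_norm[OF Cc_infty_integrable[OF f]])
  define K where "K = (\<integral>z. norm (f z) \<partial>lborel)"
  have est: "norm (conv f \<phi> (x + h) - conv f \<phi> x - conv f (?D h) x) \<le> C * (norm h)\<^sup>2 * K" for h
  proof -
    have e: "x + h + z = (x + z) + h" for z by simp
    have i1: "integrable lborel (\<lambda>z. f z *\<^sub>R \<phi> ((x + z) + h))"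
      using conv_integrable[OF f \<phi>, of "x + h"] by (simp only: e)
    have i2: "integrable lborel (\<lambda>z. f z *\<^sub>R \<phi> (x + z))"
      by (rule conv_integrable[OF f \<phi>])
    have "conv f \<phi> (x + h) - conv f \<phi> x - conv f (?D h) x =
        (\<integral>z. f z *\<^sub>R (\<phi> ((x + z) + h) - \<phi> (x + z) - ?D h (x + z)) \<partial>lborel)"
      unfolding conv_def e scaleR_diff_right by (simp add: i1 i2 i)
    also have "norm \<dots> \<le> (\<integral>z. C * (norm h)\<^sup>2 * norm (f z) \<partial>lborel)"
    proof (rule Bochner_Integration.integral_norm_bound_integral)
      show "integrable lborel (\<lambda>z. f z *\<^sub>R (\<phi> ((x + z) + h) - \<phi> (x + z) - ?D h (x + z)))"
        unfolding scaleR_diff_right by (simp add: i1 i2 i)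
      show "norm (f z *\<^sub>R (\<phi> ((x + z) + h) - \<phi> (x + z) - ?D h (x + z))) \<le> C * (norm h)\<^sup>2 * norm (f z)" for z
        using C(2)[of "x + z" h] by (simp add: mult.commute mult_left_mono)
    qed (use fi in simp)
    also have "\<dots> = C * (norm h)\<^sup>2 * K" by (simp add: K_def)
    finally show ?thesis .
  qed
  show "(\<lambda>h. norm (conv f \<phi> (x + h) - conv f \<phi> x - conv f (?D h) x) / norm h) \<midarrow>0\<rightarrow> 0"
  proof (rule Lim_null_comparison)
    show "((\<lambda>h. C * norm h * K) \<longlongrightarrow> 0) (at (0::'a))"
      by (rule tendsto_eq_intros refl | simp)+
    show "\<forall>\<^sub>F h in at 0. norm (norm (conv f \<phi> (x + h) - conv f \<phi> x - conv f (?D h) x) / norm h) \<le> C * norm h * K"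
      unfolding eventually_at
    proof (intro exI[of _ 1] conjI ballI impI)
      fix h :: 'a assume "h \<noteq> 0 \<and> dist h 0 < 1"
      then show "norm (norm (conv f \<phi> (x + h) - conv f \<phi> x - conv f (?D h) x) / norm h) \<le> C * norm h * K"
        using est[of h] by (simp add: divide_simps power2_eq_square mult_ac)
    qed simp
  qed
qed

lemma frechet_derivative_conv:
  assumes "f \<in> Cc_infty" "\<phi> \<in> Cc_infty"
  shows "frechet_derivative (conv f \<phi>) (at x) = (\<lambda>v. conv f (\<lambda>x. frechet_derivative \<phi> (at x) v) x)"
  by (rule frechet_derivative_at[OF conv_has_derivative[OF assms], symmetric])

lemma conv_Cc_infty:
  fixes \<phi> :: "'a::euclidean_space \<Rightarrow> 'b::euclidean_space"
  assumes f: "f \<in> Cc_infty" and \<phi>: "\<phi> \<in> Cc_infty"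
  shows "conv f \<phi> \<in> Cc_infty"
proof -
  have "C_k k (conv f \<phi>)" for k
    using \<phi>
  proof (induction k arbitrary: \<phi>)
    case (0 \<phi>)
    show ?case
      unfolding C_k.simps using has_derivative_continuous[OF conv_has_derivative[OF f 0]]
      by (simp add: continuous_on_eq_continuous_at)
  next
    case (Suc k \<phi>)
    have "C_k k (\<lambda>x. conv f (\<lambda>x. frechet_derivative \<phi> (at x) v) x)" for v
      by (rule Suc.IH[OF Cc_infty_derivative[OF Suc.prems]])
    then show ?case by (rule C_k_SucI[OF conv_has_derivative[OF f Suc.prems]])
  qed
  then have sm: "smooth (conv f \<phi>)" by (simp add: smooth_def)
  obtain r where r: "\<And>x. r < norm x \<Longrightarrow> f x = 0" using f Cc_inftyE by metis
  obtain s where s: "\<And>x. s < norm x \<Longrightarrow> \<phi> x = 0" using \<phi> Cc_inftyE by metis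
  show ?thesis
  proof (rule Cc_inftyI[OF sm])
    fix x :: 'a assume x: "r + s < norm x"
    have "f z *\<^sub>R \<phi> (x + z) = 0" for z
    proof (cases "r < norm z")
      case False
      have "norm x \<le> norm (x + z) + norm z" using norm_triangle_ineq4[of "x + z" z] by simp
      then have "s < norm (x + z)" using False x by linarith
      then show ?thesis using s by simp
    qed (use r in simp)
    then show "conv f \<phi> x = 0" unfolding conv_def by (simp only: integral_zero)
  qed
qed

lemma conv_inner_right:
  fixes \<phi> :: "'a::euclidean_space \<Rightarrow> 'b::euclidean_space"
  assumes "f \<in> Cc_infty" "\<phi> \<in> Cc_infty"
  shows "conv f \<phi> x \<bullet> b = conv f (\<lambda>x. \<phi> x \<bullet> b) x"
  using integral_inner_left[of b lborel "\<lambda>z. f z *\<^sub>R \<phi> (x + z)"] conv_integrable[OF assms]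
  by (simp add: conv_def)

lemma divergence_conv:
  assumes f: "f \<in> Cc_infty" and \<phi>: "\<phi> \<in> Cc_infty"
  shows "divergence (conv f \<phi>) x = conv f (divergence \<phi>) x"
proof -
  have i: "integrable lborel (\<lambda>z. f z * (frechet_derivative \<phi> (at (x + z)) b \<bullet> b))" for b
    using integrable_inner_left[of b lborel "\<lambda>z. f z *\<^sub>R frechet_derivative \<phi> (at (x + z)) b"]
      conv_integrable[OF f Cc_infty_derivative[OF \<phi>]] by simp
  have "divergence (conv f \<phi>) x = (\<Sum>b\<in>Basis. conv f (\<lambda>x. frechet_derivative \<phi> (at x) b \<bullet> b) x)"
    by (simp add: divergence_def frechet_derivative_conv[OF assms]
        conv_inner_right[OF f Cc_infty_derivative[OF \<phi>]])
  also have "\<dots> = conv f (divergence \<phi>) x"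
    by (simp add: conv_def divergence_def sum_distrib_left i Bochner_Integration.integral_sum)
  finally show ?thesis .
qed

lemma grad_conv:
  assumes f: "f \<in> Cc_infty" and u: "u \<in> Cc_infty"
  shows "grad (conv f u) x = conv f (grad u) x"
proof (rule grad_eqI)
  have "conv f (\<lambda>x. frechet_derivative u (at x) v) x = conv f (grad u) x \<bullet> v" for v
    by (simp add: conv_inner_right[OF f Cc_infty_grad[OF u]] grad_inner[OF Cc_infty_smooth[OF u]])
  then show "(conv f u has_derivative (\<bullet>) (conv f (grad u) x)) (at x)"
    using conv_has_derivative[OF f u, of x] by simp
qed

lemma conv_norm_le:
  fixes \<phi> :: "'a::euclidean_space \<Rightarrow> 'b::euclidean_space"
  assumes "f \<in> Cc_infty" "\<phi> \<in> Cc_infty" "\<And>x. 0 \<le> f x" "(\<integral>x. f x \<partial>lborel) = 1" "\<And>x. norm (\<phi> x) \<le> 1"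
  shows "norm (conv f \<phi> x) \<le> 1"
proof -
  have "norm (conv f \<phi> x) \<le> (\<integral>z. f z \<partial>lborel)"
    unfolding conv_def
    by (rule Bochner_Integration.integral_norm_bound_integral)
       (use assms in \<open>auto intro: conv_integrable Cc_infty_integrable mult_left_le\<close>)
  then show ?thesis using assms(4) by simp
qed

text \<open>Weakly, the convolution is the weighted average of translates. Only scalar products with
  a fixed \<open>v\<close> are integrated, so no integral with values in the incomplete space is
  needed; the exchange of integrals is justified by compact supports.\<close>

lemma inner_conv:
  fixes u v :: "'a::euclidean_space test_fun"
  assumes f: "f \<in> Cc_infty"
  shows "inner (Test_fun (conv f (fun_of u))) v = (\<integral>z. f z * inner (translate z u) v \<partial>lborel)"
proof -
  let ?u = "grad (fun_of u)" and ?v = "grad (fun_of v)"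
  obtain r where r: "\<And>x. r < norm x \<Longrightarrow> f x = 0" using f Cc_inftyE by metis
  obtain s where s: "\<And>x. s < norm x \<Longrightarrow> ?v x = 0"
    by (rule Cc_inftyE[OF Cc_infty_grad[OF fun_of_Cc_infty[of v]]]) blast
  have cu: "continuous_on UNIV ?u" and cv: "continuous_on UNIV ?v" and cf: "continuous_on UNIV f"
    by (intro continuous_grad smooth_fun_of smooth_continuous Cc_infty_smooth f)+
  have "inner (Test_fun (conv f (fun_of u))) v = (\<integral>x. (\<integral>z. f z * (?u (x + z) \<bullet> ?v x) \<partial>lborel) \<partial>lborel)"
    using conv_integrable[OF f Cc_infty_grad[OF fun_of_Cc_infty[of u]]]
    by (simp add: inner_test_fun_def Test_fun_inverse conv_Cc_infty[OF f fun_of_Cc_infty]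
        grad_conv[OF f fun_of_Cc_infty] conv_inner_right[OF f Cc_infty_grad[OF fun_of_Cc_infty]])
       (simp add: conv_def)
  also have "\<dots> = (\<integral>z. (\<integral>x. f z * (?u (x + z) \<bullet> ?v x) \<partial>lborel) \<partial>lborel)"
  proof (rule lborel_integral_swap[where r = "max r s"])
    show "continuous_on UNIV (\<lambda>(x, z). f z * (?u (x + z) \<bullet> ?v x))"
      unfolding split_def
      by (intro continuous_on_mult continuous_on_inner continuous_on_compose2[OF cf]
          continuous_on_compose2[OF cu] continuous_on_compose2[OF cv] continuous_intros) auto
  qed (use r s in auto)
  also have "\<dots> = (\<integral>z. f z * inner (translate z u) v \<partial>lborel)"
    by (simp add: inner_test_fun_def grad_fun_of_translate)
  finally show ?thesis .
qed

text \<open>The substitution \<open>z \<mapsto> - z - x\<close> exchanges the two factors. Applied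
  to a mollifier, it turns an average of translates of \<phi> into an average of translates of the
  mollifier, which is how the smooth kernel appears in \<open>mollify_kernel\<close>.\<close>

lemma conv_commute:
  fixes f \<phi> :: "'a::euclidean_space \<Rightarrow> real"
  assumes f: "f \<in> Cc_infty" and \<phi>: "\<phi> \<in> Cc_infty" and even: "\<And>x. f (- x) = f x"
  shows "conv f \<phi> = conv (\<lambda>z. \<phi> (- z)) f"
proof
  fix x
  have cf: "continuous_on UNIV f" and cp: "continuous_on UNIV \<phi>"
    by (intro smooth_continuous Cc_infty_smooth f \<phi>)+
  have 1: "(\<lambda>z. f z * \<phi> (x + z)) \<in> borel_measurable borel"
    by (intro borel_measurable_continuous_onI continuous_on_mult cf continuous_on_compose2[OF cp] continuous_intros) auto
  have 2: "(\<lambda>z. f (z + - x) * \<phi> (x + (z + - x))) \<in> borel_measurable borel"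
    by (intro borel_measurable_continuous_onI continuous_on_mult continuous_on_compose2[OF cf]
        continuous_on_compose2[OF cp] continuous_intros) auto
  have "conv f \<phi> x = (\<integral>z. f z * \<phi> (x + z) \<partial>lborel)"
    by (simp add: conv_def)
  also have "\<dots> = (\<integral>z. f (z + - x) * \<phi> (x + (z + - x)) \<partial>lborel)"
    by (rule integral_lborel_translate[OF 1, symmetric])
  also have "\<dots> = (\<integral>z. f (- z + - x) * \<phi> (x + (- z + - x)) \<partial>lborel)"
    by (rule integral_lborel_reflect[OF 2, symmetric])
  also have "\<dots> = conv (\<lambda>z. \<phi> (- z)) f x"
    using even[of "x + _"] by (simp add: conv_def mult.commute add.commute)
  finally show "conv f \<phi> x = conv (\<lambda>z. \<phi> (- z)) f x" .
qed

section \<open>Functionals on test functions\<close>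

abbreviation on_test :: "'a::euclidean_space Dm1 \<Rightarrow> 'a test_fun \<Rightarrow> real"
  where "on_test w \<phi> \<equiv> blinfun_apply w (to_completion \<phi>)"

lemma bounded_linear_on_test: "bounded_linear (on_test w)"
proof (rule bounded_linear_intro[where K = "norm w"])
  show "norm (on_test w \<phi>) \<le> norm \<phi> * norm w" for \<phi>
    using norm_blinfun[of w "to_completion \<phi>"] by (simp add: mult.commute)
qed (simp_all add: to_completion_add to_completion_scaleR blinfun.add_right blinfun.scaleR_right)

lemma on_test_bound: "\<bar>on_test w \<phi>\<bar> \<le> norm w * norm \<phi>"
  using norm_blinfun[of w "to_completion \<phi>"] by simp

lemma norm_Dm1_le:
  fixes W :: "'a::euclidean_space Dm1"
  assumes "0 \<le> K" "\<And>\<phi>. \<bar>on_test W \<phi>\<bar> \<le> K * norm \<phi>"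
  shows "norm W \<le> K"
proof (rule norm_blinfun_bound[OF assms(1)])
  fix x
  have "closed {x. norm (blinfun_apply W x) \<le> K * norm x}"
    by (intro closed_Collect_le continuous_intros)
  moreover have "range to_completion \<subseteq> {x. norm (blinfun_apply W x) \<le> K * norm x}"
    using assms(2) by auto
  ultimately have "closure (range to_completion) \<subseteq> {x. norm (blinfun_apply W x) \<le> K * norm x}"
    by (rule closure_minimal[rotated])
  then show "norm (blinfun_apply W x) \<le> K * norm x"
    using dense_range_to_completion by blast
qed

text \<open>The limit is taken along the chosen representative of the class;
  \<open>extend_LIMSEQ\<close> shows that every Cauchy sequence in the class gives the same
  value.\<close>

definition extend :: "('v::real_normed_vector \<Rightarrow> real) \<Rightarrow> 'v normed_completion \<Rightarrow> real"
  where "extend L x = lim (\<lambda>n. L (rep_completion x n))"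

lemma extend_LIMSEQ:
  assumes L: "bounded_linear L" and X: "Cauchy X"
  shows "(\<lambda>n. L (X n)) \<longlonglongrightarrow> extend L (abs_completion X)"
proof -
  let ?Y = "rep_completion (abs_completion X)"
  have "cauchy_equiv X X" using X by (simp add: cauchy_equiv_def)
  then have "cauchy_equiv ?Y X" by (rule Quotient3_rep_abs[OF Quotient3_normed_completion])
  then have Y: "Cauchy ?Y" and 0: "(\<lambda>n. ?Y n - X n) \<longlonglongrightarrow> 0" by (auto simp: cauchy_equiv_def)
  have "(\<lambda>n. L (?Y n)) \<longlonglongrightarrow> extend L (abs_completion X)"
    unfolding extend_def using bounded_linear.Cauchy[OF L Y]
    by (simp add: Cauchy_convergent_iff convergent_LIMSEQ_iff)
  moreover have "(\<lambda>n. L (?Y n - X n)) \<longlonglongrightarrow> 0"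
    using bounded_linear.tendsto[OF L 0] linear_0[OF bounded_linear.linear[OF L]] by simp
  ultimately have "(\<lambda>n. L (?Y n) - L (?Y n - X n)) \<longlonglongrightarrow> extend L (abs_completion X) - 0"
    by (rule tendsto_diff)
  then show ?thesis by (simp add: linear_diff[OF bounded_linear.linear[OF L]])
qed

lemma bounded_linear_extend:
  assumes L: "bounded_linear (L :: 'v::real_normed_vector \<Rightarrow> real)"
  shows "bounded_linear (extend L)"
proof -
  have lin: "linear L" by (rule bounded_linear.linear[OF L])
  obtain K where K: "\<And>v. norm (L v) \<le> norm v * K" using bounded_linear.bounded[OF L] by blast
  show ?thesis
  proof (rule bounded_linear_intro[where K = K])
    fix x y :: "'v normed_completion"
    obtain X where X: "Cauchy X" "x = abs_completion X" by (rule normed_completion_cases)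
    obtain Y where Y: "Cauchy Y" "y = abs_completion Y" by (rule normed_completion_cases)
    have "x + y = abs_completion (\<lambda>n. X n + Y n)"
      using X Y by (simp add: plus_normed_completion.abs_eq cauchy_equiv_def)
    then have "(\<lambda>n. L (X n + Y n)) \<longlonglongrightarrow> extend L (x + y)"
      using extend_LIMSEQ[OF L Cauchy_add[OF X(1) Y(1)]] by simp
    moreover have "(\<lambda>n. L (X n + Y n)) \<longlonglongrightarrow> extend L x + extend L y"
      using tendsto_add[OF extend_LIMSEQ[OF L X(1)] extend_LIMSEQ[OF L Y(1)]] X Y
      by (simp add: linear_add[OF lin])
    ultimately show "extend L (x + y) = extend L x + extend L y" by (rule LIMSEQ_unique)
  next
    fix r and x :: "'v normed_completion"
    obtain X where X: "Cauchy X" "x = abs_completion X" by (rule normed_completion_cases)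
    have "r *\<^sub>R x = abs_completion (\<lambda>n. r *\<^sub>R X n)"
      using X by (simp add: scaleR_normed_completion.abs_eq cauchy_equiv_def)
    then have "(\<lambda>n. L (r *\<^sub>R X n)) \<longlonglongrightarrow> extend L (r *\<^sub>R x)"
      using extend_LIMSEQ[OF L Cauchy_scaleR[OF X(1)]] by simp
    moreover have "(\<lambda>n. L (r *\<^sub>R X n)) \<longlonglongrightarrow> r *\<^sub>R extend L x"
      using tendsto_scaleR[OF tendsto_const extend_LIMSEQ[OF L X(1)], of r] X
      by (simp add: linear_cmul[OF lin])
    ultimately show "extend L (r *\<^sub>R x) = r *\<^sub>R extend L x" by (rule LIMSEQ_unique)
  next
    fix x :: "'v normed_completion"
    obtain X where X: "Cauchy X" "x = abs_completion X" by (rule normed_completion_cases)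
    have n: "(\<lambda>n. norm (X n)) \<longlonglongrightarrow> norm x"
      using tendsto_norm[OF to_completion_LIMSEQ_abs_completion[OF X(1)]] X by simp
    show "norm (extend L x) \<le> norm x * K"
      using K X
      by (intro LIMSEQ_le[OF tendsto_norm[OF extend_LIMSEQ[OF L X(1)], folded X(2)] tendsto_mult[OF n tendsto_const]]) auto
  qed
qed

lemma Dm1_extend:
  assumes "bounded_linear L"
  obtains W :: "'a::euclidean_space Dm1" where "\<And>\<phi>. on_test W \<phi> = L \<phi>"
proof (rule that)
  show "on_test (Blinfun (extend L)) \<phi> = L \<phi>" for \<phi>
    using LIMSEQ_unique[OF extend_LIMSEQ[OF assms Cauchy_const] tendsto_const]
    by (simp add: bounded_linear_Blinfun_apply[OF bounded_linear_extend[OF assms]] to_completion.abs_eq)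
qed

text \<open>\<open>W\<close> is the image of \<open>w\<close> under the adjoint of \<open>T\<close>.
  Mollification and cutoff of functionals are both obtained in this way from operators on test
  functions.\<close>

lemma Dm1_pullback:
  fixes w :: "'a::euclidean_space Dm1"
  assumes T: "linear T" "\<And>\<phi>. norm (T \<phi>) \<le> K * norm \<phi>" and "0 \<le> K"
  obtains W :: "'a Dm1" where "\<And>\<phi>. on_test W \<phi> = on_test w (T \<phi>)" "norm W \<le> K * norm w"
proof -
  have b: "\<bar>on_test w (T \<phi>)\<bar> \<le> (K * norm w) * norm \<phi>" for \<phi>
  proof -
    have "\<bar>on_test w (T \<phi>)\<bar> \<le> norm w * norm (T \<phi>)" by (rule on_test_bound)
    also have "\<dots> \<le> norm w * (K * norm \<phi>)" by (intro mult_left_mono T) auto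
    finally show ?thesis by (simp add: mult_ac)
  qed
  have "linear (\<lambda>\<phi>. on_test w (T \<phi>))"
    using linear_compose[OF T(1) bounded_linear.linear[OF bounded_linear_on_test]] by (simp add: o_def)
  then have "bounded_linear (\<lambda>\<phi>. on_test w (T \<phi>))"
    unfolding bounded_linear_def bounded_linear_axioms_def
    using b by (auto simp: mult.commute intro!: exI[of _ "K * norm w"])
  then obtain W :: "'a Dm1" where W: "\<And>\<phi>. on_test W \<phi> = on_test w (T \<phi>)"
    by (rule Dm1_extend) blast
  show thesis
    by (rule that[OF W norm_Dm1_le]) (use b \<open>0 \<le> K\<close> in \<open>auto simp: W\<close>)
qed

lemma bounded_linear_inner_test: "bounded_linear (inner v)" for v :: "'a::euclidean_space test_fun"
  by (rule bounded_linear_inner_right)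

text \<open>A near-maximizer \<open>\<phi>\<close> of \<open>L\<close> on the unit sphere almost represents \<open>L\<close>: \<open>L\<close> is small on the
  orthogonal complement of \<open>\<phi>\<close>. This replaces the Riesz representation theorem in the incomplete space.\<close>

lemma functional_small_on_orthogonal:
  fixes L :: "'v::real_inner \<Rightarrow> real"
  assumes L: "linear L" and m: "\<And>x. \<bar>L x\<bar> \<le> m * norm x" "0 \<le> m"
    and \<phi>: "norm \<phi> = 1" and \<psi>: "inner \<phi> \<psi> = 0"
  shows "(L \<psi>)\<^sup>2 \<le> (m\<^sup>2 - (L \<phi>)\<^sup>2) * (norm \<psi>)\<^sup>2"
proof -
  define a b s where "a = L \<phi>" "b = L \<psi>" "s = (norm \<psi>)\<^sup>2"
  \<comment> \<open>On the span of \<phi> and \<psi>, the functional is the inner product with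
    \<open>a *\<^sub>R \<phi> + (b / s) *\<^sub>R \<psi>\<close>. The test vector is
    \<open>s\<close> times this one, which avoids a division by \<open>s\<close>.\<close>
  let ?x = "(a * s) *\<^sub>R \<phi> + b *\<^sub>R \<psi>"
  have \<phi>1: "inner \<phi> \<phi> = 1" using \<phi> by (simp add: norm_eq_sqrt_inner)
  have \<psi>s: "inner \<psi> \<psi> = s" by (simp add: a_b_s_def power2_norm_eq_inner)
  have Lx: "L ?x = a\<^sup>2 * s + b\<^sup>2"
    using a_b_s_def by (simp add: linear_add[OF L] linear_cmul[OF L] power2_eq_square)
  have nx: "(norm ?x)\<^sup>2 = s * (a\<^sup>2 * s + b\<^sup>2)"
    unfolding power2_norm_eq_inner inner_add_left inner_add_right
    using \<phi>1 \<psi> \<psi>s by (simp add: inner_commute[of \<psi> \<phi>] power2_eq_square algebra_simps)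
  have "\<bar>L ?x\<bar>\<^sup>2 \<le> (m * norm ?x)\<^sup>2" by (intro power_mono m) auto
  then have le: "(a\<^sup>2 * s + b\<^sup>2) * (a\<^sup>2 * s + b\<^sup>2) \<le> (m\<^sup>2 * s) * (a\<^sup>2 * s + b\<^sup>2)"
    unfolding power_mult_distrib nx using Lx by (simp add: power2_eq_square mult_ac)
  have s: "0 \<le> s" unfolding a_b_s_def by simp
  have "a\<^sup>2 * s + b\<^sup>2 \<le> m\<^sup>2 * s"
  proof (cases "a\<^sup>2 * s + b\<^sup>2 = 0")
    case False
    then have "0 < a\<^sup>2 * s + b\<^sup>2" using s by (metis add_nonneg_nonneg less_eq_real_def mult_nonneg_nonneg zero_le_power2)
    then show ?thesis using le by (simp only: mult_le_cancel_right_pos)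
  qed (use s in simp)
  then show ?thesis unfolding a_b_s_def by (simp add: left_diff_distrib)
qed

lemma functional_approx_inner:
  fixes L :: "'v::real_inner \<Rightarrow> real"
  assumes L: "bounded_linear L" and e: "0 < e"
  obtains v where "\<And>\<phi>. \<bar>L \<phi> - inner v \<phi>\<bar> \<le> e * norm \<phi>"
proof -
  have lin: "linear L" by (rule bounded_linear.linear[OF L])
  define m where "m = onorm L"
  have m: "\<And>x. \<bar>L x\<bar> \<le> m * norm x" "0 \<le> m"
    using onorm[OF L] onorm_pos_le[OF L] by (auto simp: m_def)
  show thesis
  proof (cases "m = 0")
    case True
    then have "\<bar>L \<phi> - inner 0 \<phi>\<bar> \<le> e * norm \<phi>" for \<phi>
      using m(1)[of \<phi>] e by simp
    then show thesis by (rule that)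
  next
    case False
    \<comment> \<open>The first bound keeps \<open>m - d\<close> positive for squaring; the second
      makes \<open>m\<^sup>2 - (m - d)\<^sup>2 \<le> 2 * m * d \<le> e\<^sup>2\<close>.\<close>
    define d where "d = min (m / 2) (e\<^sup>2 / (2 * m))"
    have "0 < m" using False m(2) by simp
    then have d: "0 < d" "d < m"
      using e by (auto simp: d_def min_def)
    have "2 * m * d \<le> 2 * m * (e\<^sup>2 / (2 * m))"
      using \<open>0 < m\<close> by (intro mult_left_mono) (auto simp: d_def)
    also have "\<dots> = e\<^sup>2" using \<open>0 < m\<close> by simp
    finally have d3: "2 * m * d \<le> e\<^sup>2" .
    have "\<exists>x. (m - d) * norm x < \<bar>L x\<bar>"
    proof (rule ccontr)
      assume "\<nexists>x. (m - d) * norm x < \<bar>L x\<bar>"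
      then have "onorm L \<le> m - d"
        using d by (intro onorm_bound) (auto simp: not_less)
      then show False using d by (simp add: m_def)
    qed
    then obtain x where x: "(m - d) * norm x < \<bar>L x\<bar>" by blast
    then have x0: "0 < norm x" using linear_0[OF lin] by auto
    define \<phi> where "\<phi> = x /\<^sub>R norm x"
    have \<phi>: "norm \<phi> = 1" using x0 by (simp add: \<phi>_def)
    have "m - d < \<bar>L \<phi>\<bar>"
      using x x0 by (simp add: \<phi>_def linear_cmul[OF lin] abs_mult field_simps)
    then have "(m - d)\<^sup>2 \<le> \<bar>L \<phi>\<bar>\<^sup>2" using d by (intro power_mono) auto
    then have "m\<^sup>2 - (L \<phi>)\<^sup>2 \<le> m\<^sup>2 - (m - d)\<^sup>2" by simp
    also have "\<dots> \<le> 2 * m * d" by (simp add: power2_eq_square algebra_simps)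
    finally have small: "m\<^sup>2 - (L \<phi>)\<^sup>2 \<le> e\<^sup>2" using d3 by simp
    show thesis
    proof (rule that[of "L \<phi> *\<^sub>R \<phi>"])
      fix \<psi>
      \<comment> \<open>The two functionals agree on multiples of \<phi>, so their difference at
        \<psi> is \<open>L\<close> at the component orthogonal to \<phi>.\<close>
      define \<eta> where "\<eta> = \<psi> - inner \<phi> \<psi> *\<^sub>R \<phi>"
      have orth: "inner \<phi> \<eta> = 0"
        using \<phi> by (simp add: \<eta>_def inner_diff_right norm_eq_sqrt_inner)
      have \<psi>: "\<eta> + inner \<phi> \<psi> *\<^sub>R \<phi> = \<psi>" by (simp add: \<eta>_def)
      have "orthogonal \<eta> (inner \<phi> \<psi> *\<^sub>R \<phi>)"
        unfolding orthogonal_def by (simp only: inner_scaleR_right inner_commute[of \<eta> \<phi>] orth mult_zero_right)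
      from norm_add_Pythagorean[OF this, unfolded \<psi>]
      have "(norm \<psi>)\<^sup>2 = (norm \<eta>)\<^sup>2 + (norm (inner \<phi> \<psi> *\<^sub>R \<phi>))\<^sup>2" .
      then have "(norm \<eta>)\<^sup>2 \<le> (norm \<psi>)\<^sup>2"
        by (metis le_add_same_cancel1 zero_le_power2)
      then have n: "norm \<eta> \<le> norm \<psi>"
        by (rule power2_le_imp_le) (rule norm_ge_zero)
      have eq: "L \<psi> - inner (L \<phi> *\<^sub>R \<phi>) \<psi> = L \<eta>"
        by (simp add: \<eta>_def linear_diff[OF lin] linear_cmul[OF lin] mult.commute)
      have "\<bar>L \<eta>\<bar>\<^sup>2 \<le> (e * norm \<eta>)\<^sup>2"
      proof -
        have "(L \<eta>)\<^sup>2 \<le> (m\<^sup>2 - (L \<phi>)\<^sup>2) * (norm \<eta>)\<^sup>2"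
          by (rule functional_small_on_orthogonal[OF lin m \<phi> orth])
        also have "\<dots> \<le> e\<^sup>2 * (norm \<eta>)\<^sup>2" by (intro mult_right_mono small) simp
        finally show ?thesis by (simp add: power_mult_distrib)
      qed
      then have "\<bar>L \<eta>\<bar> \<le> e * norm \<eta>" by (rule power2_le_imp_le) (use e in simp)
      also have "\<dots> \<le> e * norm \<psi>" using e n by simp
      finally show "\<bar>L \<psi> - inner (L \<phi> *\<^sub>R \<phi>) \<psi>\<bar> \<le> e * norm \<psi>"
        using eq by simp
    qed
  qed
qed

text \<open>This density is the gate through which the later facts about arbitrary functionals pass:
  decay of the mollified function, the kernel formula, and convergence under mollification and
  cutoff.\<close>

lemma Dm1_approx_inner:
  fixes w :: "'a::euclidean_space Dm1"
  assumes "0 < e"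
  obtains v W where "\<And>\<phi>. on_test W \<phi> = inner v \<phi>" "norm (w - W) \<le> e"
proof -
  obtain v where v: "\<And>\<phi>. \<bar>on_test w \<phi> - inner v \<phi>\<bar> \<le> e * norm \<phi>"
    using functional_approx_inner[OF bounded_linear_on_test assms] by metis
  obtain W :: "'a Dm1" where W: "\<And>\<phi>. on_test W \<phi> = inner v \<phi>"
    using Dm1_extend[OF bounded_linear_inner_test] by metis
  have "norm (w - W) \<le> e"
    by (rule norm_Dm1_le) (use v assms in \<open>auto simp: blinfun.diff_left W\<close>)
  with W show thesis by (rule that)
qed

lemma represents_inner:
  fixes v :: "'a::euclidean_space test_fun"
  assumes W: "\<And>\<phi>. on_test W \<phi> = inner v \<phi>"
  obtains u where "u \<in> Cc_infty_av" "represents u W"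
proof -
  let ?u = "\<lambda>x. - 1 * divergence (grad (fun_of v)) x"
  have G: "grad (fun_of v) \<in> Cc_infty" by (rule Cc_infty_grad[OF fun_of_Cc_infty])
  have D: "divergence (grad (fun_of v)) \<in> Cc_infty" by (rule Cc_infty_divergence[OF G])
  have "?u \<in> Cc_infty"
    using D by (intro Cc_infty_mult smooth_const Cc_infty_smooth disjI2)
  then have "?u \<in> Cc_infty_av"
    using integral_divergence_eq_0[OF G] by (simp add: Cc_infty_av_def)
  moreover have "on_test W \<phi> = (\<integral>x. ?u x * fun_of \<phi> x \<partial>lborel)" for \<phi>
    using integral_by_parts[OF smooth_fun_of Cc_infty_smooth[OF G] disjI2[OF G], of \<phi>]
    by (simp add: W inner_test_fun_def inner_commute mult.commute)
  ultimately show thesis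
    using that unfolding represents_def by blast
qed

section \<open>A Poincare inequality and cutoff operators\<close>

text \<open>The variance of \<open>h\<close> under the probability density \<open>w\<close> is
  nonnegative.\<close>

lemma jensen_square:
  fixes w h :: "'a \<Rightarrow> real"
  assumes w: "integrable M w" "(\<integral>x. w x \<partial>M) = 1" "\<And>x. 0 \<le> w x"
    and h: "integrable M (\<lambda>x. w x * h x)" "integrable M (\<lambda>x. w x * (h x)\<^sup>2)"
  shows "(\<integral>x. w x * h x \<partial>M)\<^sup>2 \<le> (\<integral>x. w x * (h x)\<^sup>2 \<partial>M)"
proof -
  define m where "m = (\<integral>x. w x * h x \<partial>M)"
  have "0 \<le> (\<integral>x. w x * (h x - m)\<^sup>2 \<partial>M)" using w(3) by simp
  also have "(\<lambda>x. w x * (h x - m)\<^sup>2) = (\<lambda>x. w x * (h x)\<^sup>2 - (2 * m) * (w x * h x) + m\<^sup>2 * w x)"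
    by (simp add: fun_eq_iff power2_eq_square algebra_simps)
  also have "(\<integral>x. w x * (h x)\<^sup>2 - (2 * m) * (w x * h x) + m\<^sup>2 * w x \<partial>M) =
      (\<integral>x. w x * (h x)\<^sup>2 \<partial>M) - (2 * m) * m + m\<^sup>2 * 1"
    using w h by (simp add: m_def)
  finally show ?thesis by (simp add: m_def power2_eq_square)
qed

text \<open>The fundamental theorem of calculus on the segment from \<open>x\<close> to
  \<open>x + z\<close>, followed by \<open>jensen_square\<close> with the uniform density on [0, 1].
  The nonnegative integral is used so that the later exchange with the integral over
  \<open>x\<close> requires measurability only.\<close>

lemma difference_le_line_integral:
  fixes u :: "'a::euclidean_space \<Rightarrow> real"
  assumes u: "smooth u"
  shows "ennreal ((u (x + z) - u x)\<^sup>2) \<le>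
    (\<integral>\<^sup>+t. indicator {0..1::real} t * ennreal ((norm z)\<^sup>2 * (norm (grad u (x + t *\<^sub>R z)))\<^sup>2) \<partial>lborel)"
proof -
  let ?g = "\<lambda>t. grad u (x + t *\<^sub>R z)"
  have cg: "continuous_on UNIV ?g"
    by (rule continuous_on_compose2[OF continuous_grad[OF u, of UNIV]]) (auto intro!: continuous_intros)
  have int: "integrable lborel (\<lambda>t. indicator {0..1::real} t * h t)" if "continuous_on UNIV h" for h :: "real \<Rightarrow> real"
    using borel_integrable_compact[of "{0..1::real}" h] that continuous_on_subset by auto
  have D: "((\<lambda>t. u (x + t *\<^sub>R z)) has_vector_derivative (?g t \<bullet> z)) (at t within S)" for t S
  proof -
    have "((\<lambda>t. x + t *\<^sub>R z) has_derivative (\<lambda>h. h *\<^sub>R z)) (at t)"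
      by (auto intro!: derivative_eq_intros)
    from diff_chain_at[OF this smooth_has_derivative_grad[OF u]]
    have "((\<lambda>t. u (x + t *\<^sub>R z)) has_derivative (\<lambda>h. ?g t \<bullet> (h *\<^sub>R z))) (at t)"
      by (simp only: o_def)
    then show ?thesis
      by (simp add: has_vector_derivative_def has_derivative_at_withinI)
  qed
  have "(\<integral>t. indicator {0..1} t *\<^sub>R (?g t \<bullet> z) \<partial>lborel) = u (x + 1 *\<^sub>R z) - u (x + 0 *\<^sub>R z)"
    by (rule integral_FTC_Icc[OF _ D]) (auto intro!: continuous_intros continuous_on_subset[OF cg])
  then have "(u (x + z) - u x)\<^sup>2 = (\<integral>t. indicator {0..1} t * (?g t \<bullet> z) \<partial>lborel)\<^sup>2" by simp
  also have "\<dots> \<le> (\<integral>t. indicator {0..1} t * (?g t \<bullet> z)\<^sup>2 \<partial>lborel)"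
    by (rule jensen_square) (auto intro!: int continuous_intros cg)
  also have "\<dots> \<le> (\<integral>t. indicator {0..1} t * ((norm z)\<^sup>2 * (norm (?g t))\<^sup>2) \<partial>lborel)"
  proof (intro integral_mono int continuous_intros cg mult_left_mono)
    show "(?g t \<bullet> z)\<^sup>2 \<le> (norm z)\<^sup>2 * (norm (?g t))\<^sup>2" for t
      using power_mono[OF Cauchy_Schwarz_ineq2[of "?g t" z], of 2] by (simp add: power_mult_distrib mult.commute)
  qed auto
  finally have "ennreal ((u (x + z) - u x)\<^sup>2) \<le>
      ennreal (\<integral>t. indicator {0..1} t * ((norm z)\<^sup>2 * (norm (?g t))\<^sup>2) \<partial>lborel)"
    by (rule ennreal_leI)
  also have "\<dots> = (\<integral>\<^sup>+t. ennreal (indicator {0..1} t * ((norm z)\<^sup>2 * (norm (?g t))\<^sup>2)) \<partial>lborel)"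
    by (rule nn_integral_eq_integral[symmetric]) (auto intro!: int continuous_intros cg)
  also have "\<dots> = (\<integral>\<^sup>+t. indicator {0..1} t * ennreal ((norm z)\<^sup>2 * (norm (?g t))\<^sup>2) \<partial>lborel)"
    by (rule nn_integral_cong) (auto simp: indicator_def)
  finally show ?thesis .
qed

lemma nn_integral_swap:
  fixes F :: "'a::euclidean_space \<Rightarrow> 'b::euclidean_space \<Rightarrow> ennreal"
  assumes "(\<lambda>(x, y). F x y) \<in> borel_measurable borel"
  shows "(\<integral>\<^sup>+x. \<integral>\<^sup>+y. F x y \<partial>lborel \<partial>lborel) = (\<integral>\<^sup>+y. \<integral>\<^sup>+x. F x y \<partial>lborel \<partial>lborel)"
proof -
  have "(\<lambda>(x, y). F x y) \<in> borel_measurable (lborel \<Otimes>\<^sub>M lborel)"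
    using assms by (simp add: lborel_prod)
  from lborel_pair.Fubini[OF this] show ?thesis by simp
qed

lemma norm_test_fun_sq_nn:
  fixes u :: "'a::euclidean_space test_fun"
  shows "ennreal ((norm u)\<^sup>2) = (\<integral>\<^sup>+x. ennreal ((norm (grad (fun_of u) x))\<^sup>2) \<partial>lborel)"
  unfolding norm_test_fun_sq by (rule nn_integral_eq_integral[symmetric, OF integrable_norm_grad_sq]) simp

text \<open>After exchanging the integrals, translation invariance makes every point of the segment
  contribute the same multiple of the squared Dirichlet norm.\<close>

lemma translate_difference_bound:
  fixes u :: "'a::euclidean_space test_fun"
  shows "(\<integral>\<^sup>+x. ennreal ((fun_of u (x + z) - fun_of u x)\<^sup>2) \<partial>lborel) \<le> ennreal ((norm z)\<^sup>2 * (norm u)\<^sup>2)"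
proof -
  let ?g = "grad (fun_of u)"
  have cg: "continuous_on UNIV ?g" by (rule continuous_grad[OF smooth_fun_of])
  have "(\<integral>\<^sup>+x. ennreal ((fun_of u (x + z) - fun_of u x)\<^sup>2) \<partial>lborel) \<le>
      (\<integral>\<^sup>+x. \<integral>\<^sup>+t. indicator {0..1::real} t * ennreal ((norm z)\<^sup>2 * (norm (?g (x + t *\<^sub>R z)))\<^sup>2) \<partial>lborel \<partial>lborel)"
    by (intro nn_integral_mono difference_le_line_integral smooth_fun_of)
  also have "\<dots> = (\<integral>\<^sup>+t. \<integral>\<^sup>+x. indicator {0..1::real} t * ennreal ((norm z)\<^sup>2 * (norm (?g (x + t *\<^sub>R z)))\<^sup>2) \<partial>lborel \<partial>lborel)"
  proof (rule nn_integral_swap)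
    have "(\<lambda>p::'a \<times> real. ennreal ((norm z)\<^sup>2 * (norm (?g (fst p + snd p *\<^sub>R z)))\<^sup>2)) \<in> borel_measurable borel"
      by (intro measurable_compose[OF _ measurable_ennreal] borel_measurable_continuous_onI continuous_intros
          continuous_on_compose2[OF cg]) auto
    moreover have "(\<lambda>p::'a \<times> real. indicator {0..1::real} (snd p) :: ennreal) \<in> borel_measurable borel"
      by (intro measurable_compose[OF borel_measurable_continuous_onI borel_measurable_indicator] continuous_intros) auto
    ultimately show "(\<lambda>(x, t). indicator {0..1::real} t * ennreal ((norm z)\<^sup>2 * (norm (?g (x + t *\<^sub>R z)))\<^sup>2)) \<in> borel_measurable borel"
      unfolding split_def by (rule borel_measurable_times_ennreal[rotated])
  qed
  also have "\<dots> = (\<integral>\<^sup>+t. indicator {0..1::real} t * ennreal ((norm z)\<^sup>2 * (norm u)\<^sup>2) \<partial>lborel)"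
  proof (rule nn_integral_cong)
    fix t :: real
    have m: "(\<lambda>x. ennreal ((norm (?g x))\<^sup>2)) \<in> borel_measurable borel"
      by (intro measurable_compose[OF _ measurable_ennreal] borel_measurable_continuous_onI continuous_intros cg)
    have m': "(\<lambda>x. ennreal ((norm (?g (x + t *\<^sub>R z)))\<^sup>2)) \<in> borel_measurable borel"
      by (intro measurable_compose[OF _ measurable_ennreal] borel_measurable_continuous_onI continuous_intros
          continuous_on_compose2[OF cg]) auto
    have "(\<integral>\<^sup>+x. indicator {0..1} t * ennreal ((norm z)\<^sup>2 * (norm (?g (x + t *\<^sub>R z)))\<^sup>2) \<partial>lborel) =
        (\<integral>\<^sup>+x. (indicator {0..1} t * ennreal ((norm z)\<^sup>2)) * ennreal ((norm (?g (x + t *\<^sub>R z)))\<^sup>2) \<partial>lborel)"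
      by (simp add: ennreal_mult mult.assoc)
    also have "\<dots> = (indicator {0..1} t * ennreal ((norm z)\<^sup>2)) * (\<integral>\<^sup>+x. ennreal ((norm (?g (x + t *\<^sub>R z)))\<^sup>2) \<partial>lborel)"
      using m' by (intro nn_integral_cmult) simp
    also have "(\<integral>\<^sup>+x. ennreal ((norm (?g (x + t *\<^sub>R z)))\<^sup>2) \<partial>lborel) = ennreal ((norm u)\<^sup>2)"
      unfolding norm_test_fun_sq_nn by (rule nn_integral_lborel_translate[OF m])
    finally show "(\<integral>\<^sup>+x. indicator {0..1} t * ennreal ((norm z)\<^sup>2 * (norm (?g (x + t *\<^sub>R z)))\<^sup>2) \<partial>lborel) =
        indicator {0..1} t * ennreal ((norm z)\<^sup>2 * (norm u)\<^sup>2)"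
      by (simp add: ennreal_mult mult.assoc)
  qed
  also have "\<dots> = (\<integral>\<^sup>+t. ennreal ((norm z)\<^sup>2 * (norm u)\<^sup>2) * indicator {0..1::real} t \<partial>lborel)"
    by (simp add: mult.commute)
  also have "\<dots> = ennreal ((norm z)\<^sup>2 * (norm u)\<^sup>2)"
    by (subst nn_integral_cmult_indicator) auto
  finally show ?thesis .
qed

lemma integral_bump_ge:
  assumes "0 < r"
  shows "measure lborel (cball (0::'a::euclidean_space) r) \<le> (\<integral>x. bump r (x::'a) \<partial>lborel)"
proof -
  have "(\<integral>x. indicator (cball (0::'a) r) x \<partial>lborel) \<le> (\<integral>x. bump r (x::'a) \<partial>lborel)"
  proof (rule integral_mono)
    show "integrable lborel (indicator (cball (0::'a) r) :: _ \<Rightarrow> real)"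
      by (intro integrable_real_indicator) (simp_all add: emeasure_lborel_cball_finite[unfolded infinity_ennreal_def])
    show "integrable lborel (bump r :: 'a \<Rightarrow> real)"
      by (rule Cc_infty_integrable[OF bump_Cc_infty[OF assms]])
    show "indicator (cball 0 r) x \<le> bump r x" for x :: 'a
      using bump_eq_1[OF assms, of x] bump_nonneg[of r x] by (auto simp: indicator_def)
  qed
  then show ?thesis by simp
qed

lemma measure_cball_pos: "0 < r \<Longrightarrow> 0 < measure lborel (cball (0::'a::euclidean_space) r)"
  by (simp add: content_cball)

lemma integral_bump_pos: "0 < r \<Longrightarrow> 0 < (\<integral>x. bump r (x::'a::euclidean_space) \<partial>lborel)"
  using integral_bump_ge measure_cball_pos by (metis less_le_trans)

definition unit_bump :: "real \<Rightarrow> 'a::euclidean_space \<Rightarrow> real"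
  where "unit_bump r x = bump r x / (\<integral>x. bump r (x::'a) \<partial>lborel)"

lemma unit_bump_Cc_infty: "0 < r \<Longrightarrow> unit_bump r \<in> Cc_infty"
  unfolding unit_bump_def[abs_def] divide_inverse
  by (intro Cc_infty_mult smooth_bump smooth_const disjI1 bump_Cc_infty)

lemma unit_bump_nonneg: "0 < r \<Longrightarrow> 0 \<le> unit_bump r x"
  unfolding unit_bump_def using integral_bump_pos bump_nonneg by (intro divide_nonneg_pos) auto

lemma integral_unit_bump:
  assumes "0 < r"
  shows "(\<integral>x. unit_bump r (x::'a::euclidean_space) \<partial>lborel) = 1"
  using integral_bump_pos[OF assms, where 'a = 'a] by (simp add: unit_bump_def)

lemma unit_bump_le:
  assumes "0 < r"
  shows "unit_bump r (x::'a::euclidean_space) \<le> 1 / measure lborel (cball (0::'a) r)"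
  unfolding unit_bump_def
  using integral_bump_ge[OF assms, where 'a = 'a] measure_cball_pos[OF assms, where 'a = 'a] bump_le_1[of r x]
  by (intro frac_le) auto

lemma unit_bump_minus: "unit_bump r (- x) = unit_bump r x"
  by (simp add: unit_bump_def bump_minus)

lemma unit_bump_eq_0: "0 < r \<Longrightarrow> 2 * r \<le> norm x \<Longrightarrow> unit_bump r x = 0"
  by (simp add: unit_bump_def bump_eq_0)

text \<open>Writing \<open>y = x + z\<close> in the mean over \<open>y\<close> reduces the inequality to the bound on
  \<open>fun_of u (x + z) - fun_of u x\<close> in the square mean.\<close>

lemma poincare:
  fixes u :: "'a::euclidean_space test_fun"
  assumes R: "0 < R"
  defines "c \<equiv> (\<integral>x. unit_bump R x * fun_of u x \<partial>lborel)"
  shows "(\<integral>\<^sup>+x. ennreal (indicator (cball 0 (2 * R)) x * (fun_of u x - c)\<^sup>2) \<partial>lborel) \<le>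
    ennreal (16 * 4 ^ DIM('a) * R\<^sup>2 * (norm u)\<^sup>2)"
proof -
  let ?u = "fun_of u" and ?V = "measure lborel (cball (0::'a) R)"
  let ?Q = "\<lambda>x z. ennreal (1 / ?V * (?u (x + z) - ?u x)\<^sup>2)"
  have V: "0 < ?V" by (rule measure_cball_pos[OF R])
  have cu: "continuous_on UNIV ?u" by (rule smooth_continuous[OF smooth_fun_of])
  \<comment> \<open>If \<open>x\<close> and \<open>x + z\<close> both lie in the ball of radius
    \<open>2 * R\<close>, then \<open>norm z \<le> 4 * R\<close>. This radius produces both
    constants: 16 from the square of \<open>norm z\<close>, and the power of 4 as the volume ratio
    of the balls of radius \<open>4 * R\<close> and \<open>R\<close>.\<close>
  have "ennreal (indicator (cball 0 (2 * R)) x * (?u x - c)\<^sup>2) \<le>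
      (\<integral>\<^sup>+z. indicator (cball 0 (4 * R)) z * ?Q x z \<partial>lborel)" for x
  proof (cases "x \<in> cball 0 (2 * R)")
    case True
    have i: "integrable lborel (\<lambda>y. unit_bump R y * h y)" if "smooth h" for h :: "'a \<Rightarrow> real"
      by (intro Cc_infty_integrable Cc_infty_mult Cc_infty_smooth[OF unit_bump_Cc_infty[OF R]] that
          disjI1[OF unit_bump_Cc_infty[OF R]])
    have sm: "smooth (\<lambda>y. ?u y - ?u x)" by (intro smooth_diff smooth_fun_of smooth_const)
    have sm2: "smooth (\<lambda>y. (?u y - ?u x)\<^sup>2)" unfolding power2_eq_square by (intro smooth_mult sm)
    have "c - ?u x = (\<integral>y. unit_bump R y * (?u y - ?u x) \<partial>lborel)"
      using integral_unit_bump[OF R, where 'a = 'a]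
      by (simp add: right_diff_distrib c_def Bochner_Integration.integral_diff[OF i[OF smooth_fun_of] i[OF smooth_const]])
    then have "(?u x - c)\<^sup>2 = (\<integral>y. unit_bump R y * (?u y - ?u x) \<partial>lborel)\<^sup>2"
      by (simp add: power2_commute)
    also have "\<dots> \<le> (\<integral>y. unit_bump R y * (?u y - ?u x)\<^sup>2 \<partial>lborel)"
      by (intro jensen_square i sm sm2 unit_bump_nonneg integral_unit_bump R Cc_infty_integrable unit_bump_Cc_infty)
    finally have "ennreal ((?u x - c)\<^sup>2) \<le> ennreal (\<integral>y. unit_bump R y * (?u y - ?u x)\<^sup>2 \<partial>lborel)"
      by (rule ennreal_leI)
    also have "\<dots> = (\<integral>\<^sup>+y. ennreal (unit_bump R y * (?u y - ?u x)\<^sup>2) \<partial>lborel)"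
      by (intro nn_integral_eq_integral[symmetric] i sm2 AE_I2 mult_nonneg_nonneg unit_bump_nonneg R) simp
    also have "\<dots> = (\<integral>\<^sup>+z. ennreal (unit_bump R (z + x) * (?u (z + x) - ?u x)\<^sup>2) \<partial>lborel)"
      by (rule nn_integral_lborel_translate[symmetric])
         (intro measurable_compose[OF _ measurable_ennreal] borel_measurable_smooth smooth_mult sm2
           Cc_infty_smooth unit_bump_Cc_infty R)
    also have "\<dots> \<le> (\<integral>\<^sup>+z. indicator (cball 0 (4 * R)) z * ?Q x z \<partial>lborel)"
    proof (rule nn_integral_mono)
      fix z :: 'a
      show "ennreal (unit_bump R (z + x) * (?u (z + x) - ?u x)\<^sup>2) \<le> indicator (cball 0 (4 * R)) z * ?Q x z"
      proof (cases "z \<in> cball 0 (4 * R)")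
        case z: True
        have "unit_bump R (z + x) * (?u (z + x) - ?u x)\<^sup>2 \<le> 1 / ?V * (?u (z + x) - ?u x)\<^sup>2"
          by (intro mult_right_mono unit_bump_le R) auto
        then show ?thesis using z by (simp add: ennreal_leI add.commute)
      next
        case z: False
        have "norm z \<le> norm (z + x) + norm x" using norm_triangle_ineq4[of "z + x" x] by simp
        then have "2 * R \<le> norm (z + x)" using z True by simp
        from unit_bump_eq_0[OF R this] show ?thesis by simp
      qed
    qed
    finally show ?thesis using True by simp
  qed simp
  then have "(\<integral>\<^sup>+x. ennreal (indicator (cball 0 (2 * R)) x * (?u x - c)\<^sup>2) \<partial>lborel) \<le>
      (\<integral>\<^sup>+x. \<integral>\<^sup>+z. indicator (cball 0 (4 * R)) z * ?Q x z \<partial>lborel \<partial>lborel)"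
    by (rule nn_integral_mono)
  also have "\<dots> = (\<integral>\<^sup>+z. \<integral>\<^sup>+x. indicator (cball 0 (4 * R)) z * ?Q x z \<partial>lborel \<partial>lborel)"
  proof (rule nn_integral_swap)
    have "(\<lambda>p::'a \<times> 'a. ?Q (fst p) (snd p)) \<in> borel_measurable borel"
      by (intro measurable_compose[OF _ measurable_ennreal] borel_measurable_continuous_onI continuous_intros
          continuous_on_compose2[OF cu]) auto
    moreover have "(\<lambda>p::'a \<times> 'a. indicator (cball 0 (4 * R)) (snd p) :: ennreal) \<in> borel_measurable borel"
      by (intro measurable_compose[OF borel_measurable_continuous_onI borel_measurable_indicator] continuous_intros) auto
    ultimately show "(\<lambda>(x, z). indicator (cball 0 (4 * R)) z * ?Q x z) \<in> borel_measurable borel"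
      unfolding split_def by (rule borel_measurable_times_ennreal[rotated])
  qed
  also have "\<dots> \<le> (\<integral>\<^sup>+z. ennreal (16 * R\<^sup>2 / ?V * (norm u)\<^sup>2) * indicator (cball (0::'a) (4 * R)) z \<partial>lborel)"
  proof (rule nn_integral_mono)
    fix z :: 'a
    show "(\<integral>\<^sup>+x. indicator (cball 0 (4 * R)) z * ?Q x z \<partial>lborel) \<le>
        ennreal (16 * R\<^sup>2 / ?V * (norm u)\<^sup>2) * indicator (cball (0::'a) (4 * R)) z"
    proof (cases "z \<in> cball 0 (4 * R)")
      case True
      have m: "(\<lambda>x. ennreal ((?u (x + z) - ?u x)\<^sup>2)) \<in> borel_measurable lborel"
        unfolding measurable_lborel2
        by (intro measurable_compose[OF _ measurable_ennreal] borel_measurable_continuous_onI continuous_intros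
          continuous_on_compose2[OF cu] cu) auto
      have "(\<integral>\<^sup>+x. ?Q x z \<partial>lborel) = (\<integral>\<^sup>+x. ennreal (1 / ?V) * ennreal ((?u (x + z) - ?u x)\<^sup>2) \<partial>lborel)"
        using V by (intro nn_integral_cong ennreal_mult) auto
      also have "\<dots> = ennreal (1 / ?V) * (\<integral>\<^sup>+x. ennreal ((?u (x + z) - ?u x)\<^sup>2) \<partial>lborel)"
        by (rule nn_integral_cmult[OF m])
      also have "\<dots> \<le> ennreal (1 / ?V) * ennreal ((norm z)\<^sup>2 * (norm u)\<^sup>2)"
        by (intro mult_left_mono translate_difference_bound) simp
      also have "\<dots> = ennreal (1 / ?V * ((norm z)\<^sup>2 * (norm u)\<^sup>2))"
        using V by (intro ennreal_mult[symmetric]) auto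
      also have "\<dots> \<le> ennreal (16 * R\<^sup>2 / ?V * (norm u)\<^sup>2)"
      proof (rule ennreal_leI)
        have "(norm z)\<^sup>2 \<le> (4 * R)\<^sup>2" using True by (intro power_mono) auto
        then have "1 / ?V * ((norm z)\<^sup>2 * (norm u)\<^sup>2) \<le> 1 / ?V * ((4 * R)\<^sup>2 * (norm u)\<^sup>2)"
          using V by (intro mult_left_mono mult_right_mono) auto
        then show "1 / ?V * ((norm z)\<^sup>2 * (norm u)\<^sup>2) \<le> 16 * R\<^sup>2 / ?V * (norm u)\<^sup>2"
          by (simp add: power_mult_distrib)
      qed
      finally show ?thesis using True by simp
    qed simp
  qed
  also have "\<dots> = ennreal (16 * R\<^sup>2 / ?V * (norm u)\<^sup>2) * emeasure lborel (cball (0::'a) (4 * R))"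
    by (rule nn_integral_cmult_indicator) simp
  also have "emeasure lborel (cball (0::'a) (4 * R)) = ennreal (4 ^ DIM('a) * ?V)"
    using R by (simp add: emeasure_cball content_cball power_mult_distrib mult_ac)
  also have "ennreal (16 * R\<^sup>2 / ?V * (norm u)\<^sup>2) * ennreal (4 ^ DIM('a) * ?V) =
      ennreal (16 * R\<^sup>2 / ?V * (norm u)\<^sup>2 * (4 ^ DIM('a) * ?V))"
    using V by (intro ennreal_mult[symmetric]) auto
  also have "16 * R\<^sup>2 / ?V * (norm u)\<^sup>2 * (4 ^ DIM('a) * ?V) = 16 * 4 ^ DIM('a) * R\<^sup>2 * (norm u)\<^sup>2"
    using V by simp
  finally show ?thesis .
qed

section \<open>The cutoff operators and their uniform bound\<close>

definition bump_mean :: "real \<Rightarrow> 'a::euclidean_space test_fun \<Rightarrow> real"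
  where "bump_mean R u = (\<integral>x. unit_bump R x * fun_of u x \<partial>lborel)"

definition cutoff :: "real \<Rightarrow> 'a::euclidean_space test_fun \<Rightarrow> 'a test_fun"
  where "cutoff R u = Test_fun (\<lambda>x. bump R x * (fun_of u x - bump_mean R u))"

lemma unit_bump_mult_integrable:
  assumes "0 < R"
  shows "integrable lborel (\<lambda>x. unit_bump R x * fun_of u x)"
  by (intro Cc_infty_integrable Cc_infty_mult smooth_fun_of Cc_infty_smooth disjI1 unit_bump_Cc_infty assms)

lemma fun_of_cutoff:
  assumes "0 < R"
  shows "fun_of (cutoff R u) = (\<lambda>x. bump R x * (fun_of u x - bump_mean R u))"
  unfolding cutoff_def
  by (intro Test_fun_inverse Cc_infty_mult smooth_bump smooth_diff smooth_fun_of smooth_const disjI1 bump_Cc_infty assms)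

lemma linear_cutoff:
  assumes R: "0 < R"
  shows "linear (cutoff R)"
proof (intro linearI test_fun_eqI)
  fix u v :: "'a test_fun" and x
  have "bump_mean R (u + v) = bump_mean R u + bump_mean R v"
    using unit_bump_mult_integrable[OF R, of u] unit_bump_mult_integrable[OF R, of v]
    by (simp add: bump_mean_def plus_test_fun.rep_eq distrib_left)
  then show "fun_of (cutoff R (u + v)) x = fun_of (cutoff R u + cutoff R v) x"
    by (simp add: fun_of_cutoff[OF R] plus_test_fun.rep_eq algebra_simps)
next
  fix r and u :: "'a test_fun" and x
  have "bump_mean R (r *\<^sub>R u) = r * bump_mean R u"
    by (simp add: bump_mean_def scaleR_test_fun.rep_eq mult.left_commute)
  then show "fun_of (cutoff R (r *\<^sub>R u)) x = fun_of (r *\<^sub>R cutoff R u) x"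
    by (simp add: fun_of_cutoff[OF R] scaleR_test_fun.rep_eq algebra_simps)
qed

text \<open>The constant does not depend on the radius: the square of the gradient of the bump
  contributes \<open>1 / R\<^sup>2\<close>, exactly cancelling the \<open>R\<^sup>2\<close> of the
  Poincare inequality.\<close>

lemma cutoff_bounded:
  obtains C where "0 \<le> C" "\<And>R u. 0 < R \<Longrightarrow> norm (cutoff R (u :: 'a::euclidean_space test_fun)) \<le> C * norm u"
proof -
  obtain K where K: "0 < K" "\<And>r x. 0 < r \<Longrightarrow> norm (grad (bump r) (x::'a)) \<le> K / r"
    by (rule grad_bump_bound) blast
  \<comment> \<open>Both factors 2 come from
    \<open>(a + b)\<^sup>2 \<le> 2 * a\<^sup>2 + 2 * b\<^sup>2\<close> for the two terms of the
    product rule; the rest is the Poincare constant.\<close>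
  define C where "C = sqrt (2 + 2 * K\<^sup>2 * (16 * 4 ^ DIM('a)))"
  show thesis
  proof (rule that)
    show "0 \<le> C" by (simp add: C_def)
    fix R and u :: "'a test_fun" assume R: "0 < (R::real)"
    let ?h = "\<lambda>x. fun_of u x - bump_mean R u"
    let ?I = "\<lambda>x. indicator (cball 0 (2 * R)) x * (?h x)\<^sup>2"
    have g: "grad (fun_of (cutoff R u)) x = bump R x *\<^sub>R grad (fun_of u) x + ?h x *\<^sub>R grad (bump R) x" for x
    proof -
      have "grad ?h x = grad (fun_of u) x"
        by (rule grad_eqI) (auto intro!: derivative_eq_intros smooth_has_derivative_grad smooth_fun_of)
      then show ?thesis
        unfolding fun_of_cutoff[OF R]
        by (subst grad_mult) (auto intro: smooth_bump smooth_diff smooth_fun_of smooth_const)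
    qed
    have "(norm (grad (fun_of (cutoff R u)) x))\<^sup>2 \<le> 2 * (norm (grad (fun_of u) x))\<^sup>2 + (2 * (K / R)\<^sup>2) * ?I x" for x
    proof -
      define a b where "a = norm (bump R x *\<^sub>R grad (fun_of u) x)" and "b = norm (?h x *\<^sub>R grad (bump R) x)"
      have "(norm (grad (fun_of (cutoff R u)) x))\<^sup>2 \<le> (a + b)\<^sup>2"
        unfolding g a_def b_def by (intro power_mono norm_triangle_ineq) auto
      also have "\<dots> \<le> 2 * a\<^sup>2 + 2 * b\<^sup>2"
        using sum_squares_bound[of a b] by (simp add: power2_sum)
      also have "a\<^sup>2 \<le> (norm (grad (fun_of u) x))\<^sup>2"
        unfolding a_def using bump_nonneg[of R x] bump_le_1[of R x]
        by (intro power_mono) (auto simp: mult_left_le_one_le)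
      also have "b\<^sup>2 \<le> (K / R)\<^sup>2 * ?I x"
      proof (cases "x \<in> cball 0 (2 * R)")
        case True
        have "(norm (grad (bump R) x))\<^sup>2 \<le> (K / R)\<^sup>2"
          by (intro power_mono K R) auto
        then have "(?h x)\<^sup>2 * (norm (grad (bump R) x))\<^sup>2 \<le> (?h x)\<^sup>2 * (K / R)\<^sup>2"
          by (rule mult_left_mono) simp
        then show ?thesis using True by (simp add: b_def power_mult_distrib mult.commute)
      next
        case False
        then show ?thesis using grad_bump_eq_0[OF R, of x] by (simp add: b_def)
      qed
      finally show ?thesis by simp
    qed
    then have "ennreal ((norm (cutoff R u))\<^sup>2) \<le>
        (\<integral>\<^sup>+x. ennreal (2 * (norm (grad (fun_of u) x))\<^sup>2 + (2 * (K / R)\<^sup>2) * ?I x) \<partial>lborel)"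
      unfolding norm_test_fun_sq_nn by (intro nn_integral_mono ennreal_leI)
    also have "\<dots> = (\<integral>\<^sup>+x. 2 * ennreal ((norm (grad (fun_of u) x))\<^sup>2) + ennreal (2 * (K / R)\<^sup>2) * ennreal (?I x) \<partial>lborel)"
      by (intro nn_integral_cong) (simp add: ennreal_plus ennreal_mult)
    also have "\<dots> = 2 * (\<integral>\<^sup>+x. ennreal ((norm (grad (fun_of u) x))\<^sup>2) \<partial>lborel) +
        ennreal (2 * (K / R)\<^sup>2) * (\<integral>\<^sup>+x. ennreal (?I x) \<partial>lborel)"
    proof -
      have m1: "(\<lambda>x. ennreal ((norm (grad (fun_of u) x))\<^sup>2)) \<in> borel_measurable lborel"
        unfolding measurable_lborel2
        by (intro measurable_compose[OF _ measurable_ennreal] borel_measurable_power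
            measurable_compose[OF borel_measurable_smooth borel_measurable_norm] smooth_grad smooth_fun_of)
      have m2: "(\<lambda>x. ennreal (?I x)) \<in> borel_measurable lborel"
        unfolding measurable_lborel2
        by (intro measurable_compose[OF _ measurable_ennreal] borel_measurable_times borel_measurable_power
            borel_measurable_indicator borel_measurable_smooth smooth_diff smooth_fun_of smooth_const) simp
      show ?thesis
        unfolding nn_integral_cmult[OF m1, symmetric] nn_integral_cmult[OF m2, symmetric]
        by (rule nn_integral_add) (intro borel_measurable_times_ennreal borel_measurable_const m1 m2)+
    qed
    also have "\<dots> \<le> 2 * ennreal ((norm u)\<^sup>2) + ennreal (2 * (K / R)\<^sup>2) * ennreal (16 * 4 ^ DIM('a) * R\<^sup>2 * (norm u)\<^sup>2)"
      unfolding norm_test_fun_sq_nn[symmetric] bump_mean_def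
      by (intro add_left_mono mult_left_mono poincare R) simp
    also have "\<dots> = ennreal (2 * (norm u)\<^sup>2 + 2 * (K / R)\<^sup>2 * (16 * 4 ^ DIM('a) * R\<^sup>2 * (norm u)\<^sup>2))"
    proof -
      have "2 * ennreal x + ennreal y * ennreal z = ennreal (2 * x + y * z)" if "0 \<le> x" "0 \<le> y" "0 \<le> z" for x y z
        using that by (simp add: ennreal_plus ennreal_mult)
      then show ?thesis by simp
    qed
    also have "2 * (norm u)\<^sup>2 + 2 * (K / R)\<^sup>2 * (16 * 4 ^ DIM('a) * R\<^sup>2 * (norm u)\<^sup>2) = (C * norm u)\<^sup>2"
    proof -
      have "C\<^sup>2 = 2 + 2 * K\<^sup>2 * (16 * 4 ^ DIM('a))" unfolding C_def by (rule real_sqrt_pow2) simp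
      then show ?thesis using R by (simp add: power_mult_distrib power_divide field_simps)
    qed
    finally have "(norm (cutoff R u))\<^sup>2 \<le> (C * norm u)\<^sup>2" by (simp del: power_mult_distrib)
    then show "norm (cutoff R u) \<le> C * norm u"
      by (rule power2_le_imp_le) (simp add: C_def)
  qed
qed

section \<open>Total variation and mollification\<close>

text \<open>The exceptional set is open by continuity, and a nonempty open set is not null.\<close>

lemma Cc_infty_AE_norm_le:
  fixes \<phi> :: "'a::euclidean_space \<Rightarrow> 'b::euclidean_space"
  assumes \<phi>: "\<phi> \<in> Cc_infty" and ae: "AE x in lborel. norm (\<phi> x) \<le> 1"
  shows "norm (\<phi> x) \<le> 1"
proof -
  let ?S = "{x. 1 < norm (\<phi> x)}"
  have "open ?S"
    by (intro open_Collect_less continuous_intros smooth_continuous Cc_infty_smooth \<phi>)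
  moreover have "AE x in lborel. x \<notin> ?S" using ae by (simp add: not_less)
  ultimately have "?S \<in> null_sets lborel" by (subst AE_iff_null_sets) auto
  then have "negligible ?S"
    using null_sets_completionI negligible_iff_null_sets by blast
  then have "?S = {}" using \<open>open ?S\<close> open_not_negligible by blast
  then show ?thesis by (auto simp: not_less)
qed

lemma TV_upper:
  assumes "\<phi> \<in> Cc_infty" "\<And>x. norm (\<phi> x) \<le> 1"
  shows "ereal (on_test W (Test_fun (divergence \<phi>))) \<le> TV W"
  unfolding TV_def div_class_def using assms by (intro Sup_upper) auto

lemma TV_leI:
  fixes W :: "'a::euclidean_space Dm1"
  assumes "\<And>\<phi>. \<phi> \<in> Cc_infty \<Longrightarrow> (\<And>x. norm (\<phi> x) \<le> 1) \<Longrightarrow>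
    ereal (on_test W (Test_fun (divergence \<phi>))) \<le> B"
  shows "TV W \<le> B"
  unfolding TV_def div_class_def
proof (rule Sup_least, clarify)
  fix \<phi> :: "'a \<Rightarrow> 'a" assume "\<phi> \<in> Cc_infty" "AE x in lborel. norm (\<phi> x) \<le> 1"
  then show "ereal (on_test W (Test_fun (divergence \<phi>))) \<le> B"
    using assms Cc_infty_AE_norm_le by blast
qed

lemma TV_tendsto:
  fixes w :: "'a::euclidean_space Dm1"
  assumes lim: "W \<longlonglongrightarrow> w" and le: "\<And>k. TV (W k) \<le> TV w + ereal (inverse (real (Suc k)))"
  shows "(\<lambda>k. TV (W k)) \<longlonglongrightarrow> TV w"
proof (rule order_tendstoI)
  fix a assume "a < TV w"
  then obtain \<phi> where \<phi>: "\<phi> \<in> Cc_infty" "AE x in lborel. norm (\<phi> x) \<le> 1" "a < ereal (blinfun_apply w (div_class \<phi>))"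
    unfolding TV_def less_Sup_iff by blast
  have "(\<lambda>k. ereal (blinfun_apply (W k) (div_class \<phi>))) \<longlonglongrightarrow> ereal (blinfun_apply w (div_class \<phi>))"
    by (intro tendsto_ereal blinfun.tendsto[OF lim tendsto_const])
  then have "\<forall>\<^sub>F k in sequentially. a < ereal (blinfun_apply (W k) (div_class \<phi>))"
    using \<phi>(3) by (rule order_tendstoD)
  then show "\<forall>\<^sub>F k in sequentially. a < TV (W k)"
  proof eventually_elim
    case (elim k)
    also have "ereal (blinfun_apply (W k) (div_class \<phi>)) \<le> TV (W k)"
      unfolding TV_def using \<phi> by (intro Sup_upper) auto
    finally show ?case .
  qed
next
  fix a assume a: "TV w < a"
  \<comment> \<open>Having something above \<open>TV w\<close> forces it to be finite, so an
    infinite total variation needs nothing in this half.\<close>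
  then obtain t where t: "TV w = ereal t" using TV_nonneg[of w] by (cases "TV w") auto
  have "(\<lambda>k. ereal (t + inverse (real (Suc k)))) \<longlonglongrightarrow> ereal (t + 0)"
    by (intro tendsto_ereal tendsto_add tendsto_const LIMSEQ_inverse_real_of_nat)
  then have "\<forall>\<^sub>F k in sequentially. ereal (t + inverse (real (Suc k))) < a"
    by (rule order_tendstoD) (use a t in simp)
  then show "\<forall>\<^sub>F k in sequentially. TV (W k) < a"
  proof eventually_elim
    case (elim k)
    then show ?case using le[of k] t by (simp add: order_le_less_trans)
  qed
qed

section \<open>Mollification of test functions and functionals\<close>

definition mollify :: "real \<Rightarrow> 'a::euclidean_space test_fun \<Rightarrow> 'a test_fun"
  where "mollify r u = Test_fun (conv (unit_bump r) (fun_of u))"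

lemma fun_of_mollify: "0 < r \<Longrightarrow> fun_of (mollify r u) = conv (unit_bump r) (fun_of u)"
  unfolding mollify_def by (intro Test_fun_inverse conv_Cc_infty unit_bump_Cc_infty fun_of_Cc_infty)

lemma linear_mollify:
  assumes r: "0 < r"
  shows "linear (mollify r)"
proof (intro linearI test_fun_eqI)
  fix u v :: "'a test_fun" and x
  have "integrable lborel (\<lambda>z. unit_bump r z * fun_of u (x + z))" for u :: "'a test_fun"
    using conv_integrable[OF unit_bump_Cc_infty[OF r] fun_of_Cc_infty] by simp
  then show "fun_of (mollify r (u + v)) x = fun_of (mollify r u + mollify r v) x"
    by (simp add: fun_of_mollify[OF r] plus_test_fun.rep_eq conv_def distrib_left)
next
  fix c and u :: "'a test_fun" and x
  show "fun_of (mollify r (c *\<^sub>R u)) x = fun_of (c *\<^sub>R mollify r u) x"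
    by (simp add: fun_of_mollify[OF r] scaleR_test_fun.rep_eq conv_def mult.left_commute)
qed

lemma inner_mollify:
  "0 < r \<Longrightarrow> inner (mollify r u) v = (\<integral>z. unit_bump r z * inner (translate z u) v \<partial>lborel)"
  unfolding mollify_def by (rule inner_conv[OF unit_bump_Cc_infty])

lemma continuous_on_translate: "continuous_on S (\<lambda>z. translate z u)"
  by (intro continuous_at_imp_continuous_on ballI has_derivative_continuous[OF translate_has_derivative])

lemma integrable_inner_translate:
  assumes "0 < r"
  shows "integrable lborel (\<lambda>z. unit_bump r z * inner (translate z u) v)"
  by (rule integrable_compact_support[where r = "2 * r"])
     (intro continuous_on_mult continuous_on_inner continuous_on_translate continuous_on_const
       smooth_continuous[OF Cc_infty_smooth[OF unit_bump_Cc_infty[OF assms]]],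
      simp add: unit_bump_eq_0[OF assms])

lemma unit_bump_average_le:
  assumes "0 < r" "integrable lborel (\<lambda>z. unit_bump r z * h z)" "\<And>z. norm z \<le> 2 * r \<Longrightarrow> h z \<le> B"
  shows "(\<integral>z. unit_bump r (z::'a::euclidean_space) * h z \<partial>lborel) \<le> B"
proof -
  have "(\<integral>z. unit_bump r (z::'a) * h z \<partial>lborel) \<le> (\<integral>z. unit_bump r (z::'a) * B \<partial>lborel)"
  proof (rule integral_mono[OF assms(2)])
    show "integrable lborel (\<lambda>z::'a. unit_bump r z * B)"
      by (intro integrable_mult_left Cc_infty_integrable unit_bump_Cc_infty assms)
    show "unit_bump r z * h z \<le> unit_bump r z * B" for z
    proof (cases "norm z \<le> 2 * r")
      case True
      show ?thesis by (intro mult_left_mono assms(3) unit_bump_nonneg assms(1) True)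
    qed (simp add: unit_bump_eq_0[OF assms(1)])
  qed
  then show ?thesis by (simp add: integral_unit_bump[OF assms(1)])
qed

text \<open>Pairing the mollified function with itself gives an average of inner products with
  translates of \<open>u\<close>, all of which have the norm of \<open>u\<close>.\<close>

lemma norm_mollify_le:
  assumes r: "0 < r"
  shows "norm (mollify r u) \<le> norm u"
proof -
  let ?m = "mollify r u"
  have "(norm ?m)\<^sup>2 = (\<integral>z. unit_bump r z * inner (translate z u) ?m \<partial>lborel)"
    by (simp add: power2_norm_eq_inner inner_mollify[OF r])
  also have "\<dots> \<le> norm u * norm ?m"
    by (intro unit_bump_average_le integrable_inner_translate r)
       (metis norm_translate norm_cauchy_schwarz)
  finally have "norm ?m * norm ?m \<le> norm u * norm ?m" by (simp add: power2_eq_square)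
  then show ?thesis by (cases "norm ?m = 0") (auto simp: mult_le_cancel_right)
qed

text \<open>The mollifier is even. Consequently mollifying the functional \<open>inner v\<close>
  amounts to mollifying \<open>v\<close>.\<close>

lemma inner_mollify_commute:
  fixes u v :: "'a::euclidean_space test_fun"
  assumes r: "0 < r"
  shows "inner (mollify r u) v = inner u (mollify r v)"
proof -
  have "(\<lambda>z. unit_bump r z * inner u (translate z v)) \<in> borel_measurable borel"
    by (intro borel_measurable_continuous_onI continuous_intros continuous_on_translate smooth_continuous
        Cc_infty_smooth unit_bump_Cc_infty r)
  from integral_lborel_reflect[OF this] show ?thesis
    by (simp add: inner_mollify[OF r] inner_translate_left unit_bump_minus inner_commute[of u])
qed

text \<open>The error, paired with itself, is an average of inner products with
  \<open>translate z v - v\<close> over small \<open>z\<close>, where continuity of translation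
  applies.\<close>

lemma mollify_approx:
  fixes v :: "'a::euclidean_space test_fun"
  assumes "0 < e"
  obtains r where "0 < r" "norm (mollify r v - v) \<le> e"
proof -
  have "((\<lambda>z. translate z v) \<longlongrightarrow> translate 0 v) (at 0)"
    by (rule translate_tendsto) (rule tendsto_ident_at)
  then obtain d where d: "0 < d" "\<And>z. z \<noteq> 0 \<Longrightarrow> dist z 0 < d \<Longrightarrow> dist (translate z v) (translate 0 v) < e"
    using assms unfolding tendsto_iff eventually_at by (metis UNIV_I)
  \<comment> \<open>The mollifier lives on \<open>norm z \<le> 2 * r\<close>, that is on
    \<open>norm z \<le> d / 2\<close>, strictly inside the ball given by continuity.\<close>
  define r where "r = d / 4"
  have r: "0 < r" using d by (simp add: r_def)
  have close: "norm (translate z v - v) \<le> e" if "norm z \<le> 2 * r" for z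
    using d(2)[of z] that d(1) assms by (cases "z = 0") (auto simp: r_def dist_norm)
  define m where "m = mollify r v - v"
  have i: "integrable lborel (\<lambda>z. unit_bump r z * inner (translate z v) m)"
    by (rule integrable_inner_translate[OF r])
  have i': "integrable lborel (\<lambda>z. unit_bump r z * inner v m)"
    by (intro integrable_mult_left Cc_infty_integrable unit_bump_Cc_infty r)
  have "(norm m)\<^sup>2 = inner (mollify r v) m - inner v m"
    by (simp add: power2_norm_eq_inner m_def inner_diff_left)
  also have "\<dots> = (\<integral>z. unit_bump r z * inner (translate z v - v) m \<partial>lborel)"
    using integral_unit_bump[OF r, where 'a = 'a]
    by (simp add: inner_mollify[OF r] inner_diff_left right_diff_distrib Bochner_Integration.integral_diff[OF i i'])
  also have "\<dots> \<le> e * norm m"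
  proof (rule unit_bump_average_le[OF r])
    show "integrable lborel (\<lambda>z. unit_bump r z * inner (translate z v - v) m)"
      using Bochner_Integration.integrable_diff[OF i i'] by (simp add: inner_diff_left right_diff_distrib)
    fix z :: 'a assume "norm z \<le> 2 * r"
    have "inner (translate z v - v) m \<le> norm (translate z v - v) * norm m" by (rule norm_cauchy_schwarz)
    also have "\<dots> \<le> e * norm m" by (intro mult_right_mono close \<open>norm z \<le> 2 * r\<close>) simp
    finally show "inner (translate z v - v) m \<le> e * norm m" .
  qed
  finally have "norm m * norm m \<le> e * norm m" by (simp add: power2_eq_square)
  then have "norm m \<le> e" using assms by (cases "norm m = 0") (auto simp: mult_le_cancel_right)
  with r show thesis unfolding m_def by (rule that)
qed

definition vanishes_at_infinity :: "('a::real_normed_vector \<Rightarrow> real) \<Rightarrow> bool"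
  where "vanishes_at_infinity g \<longleftrightarrow> (\<forall>e>0. \<exists>R. \<forall>x. R < norm x \<longrightarrow> \<bar>g x\<bar> \<le> e)"

text \<open>For \<open>inner v\<close> the function is zero far out by
  \<open>inner_translate_far\<close>. The error of approximating \<open>w\<close> is uniform in
  \<open>x\<close> because translations preserve the norm.\<close>

lemma functional_translate_vanishes:
  fixes w :: "'a::euclidean_space Dm1"
  shows "vanishes_at_infinity (\<lambda>x. on_test w (translate (- x) u))"
  unfolding vanishes_at_infinity_def
proof (intro allI impI)
  fix e :: real assume e: "0 < e"
  define d where "d = e / (norm u + 1)"
  have d: "0 < d" "d * norm u \<le> e" using e by (auto simp: d_def field_simps add_pos_nonneg add_nonneg_pos)
  obtain v W where W: "\<And>\<phi>. on_test W \<phi> = inner v \<phi>" "norm (w - W) \<le> d"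
    using Dm1_approx_inner[OF d(1)] by metis
  obtain R where R: "\<And>z. R < norm z \<Longrightarrow> inner v (translate z u) = 0"
    by (rule inner_translate_far) blast
  have "\<bar>on_test w (translate (- x) u)\<bar> \<le> e" if "R < norm x" for x
  proof -
    have "on_test w (translate (- x) u) = on_test (w - W) (translate (- x) u)"
      using R[of "- x"] that by (simp add: blinfun.diff_left W)
    also have "\<bar>\<dots>\<bar> \<le> norm (w - W) * norm u"
      using on_test_bound[of "w - W" "translate (- x) u"] by simp
    also have "\<dots> \<le> d * norm u" by (intro mult_right_mono W) simp
    finally show ?thesis using d by simp
  qed
  then show "\<exists>R. \<forall>x. R < norm x \<longrightarrow> \<bar>on_test w (translate (- x) u)\<bar> \<le> e" by blast
qed

text \<open>For \<open>inner v\<close> the formula follows from \<open>conv_commute\<close> and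
  \<open>inner_conv\<close>, with the roles of mollifier and test function exchanged. For fixed
  \<phi> both sides depend continuously on the functional, so it persists for all
  \<open>w\<close>.\<close>

lemma mollify_kernel:
  fixes w :: "'a::euclidean_space Dm1"
  assumes r: "0 < r"
  shows "on_test w (mollify r \<phi>) = (\<integral>x. on_test w (translate (- x) (Test_fun (unit_bump r))) * fun_of \<phi> x \<partial>lborel)"
proof -
  define \<rho> :: "'a test_fun" where "\<rho> = Test_fun (unit_bump r)"
  have f\<rho>: "fun_of \<rho> = unit_bump r"
    unfolding \<rho>_def by (rule Test_fun_inverse[OF unit_bump_Cc_infty[OF r]])
  let ?g = "\<lambda>w x. on_test w (translate (- x) \<rho>)"
  have ig: "integrable lborel (\<lambda>x. ?g w x * fun_of \<phi> x)" for w
    by (intro Cc_infty_integrable Cc_infty_mult smooth_functional_translate bounded_linear_on_test smooth_fun_of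
        disjI2 fun_of_Cc_infty)
  have inner_case: "on_test W (mollify r \<phi>) = (\<integral>x. ?g W x * fun_of \<phi> x \<partial>lborel)"
    if W: "\<And>\<phi>. on_test W \<phi> = inner v \<phi>" for W :: "'a Dm1" and v
  proof -
    have "mollify r \<phi> = Test_fun (conv (\<lambda>z. fun_of \<phi> (- z)) (fun_of \<rho>))"
      unfolding mollify_def f\<rho>
      by (subst conv_commute[OF unit_bump_Cc_infty[OF r] fun_of_Cc_infty unit_bump_minus]) (rule refl)
    then have "on_test W (mollify r \<phi>) = (\<integral>z. fun_of \<phi> (- z) * inner (translate z \<rho>) v \<partial>lborel)"
      by (simp add: W inner_commute[of v] inner_conv[OF Cc_infty_reflect[OF fun_of_Cc_infty]])
    also have "\<dots> = (\<integral>z. fun_of \<phi> (- (- z)) * inner (translate (- z) \<rho>) v \<partial>lborel)"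
    proof (rule integral_lborel_reflect[symmetric])
      show "(\<lambda>z. fun_of \<phi> (- z) * inner (translate z \<rho>) v) \<in> borel_measurable borel"
        by (intro borel_measurable_continuous_onI continuous_intros continuous_on_translate smooth_continuous
            Cc_infty_smooth Cc_infty_reflect fun_of_Cc_infty)
    qed
    also have "\<dots> = (\<integral>x. ?g W x * fun_of \<phi> x \<partial>lborel)"
      by (simp add: W inner_commute[of v] mult.commute)
    finally show ?thesis .
  qed
  \<comment> \<open>Times the norm of a functional, this bounds the two sides of the claim together:
    the first summand is for the left one, the second for the integral.\<close>
  define K where "K = norm \<phi> + norm \<rho> * (\<integral>x. \<bar>fun_of \<phi> x\<bar> \<partial>lborel)"
  have K: "0 \<le> K" by (simp add: K_def)
  have "\<bar>on_test w (mollify r \<phi>) - (\<integral>x. ?g w x * fun_of \<phi> x \<partial>lborel)\<bar> \<le> 0 + e" if e: "0 < e" for e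
  proof -
    define d where "d = e / (K + 1)"
    have d: "0 < d" "d * K \<le> e" using e K by (auto simp: d_def field_simps)
    obtain v W where W: "\<And>\<phi>. on_test W \<phi> = inner v \<phi>" "norm (w - W) \<le> d"
      using Dm1_approx_inner[OF d(1)] by metis
    have "on_test w (mollify r \<phi>) - (\<integral>x. ?g w x * fun_of \<phi> x \<partial>lborel) =
        on_test (w - W) (mollify r \<phi>) - (\<integral>x. ?g (w - W) x * fun_of \<phi> x \<partial>lborel)"
      using inner_case[OF W(1)] ig by (simp add: blinfun.diff_left left_diff_distrib)
    also have "\<bar>\<dots>\<bar> \<le> \<bar>on_test (w - W) (mollify r \<phi>)\<bar> + \<bar>\<integral>x. ?g (w - W) x * fun_of \<phi> x \<partial>lborel\<bar>"
      by (rule abs_triangle_ineq4)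
    also have "\<dots> \<le> d * norm \<phi> + (\<integral>x. d * norm \<rho> * \<bar>fun_of \<phi> x\<bar> \<partial>lborel)"
    proof (rule add_mono)
      have "\<bar>on_test (w - W) (mollify r \<phi>)\<bar> \<le> norm (w - W) * norm (mollify r \<phi>)" by (rule on_test_bound)
      also have "\<dots> \<le> d * norm \<phi>" using d by (intro mult_mono W norm_mollify_le r) auto
      finally show "\<bar>on_test (w - W) (mollify r \<phi>)\<bar> \<le> d * norm \<phi>" .
      have "norm (\<integral>x. ?g (w - W) x * fun_of \<phi> x \<partial>lborel) \<le> (\<integral>x. d * norm \<rho> * \<bar>fun_of \<phi> x\<bar> \<partial>lborel)"
      proof (rule Bochner_Integration.integral_norm_bound_integral[OF ig])
        show "integrable lborel (\<lambda>x. d * norm \<rho> * \<bar>fun_of \<phi> x\<bar>)"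
          by (intro integrable_mult_right integrable_abs Cc_infty_integrable fun_of_Cc_infty)
        fix x :: 'a
        have "\<bar>?g (w - W) x\<bar> \<le> norm (w - W) * norm \<rho>"
          using on_test_bound[of "w - W" "translate (- x) \<rho>"] by simp
        also have "\<dots> \<le> d * norm \<rho>" by (intro mult_right_mono W) simp
        finally show "norm (?g (w - W) x * fun_of \<phi> x) \<le> d * norm \<rho> * \<bar>fun_of \<phi> x\<bar>"
          by (simp add: abs_mult mult_right_mono)
      qed
      then show "\<bar>\<integral>x. ?g (w - W) x * fun_of \<phi> x \<partial>lborel\<bar> \<le> (\<integral>x. d * norm \<rho> * \<bar>fun_of \<phi> x\<bar> \<partial>lborel)" by simp
    qed
    also have "\<dots> = d * K" by (simp add: K_def distrib_left mult.assoc)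
    finally show ?thesis using d by simp
  qed
  then have "\<bar>on_test w (mollify r \<phi>) - (\<integral>x. ?g w x * fun_of \<phi> x \<partial>lborel)\<bar> \<le> 0"
    by (rule field_le_epsilon)
  then show ?thesis by (simp add: \<rho>_def)
qed

text \<open>Total variation does not grow because mollification commutes with the divergence and an
  average of vectors of norm at most 1 again has norm at most 1.\<close>

lemma Dm1_mollify:
  fixes w :: "'a::euclidean_space Dm1"
  assumes e: "0 < e"
  obtains W g where "norm (W - w) \<le> e" "TV W \<le> TV w" "smooth g" "represents g W" "vanishes_at_infinity g"
proof -
  have e3: "0 < e / 3" using e by simp
  obtain v W0 where W0: "\<And>\<phi>. on_test W0 \<phi> = inner v \<phi>" "norm (w - W0) \<le> e / 3"
    using Dm1_approx_inner[OF e3] by metis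
  obtain r where r: "0 < r" "norm (mollify r v - v) \<le> e / 3"
    using mollify_approx[OF e3] by metis
  obtain W where W: "\<And>\<phi>. on_test W \<phi> = on_test w (mollify r \<phi>)"
    using Dm1_pullback[OF linear_mollify[OF r(1)], of 1 w] norm_mollify_le[OF r(1)] by (metis mult_1 zero_le_one)
  show thesis
  proof (rule that)
    show "norm (W - w) \<le> e"
    proof (rule norm_Dm1_le)
      fix \<phi>
      \<comment> \<open>The approximating functional is inserted twice; symmetry of mollification
        moves the middle error onto \<open>v\<close>, where \<open>mollify_approx\<close>
        applies.\<close>
      have "on_test (W - w) \<phi> = on_test (w - W0) (mollify r \<phi>) + inner (mollify r v - v) \<phi> - on_test (w - W0) \<phi>"
        by (simp add: blinfun.diff_left W W0 inner_diff_left inner_mollify_commute[OF r(1)])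
      also have "\<bar>\<dots>\<bar> \<le> \<bar>on_test (w - W0) (mollify r \<phi>)\<bar> + \<bar>inner (mollify r v - v) \<phi>\<bar> + \<bar>on_test (w - W0) \<phi>\<bar>"
        by linarith
      also have "\<dots> \<le> norm (w - W0) * norm (mollify r \<phi>) + norm (mollify r v - v) * norm \<phi> + norm (w - W0) * norm \<phi>"
        by (intro add_mono on_test_bound Cauchy_Schwarz_ineq2)
      also have "\<dots> \<le> e / 3 * norm \<phi> + e / 3 * norm \<phi> + e / 3 * norm \<phi>"
        using e by (intro add_mono mult_mono W0 r norm_mollify_le) auto
      finally show "\<bar>on_test (W - w) \<phi>\<bar> \<le> e * norm \<phi>" by simp
    qed (use e in simp)
    show "TV W \<le> TV w"
    proof (rule TV_leI)
      fix \<phi> :: "'a \<Rightarrow> 'a" assume \<phi>: "\<phi> \<in> Cc_infty" "\<And>x. norm (\<phi> x) \<le> 1"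
      have "mollify r (Test_fun (divergence \<phi>)) = Test_fun (divergence (conv (unit_bump r) \<phi>))"
        unfolding mollify_def Test_fun_inverse[OF Cc_infty_divergence[OF \<phi>(1)]]
        by (rule arg_cong[where f = Test_fun])
           (simp add: fun_eq_iff divergence_conv[OF unit_bump_Cc_infty[OF r(1)] \<phi>(1)])
      then have "ereal (on_test W (Test_fun (divergence \<phi>))) =
          ereal (on_test w (Test_fun (divergence (conv (unit_bump r) \<phi>))))" by (simp add: W)
      also have "\<dots> \<le> TV w"
        by (intro TV_upper conv_Cc_infty conv_norm_le unit_bump_Cc_infty unit_bump_nonneg integral_unit_bump r \<phi>)
      finally show "ereal (on_test W (Test_fun (divergence \<phi>))) \<le> TV w" .
    qed
    let ?g = "\<lambda>x. on_test w (translate (- x) (Test_fun (unit_bump r)))"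
    show "smooth ?g" by (rule smooth_functional_translate[OF bounded_linear_on_test])
    show "represents ?g W" unfolding represents_def W by (simp add: mollify_kernel[OF r(1)])
    show "vanishes_at_infinity ?g" by (rule functional_translate_vanishes)
  qed
qed

section \<open>A Hardy inequality for functions of bounded variation\<close>

text \<open>A smooth positive part: since \<open>1 + y \<le> exp y\<close>, its slope stays between
  0 and 1 and it lies at most 1 below \<open>s\<close>.\<close>

definition soft_ramp :: "real \<Rightarrow> real"
  where "soft_ramp s = s * flat_exp 0 s"

definition soft_ramp' :: "real \<Rightarrow> real"
  where "soft_ramp' s = flat_exp 0 s + flat_exp 1 s"

lemma soft_ramp_DERIV: "(soft_ramp has_real_derivative soft_ramp' s) (at s)"
proof -
  have "(soft_ramp has_real_derivative (1 * flat_exp 0 s + (flat_exp (0 + 2) s - real 0 * flat_exp (0 + 1) s) * s)) (at s)"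
    unfolding soft_ramp_def[abs_def] by (intro DERIV_mult DERIV_ident flat_exp_DERIV)
  also have "1 * flat_exp 0 s + (flat_exp (0 + 2) s - real 0 * flat_exp (0 + 1) s) * s = soft_ramp' s"
    by (simp add: soft_ramp'_def flat_exp_def power2_eq_square)
  finally show ?thesis .
qed

lemma soft_ramp_eq_0: "s \<le> 0 \<Longrightarrow> soft_ramp s = 0" "s \<le> 0 \<Longrightarrow> soft_ramp' s = 0"
  by (simp_all add: soft_ramp_def soft_ramp'_def flat_exp_def)

lemma soft_ramp_nonneg: "0 \<le> soft_ramp s" "0 \<le> soft_ramp' s"
  by (auto simp: soft_ramp_def soft_ramp'_def flat_exp_def)

lemma soft_ramp'_le_1: "soft_ramp' s \<le> 1"
proof (cases "0 < s")
  case True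
  have "soft_ramp' s = exp (- 1 / s) * (1 + 1 / s)"
    using True by (simp add: soft_ramp'_def flat_exp_def distrib_left)
  also have "\<dots> \<le> exp (- 1 / s) * exp (1 / s)"
    by (intro mult_left_mono exp_ge_add_one_self) simp
  also have "\<dots> = 1" by (simp flip: exp_add)
  finally show ?thesis .
qed (simp add: soft_ramp_eq_0)

lemma soft_ramp_ge: "s - 1 \<le> soft_ramp s"
proof (cases "0 < s")
  case True
  have "s - 1 = s * (1 + - 1 / s)" using True by (simp add: field_simps)
  also have "\<dots> \<le> s * exp (- 1 / s)"
    using True by (intro mult_left_mono exp_ge_add_one_self) simp
  finally show ?thesis using True by (simp add: soft_ramp_def flat_exp_def)
qed (simp add: soft_ramp_eq_0)

lemma smooth_soft_ramp: "smooth soft_ramp" "smooth soft_ramp'"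
  unfolding soft_ramp_def[abs_def] soft_ramp'_def[abs_def]
  by (intro smooth_mult smooth_add smooth_ident smooth_flat_exp)+

text \<open>A smooth substitute for \<open>max (\<bar>t\<bar> - d) 0\<close>; since it vanishes near \<open>0\<close>, its composition with a
  smooth function vanishing at infinity has compact support.\<close>

definition soft_abs :: "real \<Rightarrow> real \<Rightarrow> real"
  where "soft_abs d t = d * (soft_ramp (t / d - 1) + soft_ramp (- t / d - 1))"

definition soft_sgn :: "real \<Rightarrow> real \<Rightarrow> real"
  where "soft_sgn d t = soft_ramp' (t / d - 1) - soft_ramp' (- t / d - 1)"

lemma soft_abs_DERIV:
  assumes "0 < d"
  shows "(soft_abs d has_real_derivative soft_sgn d t) (at t)"
proof -
  have a: "((\<lambda>t. t / d - 1) has_real_derivative 1 / d) (at t)"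
    and b: "((\<lambda>t. - t / d - 1) has_real_derivative - 1 / d) (at t)"
    using assms by (auto intro!: derivative_eq_intros)
  have "(soft_abs d has_real_derivative
      d * (soft_ramp' (t / d - 1) * (1 / d) + soft_ramp' (- t / d - 1) * (- 1 / d))) (at t)"
    unfolding soft_abs_def[abs_def]
    by (intro DERIV_cmult DERIV_add DERIV_chain2[OF soft_ramp_DERIV a] DERIV_chain2[OF soft_ramp_DERIV b])
  then show ?thesis by (rule DERIV_cong) (use assms in \<open>simp add: soft_sgn_def right_diff_distrib\<close>)
qed

lemma soft_abs_eq_0:
  assumes "0 < d" "\<bar>t\<bar> \<le> d"
  shows "soft_abs d t = 0" "soft_sgn d t = 0"
proof -
  have "t / d - 1 \<le> 0" "- t / d - 1 \<le> 0" using assms by (auto simp: field_simps)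
  then show "soft_abs d t = 0" "soft_sgn d t = 0"
    by (simp_all only: soft_abs_def soft_sgn_def soft_ramp_eq_0) simp_all
qed

lemma soft_abs_nonneg: "0 < d \<Longrightarrow> 0 \<le> soft_abs d t"
  by (simp add: soft_abs_def soft_ramp_nonneg)

lemma abs_soft_sgn_le: "\<bar>soft_sgn d t\<bar> \<le> 1"
  using soft_ramp_nonneg(2)[of "t / d - 1"] soft_ramp_nonneg(2)[of "- t / d - 1"]
    soft_ramp'_le_1[of "t / d - 1"] soft_ramp'_le_1[of "- t / d - 1"]
  by (simp add: soft_sgn_def)

text \<open>One \<open>d\<close> is lost to the threshold, and another because the ramp may lie 1
  below its argument before the scaling by \<open>d\<close>.\<close>

lemma soft_abs_ge:
  assumes d: "0 < d"
  shows "\<bar>t\<bar> - 2 * d \<le> soft_abs d t"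
proof -
  have "s - 2 * d \<le> soft_abs d t" if s: "s = t \<or> s = - t" for s
  proof -
    have "s - 2 * d = d * (s / d - 1 - 1)" using d by (simp add: field_simps)
    also have "\<dots> \<le> d * soft_ramp (s / d - 1)" using d by (intro mult_left_mono soft_ramp_ge) simp
    also have "\<dots> \<le> soft_abs d t"
      unfolding soft_abs_def using s d soft_ramp_nonneg(1) by (intro mult_left_mono) auto
    finally show ?thesis .
  qed
  from this[of t] this[of "- t"] show ?thesis by (simp add: abs_if)
qed

lemma smooth_soft_abs: "smooth (soft_abs d)" "smooth (soft_sgn d)"
proof -
  have a: "smooth (\<lambda>t. t / d - 1)" "smooth (\<lambda>t. - t / d - 1)"
    using smooth_diff[OF smooth_mult[OF smooth_ident smooth_const[of "1 / d"]] smooth_const[of "1::real"]]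
      smooth_diff[OF smooth_mult[OF smooth_ident smooth_const[of "- 1 / d"]] smooth_const[of "1::real"]]
    by simp_all
  show "smooth (soft_abs d)" "smooth (soft_sgn d)"
    unfolding soft_abs_def[abs_def] soft_sgn_def[abs_def]
    by (intro smooth_mult smooth_add smooth_diff smooth_const
        smooth_compose_real[OF smooth_soft_ramp(1)] smooth_compose_real[OF smooth_soft_ramp(2)] a)+
qed

section \<open>The Hardy weight and the radial field\<close>

definition hardy_weight :: "'a::euclidean_space \<Rightarrow> real"
  where "hardy_weight x = (1 + x \<bullet> x) powr (- 1 / 2)"

lemma one_plus_inner_pos: "0 < 1 + x \<bullet> x"
  by (rule add_pos_nonneg) auto

lemma smooth_one_plus_inner: "smooth (\<lambda>x::'a::euclidean_space. 1 + x \<bullet> x)"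
  by (intro smooth_add smooth_const smooth_inner smooth_ident)

lemma smooth_hardy_weight: "smooth hardy_weight"
  unfolding hardy_weight_def[abs_def] by (intro smooth_powr one_plus_inner_pos smooth_one_plus_inner)

lemma hardy_weight_pos: "0 < hardy_weight x"
  using one_plus_inner_pos[of x] by (simp add: hardy_weight_def)

lemma hardy_weight_sq: "(hardy_weight x)\<^sup>2 * (1 + x \<bullet> x) = 1"
proof -
  have "(hardy_weight x)\<^sup>2 = (1 + x \<bullet> x) powr (- 1)"
    unfolding hardy_weight_def power2_eq_square by (simp flip: powr_add)
  then show ?thesis using one_plus_inner_pos[of x] by (simp add: powr_minus)
qed

lemma grad_hardy_weight: "grad hardy_weight x = - (hardy_weight x / (1 + x \<bullet> x)) *\<^sub>R x"
proof (rule grad_eqI)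
  have p: "0 < 1 + x \<bullet> x" by (rule one_plus_inner_pos)
  have "((\<lambda>x. 1 + x \<bullet> x) has_derivative (\<lambda>v. 2 * (x \<bullet> v))) (at x)"
    by (auto intro!: derivative_eq_intros simp: inner_commute)
  moreover have "((\<lambda>t. t powr (- 1 / 2)) has_derivative (\<lambda>h. ((- 1 / 2) * (1 + x \<bullet> x) powr (- 1 / 2 - 1)) * h)) (at (1 + x \<bullet> x))"
    using has_real_derivative_powr[OF p, of "- 1 / 2"] by (simp only: has_field_derivative_def)
  ultimately have D: "(hardy_weight has_derivative
      (\<lambda>v. ((- 1 / 2) * (1 + x \<bullet> x) powr (- 1 / 2 - 1)) * (2 * (x \<bullet> v)))) (at x)"
    unfolding hardy_weight_def[abs_def]
    using diff_chain_at[of "\<lambda>x. 1 + x \<bullet> x" _ x "\<lambda>t. t powr (- 1 / 2)"] by (simp only: o_def)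
  have "(1 + x \<bullet> x) powr (- 1 / 2 - 1) = hardy_weight x / (1 + x \<bullet> x)"
    using p by (subst powr_diff) (simp add: hardy_weight_def)
  moreover have "((- 1 / 2) * c) * (2 * y) = - c * y" for c y :: real by simp
  ultimately have "(\<lambda>v. ((- 1 / 2) * (1 + x \<bullet> x) powr (- 1 / 2 - 1)) * (2 * (x \<bullet> v))) =
      (\<bullet>) (- (hardy_weight x / (1 + x \<bullet> x)) *\<^sub>R x)"
    by (simp only: inner_scaleR_left[abs_def])
  with D show "(hardy_weight has_derivative (\<bullet>) (- (hardy_weight x / (1 + x \<bullet> x)) *\<^sub>R x)) (at x)"
    by (simp only:)
qed

lemma divergence_ident: "divergence (\<lambda>x::'a::euclidean_space. x) x = DIM('a)"
proof -
  have "frechet_derivative (\<lambda>x::'a. x) (at x) = (\<lambda>v. v)"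
    by (rule frechet_derivative_at[symmetric]) simp
  then show ?thesis by (simp add: divergence_def)
qed

text \<open>A smooth substitute for the unit radial field x / |x|, whose divergence (n - 1) / |x| is
  the classical Hardy weight.\<close>

definition hardy_field :: "'a::euclidean_space \<Rightarrow> 'a"
  where "hardy_field x = hardy_weight x *\<^sub>R x"

lemma smooth_hardy_field: "smooth hardy_field"
  unfolding hardy_field_def[abs_def] by (intro smooth_scaleR smooth_hardy_weight smooth_ident)

lemma norm_hardy_field_le: "norm (hardy_field x) \<le> 1"
proof (rule power2_le_imp_le)
  have "(norm (hardy_field x))\<^sup>2 = (hardy_weight x)\<^sup>2 * (x \<bullet> x)"
    by (simp add: hardy_field_def power_mult_distrib power2_norm_eq_inner)
  also have "\<dots> \<le> (hardy_weight x)\<^sup>2 * (1 + x \<bullet> x)" by (intro mult_left_mono) auto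
  finally show "(norm (hardy_field x))\<^sup>2 \<le> 1\<^sup>2" by (simp add: hardy_weight_sq)
qed simp

text \<open>The divergence of the identity contributes n times the weight, and the gradient of the
  weight removes the fraction |x|^2 / (1 + |x|^2) < 1 of one such weight.\<close>

lemma divergence_hardy_field_ge:
  "(real DIM('a) - 1) * hardy_weight x \<le> divergence hardy_field (x::'a::euclidean_space)"
proof -
  have "divergence hardy_field x = DIM('a) * hardy_weight x - hardy_weight x * ((x \<bullet> x) / (1 + x \<bullet> x))"
    unfolding hardy_field_def[abs_def]
    by (subst divergence_scaleR[OF smooth_hardy_weight smooth_ident])
       (simp add: divergence_ident grad_hardy_weight mult.commute)
  moreover have "hardy_weight x * ((x \<bullet> x) / (1 + x \<bullet> x)) \<le> hardy_weight x * 1"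
    using one_plus_inner_pos[of x] hardy_weight_pos[of x] by (intro mult_left_mono) (auto simp: divide_le_eq)
  ultimately show ?thesis by (simp add: left_diff_distrib)
qed

lemma TV_integral_bound:
  fixes W :: "'a::euclidean_space Dm1"
  assumes W: "represents g W" "TV W \<le> ereal V" and \<phi>: "\<phi> \<in> Cc_infty" "\<And>x. norm (\<phi> x) \<le> 1"
  shows "(\<integral>x. g x * divergence \<phi> x \<partial>lborel) \<le> V"
proof -
  have "on_test W (Test_fun (divergence \<phi>)) = (\<integral>x. g x * divergence \<phi> x \<partial>lborel)"
    using W(1) unfolding represents_def by (simp add: Test_fun_inverse Cc_infty_divergence[OF \<phi>(1)])
  then have "ereal (\<integral>x. g x * divergence \<phi> x \<partial>lborel) \<le> TV W"
    using TV_upper[OF \<phi>, of W] by simp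
  also note W(2)
  finally show ?thesis by simp
qed

text \<open>Two integrations by parts around the chain rule: the gradient of the softened absolute
  value is \<open>soft_sgn d (g x) *\<^sub>R grad g x\<close>, and the softened sign is absorbed
  into the field. The resulting field has compact support and norm at most 1, hence competes in the
  total variation of \<open>W\<close>.\<close>

lemma integral_soft_abs_le:
  fixes g :: "'a::euclidean_space \<Rightarrow> real"
  assumes W: "represents g W" "TV W \<le> ereal V" and g: "smooth g" "vanishes_at_infinity g" and d: "0 < d"
  shows "(\<integral>x. soft_abs d (g x) * divergence hardy_field x \<partial>lborel) \<le> V"
    and "(\<lambda>x. soft_abs d (g x)) \<in> Cc_infty"
proof -
  obtain R where R: "\<And>x. R < norm x \<Longrightarrow> \<bar>g x\<bar> \<le> d"
    using g(2) d unfolding vanishes_at_infinity_def by blast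
  show abs: "(\<lambda>x. soft_abs d (g x)) \<in> Cc_infty"
    using soft_abs_eq_0(1)[OF d] R
    by (intro Cc_inftyI[of _ R] smooth_compose_real[OF smooth_soft_abs(1)] g) auto
  have sgn: "(\<lambda>x. soft_sgn d (g x)) \<in> Cc_infty"
    using soft_abs_eq_0(2)[OF d] R
    by (intro Cc_inftyI[of _ R] smooth_compose_real[OF smooth_soft_abs(2)] g) auto
  define \<phi> where "\<phi> = (\<lambda>x. soft_sgn d (g x) *\<^sub>R hardy_field x)"
  have \<phi>: "\<phi> \<in> Cc_infty"
    unfolding \<phi>_def by (intro Cc_infty_scaleR Cc_infty_smooth[OF sgn] smooth_hardy_field disjI1[OF sgn])
  have "(\<integral>x. soft_abs d (g x) * divergence hardy_field x \<partial>lborel) =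
      - (\<integral>x. grad (\<lambda>x. soft_abs d (g x)) x \<bullet> hardy_field x \<partial>lborel)"
    by (rule integral_by_parts[OF Cc_infty_smooth[OF abs] smooth_hardy_field disjI1[OF abs]])
  also have "\<dots> = - (\<integral>x. grad g x \<bullet> \<phi> x \<partial>lborel)"
    by (simp add: grad_compose[OF g(1) soft_abs_DERIV[OF d]] \<phi>_def)
  also have "\<dots> = (\<integral>x. g x * divergence \<phi> x \<partial>lborel)"
    by (rule integral_by_parts[OF g(1) Cc_infty_smooth[OF \<phi>] disjI2[OF \<phi>], symmetric])
  also have "\<dots> \<le> V"
  proof (rule TV_integral_bound[OF W \<phi>])
    show "norm (\<phi> x) \<le> 1" for x
      using mult_mono[OF abs_soft_sgn_le norm_hardy_field_le] by (simp add: \<phi>_def)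
  qed
  finally show "(\<integral>x. soft_abs d (g x) * divergence hardy_field x \<partial>lborel) \<le> V" .
qed

lemma integrable_on_cball:
  fixes h :: "'a::euclidean_space \<Rightarrow> real"
  assumes "continuous_on UNIV h"
  shows "integrable lborel (\<lambda>x. indicator (cball 0 r) x * h x)"
  using borel_integrable_compact[of "cball 0 r" h] assms continuous_on_subset by auto

text \<open>Softening costs \<open>2 * d\<close> per unit of weight. On a ball the total weight is
  finite, so the cost can be made arbitrarily small; the bound itself does not depend on the
  radius.\<close>

lemma hardy:
  fixes g :: "'a::euclidean_space \<Rightarrow> real"
  assumes W: "represents g W" "TV W \<le> ereal V" and g: "smooth g" "vanishes_at_infinity g"
  shows "(real DIM('a) - 1) * (\<integral>x. indicator (cball 0 r) x * (\<bar>g x\<bar> * hardy_weight x) \<partial>lborel) \<le> V"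
proof (rule field_le_epsilon)
  fix e :: real assume e: "0 < e"
  let ?n = "real DIM('a) - 1"
  define P where "P = (\<integral>x. indicator (cball (0::'a) r) x * hardy_weight x \<partial>lborel)"
  have n: "0 \<le> ?n" using DIM_positive[where 'a = 'a] by simp
  have cw: "continuous_on UNIV (hardy_weight :: 'a \<Rightarrow> real)" and cg: "continuous_on UNIV g"
    by (intro smooth_continuous smooth_hardy_weight g)+
  have P: "0 \<le> P"
    unfolding P_def by (intro integral_nonneg_AE AE_I2 mult_nonneg_nonneg less_imp_le[OF hardy_weight_pos]) auto
  \<comment> \<open>Makes the total softening loss \<open>2 * d * (?n * P)\<close> at most
    \<open>e\<close>; the added 1 covers a vanishing product.\<close>
  define d where "d = e / (2 * (?n * P + 1))"
  have nP: "0 < ?n * P + 1" by (intro add_nonneg_pos mult_nonneg_nonneg n P) simp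
  have d: "0 < d" "2 * d * (?n * P) \<le> e"
    using e nP by (auto simp: d_def divide_simps mult_left_mono)
  have ig: "integrable lborel (\<lambda>x. indicator (cball 0 r) x * (\<bar>g x\<bar> * hardy_weight x))"
    by (intro integrable_on_cball continuous_intros cw cg)
  have iw: "integrable lborel (\<lambda>x. indicator (cball (0::'a) r) x * hardy_weight x)"
    by (rule integrable_on_cball[OF cw])
  have "?n * (\<integral>x. indicator (cball 0 r) x * (\<bar>g x\<bar> * hardy_weight x) \<partial>lborel) - 2 * d * (?n * P) =
      (\<integral>x. ?n * (indicator (cball 0 r) x * (\<bar>g x\<bar> * hardy_weight x)) -
        (?n * (2 * d)) * (indicator (cball 0 r) x * hardy_weight x) \<partial>lborel)"
    using ig iw by (simp add: P_def)
  also have "\<dots> \<le> (\<integral>x. soft_abs d (g x) * divergence hardy_field x \<partial>lborel)"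
  proof (rule integral_mono)
    show "integrable lborel (\<lambda>x. soft_abs d (g x) * divergence hardy_field x)"
      using integral_soft_abs_le(2)[OF W g d(1)]
      by (intro Cc_infty_integrable Cc_infty_mult smooth_divergence smooth_hardy_field Cc_infty_smooth disjI1)
    fix x :: 'a
    have w: "0 \<le> ?n * hardy_weight x" by (intro mult_nonneg_nonneg n less_imp_le[OF hardy_weight_pos])
    have "?n * (indicator (cball 0 r) x * (\<bar>g x\<bar> * hardy_weight x)) -
        (?n * (2 * d)) * (indicator (cball 0 r) x * hardy_weight x) =
        indicator (cball 0 r) x * ((\<bar>g x\<bar> - 2 * d) * (?n * hardy_weight x))"
      by (simp add: algebra_simps)
    also have "\<dots> \<le> soft_abs d (g x) * (?n * hardy_weight x)"
      using mult_right_mono[OF soft_abs_ge[OF d(1)] w, of "g x"] mult_nonneg_nonneg[OF soft_abs_nonneg[OF d(1)] w, of "g x"]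
      by (cases "x \<in> cball 0 r") auto
    also have "\<dots> \<le> soft_abs d (g x) * divergence hardy_field x"
      by (intro mult_left_mono divergence_hardy_field_ge soft_abs_nonneg d)
    finally show "?n * (indicator (cball 0 r) x * (\<bar>g x\<bar> * hardy_weight x)) -
        (?n * (2 * d)) * (indicator (cball 0 r) x * hardy_weight x) \<le> soft_abs d (g x) * divergence hardy_field x" .
  qed (use ig iw in simp)
  also have "\<dots> \<le> V" by (rule integral_soft_abs_le(1)[OF W g d(1)])
  finally show "?n * (\<integral>x. indicator (cball 0 r) x * (\<bar>g x\<bar> * hardy_weight x) \<partial>lborel) \<le> V + e"
    using d(2) by simp
qed

section \<open>Sublinear growth of the mass on balls\<close>

definition ball_mass :: "('a::euclidean_space \<Rightarrow> real) \<Rightarrow> real \<Rightarrow> real"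
  where "ball_mass g r = (\<integral>x. indicator (cball 0 r) x * \<bar>g x\<bar> \<partial>lborel)"

text \<open>On the line the volume of a ball is itself linear in the radius. Hence smallness of
  \<open>g\<close> outside a fixed ball suffices, and the mass of that ball is outgrown by
  \<open>R\<close>.\<close>

lemma ball_mass_dim_1:
  fixes g :: "'a::euclidean_space \<Rightarrow> real"
  assumes n: "DIM('a) = 1" and g: "continuous_on UNIV g" "vanishes_at_infinity g" and e: "0 < e"
  shows "\<exists>R0>0. \<forall>R\<ge>R0. ball_mass g (2 * R) \<le> e * R"
proof -
  let ?u = "unit_ball_vol (real DIM('a))"
  have u: "0 < ?u" by (rule unit_ball_vol_pos) simp
  \<comment> \<open>The ball of radius \<open>2 * R\<close> has volume \<open>?u * (2 * R)\<close>,
    so this \<open>d\<close> spends exactly \<open>e / 2 * R\<close>.\<close>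
  define d where "d = e / (4 * ?u)"
  have d: "0 < d" using u e by (simp add: d_def)
  obtain r where r: "\<And>x. r < norm x \<Longrightarrow> \<bar>g x\<bar> \<le> d"
    using g(2) d unfolding vanishes_at_infinity_def by blast
  define R0 where "R0 = 1 + 2 * \<bar>ball_mass g r\<bar> / e"
  have R0: "0 < R0" using e by (simp add: R0_def add_pos_nonneg)
  have "ball_mass g (2 * R) \<le> e * R" if R: "R0 \<le> R" for R
  proof -
    have R': "0 < R" using R R0 by simp
    have c: "continuous_on UNIV (\<lambda>x. \<bar>g x\<bar>)" by (intro continuous_intros g)
    have i: "integrable lborel (\<lambda>x. indicator (cball (0::'a) s) x * d)" for s
      by (rule integrable_on_cball) simp
    have "ball_mass g (2 * R) \<le> (\<integral>x. indicator (cball 0 r) x * \<bar>g x\<bar> + indicator (cball 0 (2 * R)) x * d \<partial>lborel)"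
      unfolding ball_mass_def
    proof (rule integral_mono)
      fix x :: 'a
      show "indicator (cball 0 (2 * R)) x * \<bar>g x\<bar> \<le> indicator (cball 0 r) x * \<bar>g x\<bar> + indicator (cball 0 (2 * R)) x * d"
        using r[of x] d by (auto simp: indicator_def not_le)
    qed (intro Bochner_Integration.integrable_add integrable_on_cball c i)+
    also have "\<dots> = ball_mass g r + (\<integral>x. indicator (cball (0::'a) (2 * R)) x * d \<partial>lborel)"
      unfolding ball_mass_def by (intro Bochner_Integration.integral_add integrable_on_cball c i)
    also have "(\<integral>x. indicator (cball (0::'a) (2 * R)) x * d \<partial>lborel) = ?u * (2 * R) * d"
      using R' n by (simp add: content_cball)
    also have "\<dots> = e / 2 * R" using less_imp_neq[OF u] by (simp add: d_def del: unit_ball_vol_pos)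
    also have "ball_mass g r \<le> e / 2 * R"
    proof -
      have "2 * \<bar>ball_mass g r\<bar> / e \<le> R" using R by (simp add: R0_def)
      then show ?thesis using e by (simp add: field_simps)
    qed
    finally show ?thesis by (simp add: mult.commute)
  qed
  with R0 show ?thesis by blast
qed

text \<open>In dimension at least 2 the Hardy integrals over balls are bounded, so their part
  outside a large ball is small. On the ball of radius \<open>2 * R\<close> the weight is at least
  \<open>1 / (3 * R)\<close>, so the mass outside the fixed ball is at most \<open>3 * R\<close>
  times that part.\<close>

lemma ball_mass_small:
  fixes g :: "'a::euclidean_space \<Rightarrow> real"
  assumes W: "represents g W" "TV W \<le> ereal V" and g: "smooth g" "vanishes_at_infinity g" and e: "0 < e"
  shows "\<exists>R0>0. \<forall>R\<ge>R0. ball_mass g (2 * R) \<le> e * R"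
proof (cases "DIM('a) = 1")
  case True
  then show ?thesis by (intro ball_mass_dim_1 smooth_continuous g e)
next
  case False
  then have n: "1 \<le> real DIM('a) - 1" using DIM_positive[where 'a = 'a] by linarith
  let ?h = "\<lambda>x. \<bar>g x\<bar> * hardy_weight x"
  define J where "J r = (\<integral>x. indicator (cball 0 r) x * ?h x \<partial>lborel)" for r
  have c: "continuous_on UNIV (\<lambda>x. \<bar>g x\<bar>)" and ch: "continuous_on UNIV ?h"
    by (intro continuous_intros smooth_continuous smooth_hardy_weight g)+
  have h0: "0 \<le> ?h x" for x using hardy_weight_pos[of x] by simp
  have J0: "0 \<le> J r" for r unfolding J_def using h0 by (intro integral_nonneg_AE AE_I2) simp
  have JV: "J r \<le> V" for r
  proof -
    have "1 * J r \<le> (real DIM('a) - 1) * J r" by (intro mult_right_mono n J0)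
    also have "\<dots> \<le> V" unfolding J_def by (rule hardy[OF W g])
    finally show ?thesis by simp
  qed
  have bdd: "bdd_above (range J)" using JV by (intro bdd_aboveI[of _ V]) auto
  define L where "L = (SUP r. J r)"
  \<comment> \<open>The tail \<open>e / 6\<close> is later multiplied by \<open>3 * R\<close>, which
    uses up half of \<open>e * R\<close>.\<close>
  have "L - e / 6 < L" using e by simp
  then obtain r where r: "L - e / 6 < J r"
    unfolding L_def using less_cSUP_iff[OF _ bdd] by auto
  have JL: "J s \<le> L" for s unfolding L_def by (rule cSUP_upper[OF _ bdd]) simp
  define R0 where "R0 = max 1 (2 * \<bar>ball_mass g r\<bar> / e)"
  have "ball_mass g (2 * R) \<le> e * R" if R: "R0 \<le> R" "r \<le> 2 * R" for R
  proof -
    have R1: "1 \<le> R" using R by (simp add: R0_def)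
    \<comment> \<open>For \<open>R \<ge> 1\<close> one has
      \<open>1 + 4 * R\<^sup>2 \<le> 9 * R\<^sup>2\<close>; the right-hand side is a perfect square,
      which gives the factor 3.\<close>
    have weight: "1 \<le> 3 * R * hardy_weight x" if "x \<in> cball 0 (2 * R)" for x :: 'a
    proof (rule power2_le_imp_le)
      have "(norm x)\<^sup>2 \<le> (2 * R)\<^sup>2" using that by (intro power_mono) auto
      then have "1 + x \<bullet> x \<le> 1 + 4 * R\<^sup>2" by (simp add: power2_norm_eq_inner power_mult_distrib)
      also have "\<dots> \<le> 9 * R\<^sup>2" using one_le_power[OF R1, of 2] by linarith
      finally have "(hardy_weight x)\<^sup>2 * (1 + x \<bullet> x) \<le> (hardy_weight x)\<^sup>2 * (9 * R\<^sup>2)"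
        by (rule mult_left_mono) simp
      then show "1\<^sup>2 \<le> (3 * R * hardy_weight x)\<^sup>2"
        unfolding hardy_weight_sq by (simp add: power_mult_distrib mult.commute)
      show "0 \<le> 3 * R * hardy_weight x" using R1 hardy_weight_pos[of x] by simp
    qed
    have "ball_mass g (2 * R) \<le> (\<integral>x. indicator (cball 0 r) x * \<bar>g x\<bar> +
        (3 * R) * (indicator (cball 0 (2 * R)) x * ?h x - indicator (cball 0 r) x * ?h x) \<partial>lborel)"
      unfolding ball_mass_def
    proof (rule integral_mono)
      fix x :: 'a
      show "indicator (cball 0 (2 * R)) x * \<bar>g x\<bar> \<le> indicator (cball 0 r) x * \<bar>g x\<bar> +
          (3 * R) * (indicator (cball 0 (2 * R)) x * ?h x - indicator (cball 0 r) x * ?h x)"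
      proof (cases "x \<in> cball 0 (2 * R) \<and> x \<notin> cball 0 r")
        case True
        then have "\<bar>g x\<bar> * 1 \<le> \<bar>g x\<bar> * (3 * R * hardy_weight x)"
          by (intro mult_left_mono weight) auto
        then show ?thesis using True by (simp add: mult_ac)
      next
        case False
        then show ?thesis using R(2) h0[of x] by (auto simp: indicator_def)
      qed
    qed (intro Bochner_Integration.integrable_add Bochner_Integration.integrable_diff integrable_mult_right
        integrable_on_cball c ch)+
    also have "\<dots> = ball_mass g r + (3 * R) * (J (2 * R) - J r)"
      unfolding ball_mass_def J_def using integrable_on_cball[OF c] integrable_on_cball[OF ch] by simp
    also have "\<dots> \<le> e / 2 * R + (3 * R) * (e / 6)"
    proof (intro add_mono mult_left_mono)
      show "J (2 * R) - J r \<le> e / 6" using JL[of "2 * R"] r by simp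
      have "2 * \<bar>ball_mass g r\<bar> / e \<le> R" using R by (simp add: R0_def)
      then show "ball_mass g r \<le> e / 2 * R" using e by (simp add: field_simps)
    qed (use R1 in simp)
    finally show ?thesis by (simp add: mult.commute)
  qed
  \<comment> \<open>The maximum with the absolute value of \<open>r\<close> ensures
    \<open>r \<le> 2 * R\<close>, so that the balls are nested.\<close>
  then show ?thesis
    by (intro exI[of _ "max R0 \<bar>r\<bar>"]) (auto simp: R0_def)
qed



section \<open>Truncation and the approximation theorem\<close>

definition truncate :: "real \<Rightarrow> ('a::euclidean_space \<Rightarrow> real) \<Rightarrow> 'a \<Rightarrow> real"
  where "truncate R g x = bump R x * g x - (\<integral>x. bump R x * g x \<partial>lborel) * unit_bump R x"

lemma bump_mult_integrable:
  assumes "0 < R" "smooth h"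
  shows "integrable lborel (\<lambda>x. bump R x * h x :: real)"
  by (intro Cc_infty_integrable Cc_infty_mult smooth_bump disjI1 bump_Cc_infty assms)

lemma truncate_Cc_infty_av:
  fixes g :: "'a::euclidean_space \<Rightarrow> real"
  assumes R: "0 < R" and g: "smooth g"
  shows "truncate R g \<in> Cc_infty_av"
proof -
  have "truncate R g \<in> Cc_infty"
    unfolding truncate_def[abs_def]
    by (intro Cc_infty_diff Cc_infty_mult smooth_bump smooth_const g disjI1[OF bump_Cc_infty[OF R]]
        disjI2[OF unit_bump_Cc_infty[OF R]] Cc_infty_smooth[OF unit_bump_Cc_infty[OF R]])
  moreover have "(\<integral>x. truncate R g x \<partial>lborel) = 0"
    using integral_unit_bump[OF R, where 'a = 'a]
    by (simp add: truncate_def Bochner_Integration.integral_diff[OF bump_mult_integrable[OF R g]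
          integrable_mult_right[OF Cc_infty_integrable[OF unit_bump_Cc_infty[OF R]]]])
  ultimately show ?thesis by (simp add: Cc_infty_av_def)
qed

lemma truncate_mult_integral:
  fixes g h :: "'a::euclidean_space \<Rightarrow> real"
  assumes R: "0 < R" and g: "smooth g" and h: "smooth h"
  shows "(\<integral>x. truncate R g x * h x \<partial>lborel) =
    (\<integral>x. bump R x * (g x * h x) \<partial>lborel) -
    (\<integral>x. bump R x * g x \<partial>lborel) * (\<integral>x. unit_bump R x * h x \<partial>lborel)"
proof -
  have i: "integrable lborel (\<lambda>x. (\<integral>x. bump R x * g x \<partial>lborel) * (unit_bump R x * h x))"
    by (intro integrable_mult_right Cc_infty_integrable Cc_infty_mult h disjI1[OF unit_bump_Cc_infty[OF R]]
        Cc_infty_smooth[OF unit_bump_Cc_infty[OF R]])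
  have "(\<integral>x. truncate R g x * h x \<partial>lborel) =
      (\<integral>x. bump R x * (g x * h x) - (\<integral>x. bump R x * g x \<partial>lborel) * (unit_bump R x * h x) \<partial>lborel)"
    by (simp add: truncate_def algebra_simps)
  also have "\<dots> = (\<integral>x. bump R x * (g x * h x) \<partial>lborel) -
      (\<integral>x. (\<integral>x. bump R x * g x \<partial>lborel) * (unit_bump R x * h x) \<partial>lborel)"
    by (intro Bochner_Integration.integral_diff bump_mult_integrable R smooth_mult g h i)
  finally show ?thesis by simp
qed

lemma on_test_cutoff:
  fixes W :: "'a::euclidean_space Dm1"
  assumes R: "0 < R" and g: "smooth g" and W: "represents g W"
  shows "on_test W (cutoff R \<phi>) = (\<integral>x. truncate R g x * fun_of \<phi> x \<partial>lborel)"
proof -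
  have i: "integrable lborel (\<lambda>x. bump R x * (g x * fun_of \<phi> x))" "integrable lborel (\<lambda>x. bump R x * g x)"
    by (intro bump_mult_integrable R smooth_mult g smooth_fun_of)+
  have "on_test W (cutoff R \<phi>) =
      (\<integral>x. bump R x * (g x * fun_of \<phi> x) - (bump R x * g x) * bump_mean R \<phi> \<partial>lborel)"
    using W unfolding represents_def by (simp add: fun_of_cutoff[OF R] algebra_simps)
  also have "\<dots> = (\<integral>x. truncate R g x * fun_of \<phi> x \<partial>lborel)"
    using i by (simp add: truncate_mult_integral[OF R g smooth_fun_of] bump_mean_def)
  finally show ?thesis .
qed

text \<open>The bump is 1 on the support of \<open>u\<close>, and the integral being subtracted is
  that of \<open>u\<close>, namely 0. So truncation does nothing to \<open>u\<close>.\<close>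

lemma on_test_cutoff_eq:
  fixes W :: "'a::euclidean_space Dm1"
  assumes R: "0 < R" and u: "u \<in> Cc_infty_av" "\<And>x. R < norm x \<Longrightarrow> u x = 0" and W: "represents u W"
  shows "on_test W (cutoff R \<phi>) = on_test W \<phi>"
proof -
  have bu: "bump R x * u x = u x" for x
    using bump_eq_1[OF R, of x] u(2)[of x] by (cases "R < norm x") (auto simp: not_less)
  moreover have "(\<integral>x. u x \<partial>lborel) = 0"
    using u(1) by (simp add: Cc_infty_av_def)
  ultimately have "truncate R u = u"
    by (simp only: truncate_def[abs_def] mult_zero_left diff_zero)
  then show ?thesis
    using on_test_cutoff[OF R _ W] W u(1) by (simp add: represents_def Cc_infty_av_def Cc_infty_smooth)
qed

text \<open>A dense class of functionals is fixed by all large cutoffs, and the cutoffs are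
  uniformly bounded; together this is convergence on every functional. The threshold depends on
  \<open>W\<close>, not on \<phi>.\<close>

lemma cutoff_pullback_approx:
  fixes W :: "'a::euclidean_space Dm1"
  assumes e: "0 < e"
  obtains R0 where "0 < R0"
    "\<And>R W'. R0 \<le> R \<Longrightarrow> (\<And>\<phi>. on_test W' \<phi> = on_test W (cutoff R \<phi>)) \<Longrightarrow> norm (W' - W) \<le> e"
proof -
  obtain C where C: "0 \<le> C" "\<And>R u. 0 < R \<Longrightarrow> norm (cutoff R (u :: 'a test_fun)) \<le> C * norm u"
    by (rule cutoff_bounded) blast
  \<comment> \<open>The approximation error enters once through the cutoff, with factor
    \<open>C\<close>, and once directly.\<close>
  define d where "d = e / (C + 1)"
  have d: "0 < d" "d * (C + 1) = e" using e C(1) by (auto simp: d_def)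
  obtain v W0 where W0: "\<And>\<phi>. on_test W0 \<phi> = inner v \<phi>" "norm (W - W0) \<le> d"
    using Dm1_approx_inner[OF d(1)] by metis
  obtain u where u: "u \<in> Cc_infty_av" "represents u W0"
    by (rule represents_inner[OF W0(1)]) blast
  obtain R0 where R0: "0 < R0" "\<And>x. R0 < norm x \<Longrightarrow> u x = 0"
    using u(1) Cc_inftyE unfolding Cc_infty_av_def by blast
  show thesis
  proof (rule that[OF R0(1)])
    fix R W' assume R: "R0 \<le> R" and W': "\<And>\<phi>. on_test W' \<phi> = on_test W (cutoff R \<phi>)"
    have R': "0 < R" using R R0(1) by simp
    show "norm (W' - W) \<le> e"
    proof (rule norm_Dm1_le)
      fix \<phi>
      have "on_test W0 (cutoff R \<phi>) = on_test W0 \<phi>"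
        by (rule on_test_cutoff_eq[OF R' u(1) _ u(2)]) (use R R0(2) in auto)
      then have "on_test (W' - W) \<phi> = on_test (W - W0) (cutoff R \<phi>) - on_test (W - W0) \<phi>"
        by (simp add: blinfun.diff_left W')
      also have "\<bar>\<dots>\<bar> \<le> \<bar>on_test (W - W0) (cutoff R \<phi>)\<bar> + \<bar>on_test (W - W0) \<phi>\<bar>"
        by (rule abs_triangle_ineq4)
      also have "\<dots> \<le> norm (W - W0) * norm (cutoff R \<phi>) + norm (W - W0) * norm \<phi>"
        by (intro add_mono on_test_bound)
      also have "\<dots> \<le> d * (C * norm \<phi>) + d * norm \<phi>"
        using d(1) by (intro add_mono mult_mono W0 C R') auto
      also have "\<dots> = e * norm \<phi>" unfolding d(2)[symmetric] by (simp add: algebra_simps)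
      finally show "\<bar>on_test (W' - W) \<phi>\<bar> \<le> e * norm \<phi>" .
    qed (use e in simp)
  qed
qed

lemma integral_bump_mult_le:
  fixes g :: "'a::euclidean_space \<Rightarrow> real"
  assumes R: "0 < R" and g: "smooth g"
  shows "\<bar>\<integral>x. bump R x * g x \<partial>lborel\<bar> \<le> ball_mass g (2 * R)"
proof -
  have "norm (\<integral>x. bump R x * g x \<partial>lborel) \<le> ball_mass g (2 * R)"
    unfolding ball_mass_def
  proof (rule Bochner_Integration.integral_norm_bound_integral[OF bump_mult_integrable[OF R g]])
    show "integrable lborel (\<lambda>x. indicator (cball 0 (2 * R)) x * \<bar>g x\<bar>)"
      by (intro integrable_on_cball continuous_intros smooth_continuous g)
    show "norm (bump R x * g x) \<le> indicator (cball 0 (2 * R)) x * \<bar>g x\<bar>" for x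
      using bump_eq_0[OF R, of x] bump_nonneg[of R x] bump_le_1[of R x]
      by (cases "x \<in> cball 0 (2 * R)") (auto simp: abs_mult mult_left_le_one_le)
  qed
  then show ?thesis by simp
qed

text \<open>Stated for a general \<open>h\<close>, since it serves twice: with \<open>g\<close> for
  the commutator of cutoff and divergence, and with the constant 1 for the mean of the
  divergence.\<close>

lemma integral_grad_bump_le:
  fixes h :: "'a::euclidean_space \<Rightarrow> real" and \<phi> :: "'a \<Rightarrow> 'a"
  assumes R: "0 < R" and K: "\<And>x::'a. norm (grad (bump R) x) \<le> K"
    and h: "smooth h" and \<phi>: "\<phi> \<in> Cc_infty" "\<And>x. norm (\<phi> x) \<le> 1"
  shows "\<bar>\<integral>x. h x * (grad (bump R) x \<bullet> \<phi> x) \<partial>lborel\<bar> \<le> K * ball_mass h (2 * R)"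
proof -
  have "norm (\<integral>x. h x * (grad (bump R) x \<bullet> \<phi> x) \<partial>lborel) \<le>
      (\<integral>x. K * (indicator (cball 0 (2 * R)) x * \<bar>h x\<bar>) \<partial>lborel)"
  proof (rule Bochner_Integration.integral_norm_bound_integral)
    have G: "(\<lambda>x. grad (bump R) x \<bullet> \<phi> x) \<in> Cc_infty"
      by (intro Cc_infty_bilinear[OF bounded_bilinear_inner] smooth_grad smooth_bump Cc_infty_smooth disjI2 \<phi>)
    show "integrable lborel (\<lambda>x. h x * (grad (bump R) x \<bullet> \<phi> x))"
      by (rule Cc_infty_integrable[OF Cc_infty_mult[OF h Cc_infty_smooth[OF G] disjI2[OF G]]])
    show "integrable lborel (\<lambda>x. K * (indicator (cball 0 (2 * R)) x * \<bar>h x\<bar>))"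
      by (intro integrable_mult_right integrable_on_cball continuous_intros smooth_continuous h)
    show "norm (h x * (grad (bump R) x \<bullet> \<phi> x)) \<le> K * (indicator (cball 0 (2 * R)) x * \<bar>h x\<bar>)" for x
    proof (cases "x \<in> cball 0 (2 * R)")
      case True
      have "\<bar>grad (bump R) x \<bullet> \<phi> x\<bar> \<le> norm (grad (bump R) x) * norm (\<phi> x)" by (rule Cauchy_Schwarz_ineq2)
      also have "\<dots> \<le> K * 1" by (intro mult_mono K \<phi> order_trans[OF norm_ge_zero K]) auto
      finally have "\<bar>h x\<bar> * \<bar>grad (bump R) x \<bullet> \<phi> x\<bar> \<le> \<bar>h x\<bar> * K" by (intro mult_left_mono) auto
      then show ?thesis using True by (simp add: abs_mult mult.commute)
    next
      case False
      then show ?thesis using grad_bump_eq_0[OF R, of x] by simp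
    qed
  qed
  then show ?thesis by (simp add: ball_mass_def)
qed

text \<open>The 1 is the commutator term of the product rule, the power of 2 the subtracted mean:
  integrating by parts bounds the mean of a divergence by \<open>K\<close> times the volume ratio of
  the balls of radius \<open>2 * R\<close> and \<open>R\<close>.\<close>

lemma TV_cutoff_le:
  fixes W :: "'a::euclidean_space Dm1"
  assumes R: "0 < R" and K: "0 \<le> K" "\<And>x::'a. norm (grad (bump R) x) \<le> K"
    and g: "smooth g" and W: "represents g W" "TV W \<le> ereal V"
    and W': "\<And>\<phi>. on_test W' \<phi> = on_test W (cutoff R \<phi>)"
  shows "TV W' \<le> ereal (V + (1 + 2 ^ DIM('a)) * (K * ball_mass g (2 * R)))"
proof (rule TV_leI)
  fix \<phi> :: "'a \<Rightarrow> 'a" assume \<phi>: "\<phi> \<in> Cc_infty" "\<And>x. norm (\<phi> x) \<le> 1"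
  note s\<phi> = Cc_infty_smooth[OF \<phi>(1)]
  let ?m = "ball_mass g (2 * R)"
  let ?V = "measure lborel (cball (0::'a) R)"
  have m0: "0 \<le> ?m" unfolding ball_mass_def by (intro integral_nonneg_AE AE_I2) simp
  have b\<phi>: "(\<lambda>x. bump R x *\<^sub>R \<phi> x) \<in> Cc_infty"
    by (intro Cc_infty_scaleR smooth_bump s\<phi> disjI2 \<phi>)
  note Db = Cc_infty_divergence[OF b\<phi>]
  have Gb: "(\<lambda>x. grad (bump R) x \<bullet> \<phi> x) \<in> Cc_infty"
    by (intro Cc_infty_bilinear[OF bounded_bilinear_inner] smooth_grad smooth_bump s\<phi> disjI2 \<phi>)
  have ig: "integrable lborel (\<lambda>x. g x * (grad (bump R) x \<bullet> \<phi> x))"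
    by (rule Cc_infty_integrable[OF Cc_infty_mult[OF g Cc_infty_smooth[OF Gb] disjI2[OF Gb]]])
  \<comment> \<open>The bump is moved into the field: the bumped field still has norm at most 1 and
    is charged to the total variation, leaving only the gradient of the bump.\<close>
  have "(\<integral>x. bump R x * (g x * divergence \<phi> x) \<partial>lborel) =
      (\<integral>x. g x * divergence (\<lambda>x. bump R x *\<^sub>R \<phi> x) x - g x * (grad (bump R) x \<bullet> \<phi> x) \<partial>lborel)"
    by (simp add: divergence_scaleR[OF smooth_bump s\<phi>] algebra_simps)
  also have "\<dots> = (\<integral>x. g x * divergence (\<lambda>x. bump R x *\<^sub>R \<phi> x) x \<partial>lborel) - (\<integral>x. g x * (grad (bump R) x \<bullet> \<phi> x) \<partial>lborel)"
    by (rule Bochner_Integration.integral_diff[OF Cc_infty_integrable[OF Cc_infty_mult[OF g Cc_infty_smooth[OF Db] disjI2[OF Db]]] ig])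
  also have "\<dots> \<le> V + K * ?m"
  proof -
    have "norm (bump R x *\<^sub>R \<phi> x) \<le> 1" for x
      using mult_mono[OF bump_le_1[of R x] \<phi>(2)[of x]] bump_nonneg[of R x] by simp
    then have "(\<integral>x. g x * divergence (\<lambda>x. bump R x *\<^sub>R \<phi> x) x \<partial>lborel) \<le> V"
      by (rule TV_integral_bound[OF W b\<phi>])
    then show ?thesis using integral_grad_bump_le[OF R K(2) g \<phi>] by linarith
  qed
  finally have 1: "(\<integral>x. bump R x * (g x * divergence \<phi> x) \<partial>lborel) \<le> V + K * ?m" .
  have 2: "\<bar>\<integral>x. unit_bump R x * divergence \<phi> x \<partial>lborel\<bar> \<le> K * 2 ^ DIM('a)"
  proof -
    define B where "B = (\<integral>x. bump R (x::'a) \<partial>lborel)"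
    have V: "0 < ?V" by (rule measure_cball_pos[OF R])
    have B: "?V \<le> B" unfolding B_def by (rule integral_bump_ge[OF R])
    have B0: "0 < B" using V B by linarith
    have "(\<integral>x. bump R x * divergence \<phi> x \<partial>lborel) = - (\<integral>x. 1 * (grad (bump R) x \<bullet> \<phi> x) \<partial>lborel)"
      using integral_by_parts[OF smooth_bump s\<phi> disjI2[OF \<phi>(1)]] by simp
    then have "\<bar>\<integral>x. bump R x * divergence \<phi> x \<partial>lborel\<bar> \<le> K * ball_mass (\<lambda>x::'a. 1) (2 * R)"
      using integral_grad_bump_le[OF R K(2) smooth_const \<phi>, of 1] by simp
    also have "ball_mass (\<lambda>x::'a. 1) (2 * R) = 2 ^ DIM('a) * ?V"
      using R by (simp add: ball_mass_def content_cball power_mult_distrib)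
    finally have "\<bar>\<integral>x. bump R x * divergence \<phi> x \<partial>lborel\<bar> \<le> K * 2 ^ DIM('a) * ?V" by simp
    also have "\<dots> \<le> K * 2 ^ DIM('a) * B" using K(1) by (intro mult_left_mono B) auto
    finally have "\<bar>\<integral>x. bump R x * divergence \<phi> x \<partial>lborel\<bar> / B \<le> K * 2 ^ DIM('a)"
      using B0 by (simp add: divide_le_eq)
    moreover have "(\<integral>x. unit_bump R x * divergence \<phi> x \<partial>lborel) = (\<integral>x. bump R x * divergence \<phi> x \<partial>lborel) / B"
      by (simp add: unit_bump_def B_def)
    ultimately show ?thesis using B0 by (simp add: abs_divide)
  qed
  have "on_test W' (Test_fun (divergence \<phi>)) =
      (\<integral>x. bump R x * (g x * divergence \<phi> x) \<partial>lborel) -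
      (\<integral>x. bump R x * g x \<partial>lborel) * (\<integral>x. unit_bump R x * divergence \<phi> x \<partial>lborel)"
    by (simp add: W' on_test_cutoff[OF R g W(1)] Test_fun_inverse[OF Cc_infty_divergence[OF \<phi>(1)]]
        truncate_mult_integral[OF R g smooth_divergence[OF s\<phi>]])
  also have "\<dots> \<le> (V + K * ?m) + ?m * (K * 2 ^ DIM('a))"
  proof -
    have "\<bar>(\<integral>x. bump R x * g x \<partial>lborel) * (\<integral>x. unit_bump R x * divergence \<phi> x \<partial>lborel)\<bar> \<le> ?m * (K * 2 ^ DIM('a))"
      unfolding abs_mult by (intro mult_mono integral_bump_mult_le R g 2 m0) simp
    with 1 show ?thesis by linarith
  qed
  also have "\<dots> = V + (1 + 2 ^ DIM('a)) * (K * ?m)" by (simp add: algebra_simps)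
  finally show "ereal (on_test W' (Test_fun (divergence \<phi>))) \<le> ereal (V + (1 + 2 ^ DIM('a)) * (K * ?m))"
    by simp
qed

lemma Dm1_truncate:
  fixes W :: "'a::euclidean_space Dm1"
  assumes W: "represents g W" "TV W \<le> ereal V" and g: "smooth g" "vanishes_at_infinity g" and e: "0 < e"
  obtains u W' where "u \<in> Cc_infty_av" "represents u W'" "norm (W' - W) \<le> e" "TV W' \<le> ereal (V + e)"
proof -
  obtain K where K: "0 < K" "\<And>r x. 0 < r \<Longrightarrow> norm (grad (bump r) (x::'a)) \<le> K / r"
    by (rule grad_bump_bound) blast
  obtain R1 where R1: "0 < R1"
    "\<And>R W'. R1 \<le> R \<Longrightarrow> (\<And>\<phi>. on_test W' \<phi> = on_test W (cutoff R \<phi>)) \<Longrightarrow> norm (W' - W) \<le> e"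
    by (rule cutoff_pullback_approx[OF e, of W]) blast
  \<comment> \<open>In \<open>TV_cutoff_le\<close> the gradient bound is \<open>K / R\<close> and
    the mass is at most \<open>d * R\<close>, so the radius cancels and the total growth is
    \<open>e\<close>.\<close>
  define d where "d = e / ((1 + 2 ^ DIM('a)) * K)"
  have p: "0 < (1 + 2 ^ DIM('a)) * K" using K(1) by (intro mult_pos_pos add_pos_pos) auto
  then have d: "0 < d" "(1 + 2 ^ DIM('a)) * K * d = e" using e by (auto simp: d_def)
  obtain R2 where R2: "0 < R2" "\<And>R. R2 \<le> R \<Longrightarrow> ball_mass g (2 * R) \<le> d * R"
    using ball_mass_small[OF W g d(1)] by blast
  define R where "R = max R1 R2"
  have R: "0 < R" "R1 \<le> R" "R2 \<le> R" using R1(1) by (auto simp: R_def)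
  obtain C where C: "0 \<le> C" "\<And>R u. 0 < R \<Longrightarrow> norm (cutoff R (u :: 'a test_fun)) \<le> C * norm u"
    by (rule cutoff_bounded) blast
  obtain W' where W': "\<And>\<phi>. on_test W' \<phi> = on_test W (cutoff R \<phi>)"
    by (rule Dm1_pullback[OF linear_cutoff[OF R(1)] C(2)[OF R(1)] C(1), of W]) blast
  show thesis
  proof (rule that)
    show "truncate R g \<in> Cc_infty_av" by (rule truncate_Cc_infty_av[OF R(1) g(1)])
    show "represents (truncate R g) W'"
      unfolding represents_def by (simp add: W' on_test_cutoff[OF R(1) g(1) W(1)])
    show "norm (W' - W) \<le> e" by (rule R1(2)[OF R(2) W'])
    have "TV W' \<le> ereal (V + (1 + 2 ^ DIM('a)) * (K / R * ball_mass g (2 * R)))"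
      using K R by (intro TV_cutoff_le[OF R(1) _ _ g(1) W W']) auto
    also have "\<dots> \<le> ereal (V + e)"
    proof -
      have "K / R * ball_mass g (2 * R) \<le> K / R * (d * R)"
        using K R by (intro mult_left_mono R2) auto
      also have "\<dots> = K * d" using R by simp
      finally have "(1 + 2 ^ DIM('a)) * (K / R * ball_mass g (2 * R)) \<le> (1 + 2 ^ DIM('a)) * (K * d)"
        by (intro mult_left_mono) auto
      then show ?thesis using d(2) by (simp add: mult.assoc)
    qed
    finally show "TV W' \<le> ereal (V + e)" .
  qed
qed

lemma Dm1_approx:
  fixes w :: "'a::euclidean_space Dm1"
  assumes e: "0 < e"
  obtains u W where "u \<in> Cc_infty_av" "represents u W" "norm (W - w) \<le> e" "TV W \<le> TV w + ereal e"
proof (cases "TV w = \<infinity>")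
  case True
  obtain v W where W: "\<And>\<phi>. on_test W \<phi> = inner v \<phi>" "norm (w - W) \<le> e"
    using Dm1_approx_inner[OF e] by metis
  obtain u where "u \<in> Cc_infty_av" "represents u W" by (rule represents_inner[OF W(1)]) blast
  then show thesis using W(2) True by (intro that[of u W]) (auto simp: norm_minus_commute)
next
  case False
  then obtain V where V: "TV w = ereal V" using TV_nonneg[of w] by (cases "TV w") auto
  have e2: "0 < e / 2" using e by simp
  obtain W g where W: "norm (W - w) \<le> e / 2" "TV W \<le> TV w" "smooth g" "represents g W" "vanishes_at_infinity g"
    by (rule Dm1_mollify[OF e2, of w]) blast
  obtain u W' where W': "u \<in> Cc_infty_av" "represents u W'" "norm (W' - W) \<le> e / 2" "TV W' \<le> ereal (V + e / 2)"
    by (rule Dm1_truncate[OF W(4) W(2)[unfolded V] W(3,5) e2]) blast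
  show thesis
  proof (rule that[OF W'(1,2)])
    have "norm (W' - w) \<le> norm (W' - W) + norm (W - w)" using norm_triangle_ineq[of "W' - W" "W - w"] by simp
    then show "norm (W' - w) \<le> e" using W(1) W'(3) by simp
    have "TV W' \<le> ereal (V + e / 2)" by (rule W'(4))
    also have "\<dots> \<le> TV w + ereal e" using e by (simp add: V)
    finally show "TV W' \<le> TV w + ereal e" .
  qed
qed

theorem lemma7:
  fixes w :: "'a::euclidean_space Dm1"
  shows "\<exists>(u :: nat \<Rightarrow> 'a \<Rightarrow> real) (W :: nat \<Rightarrow> 'a Dm1).
    (\<forall>k. u k \<in> Cc_infty_av \<and> represents (u k) (W k)) \<and>
    W \<longlonglongrightarrow> w \<and>
    (\<lambda>k. TV (W k)) \<longlonglongrightarrow> TV w"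
proof -
  have "\<exists>u W. u \<in> Cc_infty_av \<and> represents u W \<and> norm (W - w) \<le> inverse (real (Suc k)) \<and>
      TV W \<le> TV w + ereal (inverse (real (Suc k)))" for k
    by (rule Dm1_approx[of "inverse (real (Suc k))" w]) auto
  then obtain u W where uW: "\<And>k. u k \<in> Cc_infty_av" "\<And>k. represents (u k) (W k)"
    "\<And>k. norm (W k - w) \<le> inverse (real (Suc k))" "\<And>k. TV (W k) \<le> TV w + ereal (inverse (real (Suc k)))"
    by metis
  have "(\<lambda>k. W k - w) \<longlonglongrightarrow> 0"
    by (rule Lim_null_comparison[OF _ LIMSEQ_inverse_real_of_nat]) (use uW(3) in simp)
  then have lim: "W \<longlonglongrightarrow> w" by (simp add: LIM_zero_iff)
  show ?thesis
    by (intro exI[of _ u] exI[of _ W] conjI allI uW lim TV_tendsto[OF lim uW(4)])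
qed

end
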